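(* Let $A\subseteq 2^\omega$ be a Lebesgue null set that is closed under hyperarithmetic equivalence $\equiv_h$ and contains no hyperarithmetic real. Then the set $\mathcal{U}_h(A)=\{x\in 2^\omega:\exists y\in A\ (x\ge_h y)\}$ is null.
   Context: $x\ge_h y$ means $y$ is hyperarithmetic in $x$ (i.e. $y\in\Delta^1_1(x)$); $\equiv_h$ is the induced equivalence. A set of reals closed under $\equiv_h$ is identified with a set of hyperdegrees; "contains no hyperarithmetic real" means it does not contain the least hyperdegree $\mathbf{0}$. Null means Lebesgue (outer) measure zero. *)

theory Defs
  imports "HOL-Probability.Probability"
begin

type_synonym cantor = "nat \<Rightarrow> bool"

definition cantor_measure :: "cantor measure" where
  "cantor_measure = PiM UNIV (\<lambda>_. measure_pmf (bernoulli_pmf (1/2)))"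

definition null :: "cantor set \<Rightarrow> bool" where
  "null A \<longleftrightarrow> (\<exists>B \<in> sets cantor_measure. A \<subseteq> B \<and> emeasure cantor_measure B = 0)"

datatype trm = TVar nat | TZero | TSuc trm | TPlus trm trm | TTimes trm trm

text \<open>Arithmetical formulas; number variables are de Bruijn indices.
  InX refers to the real parameter X, InZ to the (single) set variable Z.\<close>
datatype fm = FEq trm trm | FLess trm trm | InX trm | InZ trm
  | FNeg fm | FConj fm fm | FEx fm

fun evalt :: "(nat \<Rightarrow> nat) \<Rightarrow> trm \<Rightarrow> nat" where
  "evalt e (TVar i) = e i"
| "evalt e TZero = 0"
| "evalt e (TSuc t) = Suc (evalt e t)"
| "evalt e (TPlus s t) = evalt e s + evalt e t"
| "evalt e (TTimes s t) = evalt e s * evalt e t"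

definition push :: "nat \<Rightarrow> (nat \<Rightarrow> nat) \<Rightarrow> nat \<Rightarrow> nat" where
  "push n e = (\<lambda>i. case i of 0 \<Rightarrow> n | Suc j \<Rightarrow> e j)"

fun sat :: "cantor \<Rightarrow> cantor \<Rightarrow> (nat \<Rightarrow> nat) \<Rightarrow> fm \<Rightarrow> bool" where
  "sat X Z e (FEq s t) = (evalt e s = evalt e t)"
| "sat X Z e (FLess s t) = (evalt e s < evalt e t)"
| "sat X Z e (InX t) = X (evalt e t)"
| "sat X Z e (InZ t) = Z (evalt e t)"
| "sat X Z e (FNeg \<phi>) = (\<not> sat X Z e \<phi>)"
| "sat X Z e (FConj \<phi> \<psi>) = (sat X Z e \<phi> \<and> sat X Z e \<psi>)"
| "sat X Z e (FEx \<phi>) = (\<exists>n. sat X Z (push n e) \<phi>)"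

text \<open>Sigma^1_1(x) and Pi^1_1(x) subsets of omega (normal form with one set quantifier
  and an arithmetical matrix; free number variable 0 is the argument).\<close>
definition Sigma11 :: "cantor \<Rightarrow> cantor \<Rightarrow> bool" where
  "Sigma11 x y \<longleftrightarrow> (\<exists>\<phi>. \<forall>n. y n \<longleftrightarrow> (\<exists>Z. sat x Z (push n (\<lambda>_. 0)) \<phi>))"

definition Pi11 :: "cantor \<Rightarrow> cantor \<Rightarrow> bool" where
  "Pi11 x y \<longleftrightarrow> (\<exists>\<phi>. \<forall>n. y n \<longleftrightarrow> (\<forall>Z. sat x Z (push n (\<lambda>_. 0)) \<phi>))"

definition hyp_le :: "cantor \<Rightarrow> cantor \<Rightarrow> bool" where
  "hyp_le y x \<longleftrightarrow> Sigma11 x y \<and> Pi11 x y"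

definition hyp_equiv :: "cantor \<Rightarrow> cantor \<Rightarrow> bool" where
  "hyp_equiv x y \<longleftrightarrow> hyp_le x y \<and> hyp_le y x"

definition hyperarithmetic :: "cantor \<Rightarrow> bool" where
  "hyperarithmetic y \<longleftrightarrow> hyp_le y (\<lambda>_. False)"

definition upper_cone_h :: "cantor set \<Rightarrow> cantor set" where
  "upper_cone_h A = {x. \<exists>y\<in>A. hyp_le y x}"

end

theory Submission
  imports Defs
begin

text \<open>
  Fix the two formulas that define \<open>y = \<Phi> x\<close> from \<open>x\<close>; there are only countably many pairs. It
  suffices to find a hyperarithmetic measure \<open>\<mu>\<close> that dominates, up to a small error, the image
  under \<open>\<Phi>\<close> of the uniform measure restricted to a clopen set \<open>N\<close> which the set \<open>X\<close> of all \<open>x\<close>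
  with \<open>\<Phi> x \<in> A\<close> almost fills. Indeed, let \<open>r\<close> be the value of the distribution function of \<open>\<mu>\<close> at
  \<open>y\<close>, and \<open>z\<close> its sequence of binary digits. If \<open>y\<close> is not hyperarithmetic, then \<open>z\<close> and \<open>y\<close> have
  the same hyperdegree, so \<open>z\<close> lies in the null set \<open>A\<close>; but \<open>z\<close> is uniformly distributed.

  To construct \<open>\<mu>\<close>, consider for a bound \<open>g\<close> on the witnesses the clopen approximations of the
  relation \<open>\<Phi> x n = b\<close>. Along an infinite \<open>g\<close> they decrease to a compact set of correct answers, so
  eventually the set of \<open>x \<in> N\<close> with contradictory answers is small. Hence the finite sequences
  \<open>g\<close> for which it is not yet small form a well-founded tree. The leaves carry measures that are
  computed directly, and each inner node receives a canonical cluster point of the measures of its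
  children. As the tree is well-founded, this arithmetical recursion has exactly one solution, which
  is therefore hyperarithmetic. Domination passes from the children \<open>g i\<close> to \<open>g\<close> since the set of
  \<open>x\<close> whose witnesses are bounded by \<open>g i\<close> increases with \<open>i\<close> to the one for \<open>g\<close>.
\<close>

section \<open>Arithmetical and Delta-1-1 relations\<close>

text \<open>The obstacle is that a bit of \<open>\<Phi> x\<close> is witnessed by reals, that no
  single bound on the witnesses need work for all \<open>x\<close>, and that the two formulas need
  to agree only on \<open>X\<close>. Moreover \<open>A\<close>, and with it \<open>X\<close>, may be
  non-measurable. The image measure itself is therefore out of reach, and only domination of outer
  measure with an additive error is asked for. This error is harmless: if \<open>X\<close> were not
  null, it would have outer measure \<open>m > 0\<close>, and all losses together are kept below
  \<open>m\<close>. The measures of the children of a node need not converge, hence cluster points;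
  they are canonical because the recursion has to determine its solution. A cluster point suffices
  because the sets to be covered increase with the bound and outer measure is continuous along
  increasing unions. That \<open>y\<close> is not hyperarithmetic is what excludes atoms of
  \<open>\<mu>\<close>: an atom leaves a gap in the values of the distribution function, and a
  dyadic number in the gap would define it.\<close>

definition ar :: "(cantor \<Rightarrow> cantor \<Rightarrow> (nat \<Rightarrow> nat) \<Rightarrow> bool) \<Rightarrow> bool" where
  "ar R \<longleftrightarrow> (\<exists>\<phi>. \<forall>X Z e. R X Z e = sat X Z e \<phi>)"

text \<open>Number variable 0 holds the value and the arguments are shifted up by one, which matches
  the variable bound by \<open>FEx\<close>. Closure lemmas of this shape replace the explicit
  construction of formulas.\<close>

definition af :: "(cantor \<Rightarrow> cantor \<Rightarrow> (nat \<Rightarrow> nat) \<Rightarrow> nat) \<Rightarrow> bool" where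
  "af f \<longleftrightarrow> ar (\<lambda>X Z e. f X Z (\<lambda>i. e (Suc i)) = e 0)"

lemma push_0 [simp]: "push n e 0 = n"
  and push_Suc [simp]: "push n e (Suc i) = e i"
  by (simp_all add: push_def)

lemma push_shift [simp]: "(\<lambda>i. push n e (Suc i)) = e"
  by simp

lemma ar_not: "ar R \<Longrightarrow> ar (\<lambda>X Z e. \<not> R X Z e)"
  unfolding ar_def by (metis sat.simps(5))

lemma ar_and: "ar R \<Longrightarrow> ar R' \<Longrightarrow> ar (\<lambda>X Z e. R X Z e \<and> R' X Z e)"
  unfolding ar_def by (metis sat.simps(6))

lemma ar_or: "ar R \<Longrightarrow> ar R' \<Longrightarrow> ar (\<lambda>X Z e. R X Z e \<or> R' X Z e)"
  using ar_not[OF ar_and[OF ar_not ar_not, of R R']] by simp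

lemma ar_ex: "ar (\<lambda>X Z e. R X Z (\<lambda>i. e (Suc i)) (e 0)) \<Longrightarrow> ar (\<lambda>X Z e. \<exists>n. R X Z e n)"
proof -
  assume "ar (\<lambda>X Z e. R X Z (\<lambda>i. e (Suc i)) (e 0))"
  then obtain \<phi> where "\<And>X Z e. R X Z (\<lambda>i. e (Suc i)) (e 0) = sat X Z e \<phi>"
    unfolding ar_def by blast
  from this[of _ _ "push _ _"] have "R X Z e n = sat X Z (push n e) \<phi>" for X Z e n by simp
  then have "\<forall>X Z e. (\<exists>n. R X Z e n) = sat X Z e (FEx \<phi>)" by simp
  then show ?thesis unfolding ar_def by blast
qed

lemma ar_all: "ar (\<lambda>X Z e. R X Z (\<lambda>i. e (Suc i)) (e 0)) \<Longrightarrow> ar (\<lambda>X Z e. \<forall>n. R X Z e n)"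
  using ar_not[OF ar_ex[of "\<lambda>X Z e n. \<not> R X Z e n"]] ar_not by fastforce

lemma evalt_rename: "\<exists>t'. \<forall>e. evalt e t' = evalt (\<lambda>i. e (\<rho> i)) t"
proof (induction t)
  case (TVar i) show ?case by (rule exI[of _ "TVar (\<rho> i)"]) simp
next
  case TZero show ?case by (rule exI[of _ TZero]) simp
next
  case (TSuc t) then show ?case by (metis evalt.simps(3))
next
  case (TPlus s t) then show ?case by (metis evalt.simps(4))
next
  case (TTimes s t) then show ?case by (metis evalt.simps(5))
qed

lemma sat_rename: "\<exists>\<phi>'. \<forall>X Z e. sat X Z e \<phi>' = sat X Z (\<lambda>i. e (\<rho> i)) \<phi>"
proof (induction \<phi> arbitrary: \<rho>)
  case (FEq s t)
  obtain s' t' where "\<And>e. evalt e s' = evalt (\<lambda>i. e (\<rho> i)) s" "\<And>e. evalt e t' = evalt (\<lambda>i. e (\<rho> i)) t"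
    using evalt_rename by metis
  then show ?case by (intro exI[of _ "FEq s' t'"]) simp
next
  case (FLess s t)
  obtain s' t' where "\<And>e. evalt e s' = evalt (\<lambda>i. e (\<rho> i)) s" "\<And>e. evalt e t' = evalt (\<lambda>i. e (\<rho> i)) t"
    using evalt_rename by metis
  then show ?case by (intro exI[of _ "FLess s' t'"]) simp
next
  case (InX t)
  obtain t' where "\<And>e. evalt e t' = evalt (\<lambda>i. e (\<rho> i)) t"
    using evalt_rename by metis
  then show ?case by (intro exI[of _ "InX t'"]) simp
next
  case (InZ t)
  obtain t' where "\<And>e. evalt e t' = evalt (\<lambda>i. e (\<rho> i)) t"
    using evalt_rename by metis
  then show ?case by (intro exI[of _ "InZ t'"]) simp
next
  case (FNeg \<phi>)
  then show ?case by (metis sat.simps(5))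
next
  case (FConj \<phi> \<psi>)
  then show ?case by (metis sat.simps(6))
next
  case (FEx \<phi>)
  obtain \<phi>' where \<phi>': "\<And>X Z e. sat X Z e \<phi>' = sat X Z (\<lambda>i. e (case i of 0 \<Rightarrow> 0 | Suc j \<Rightarrow> Suc (\<rho> j))) \<phi>"
    using FEx by metis
  have "(\<lambda>i. push n e (case i of 0 \<Rightarrow> 0 | Suc j \<Rightarrow> Suc (\<rho> j))) = push n (\<lambda>i. e (\<rho> i))" for n and e :: "nat \<Rightarrow> nat"
    by (auto simp: fun_eq_iff push_def split: nat.split)
  then show ?case by (intro exI[of _ "FEx \<phi>'"]) (simp add: \<phi>')
qed

lemma ar_rename: "ar R \<Longrightarrow> ar (\<lambda>X Z e. R X Z (\<lambda>i. e (\<rho> i)))"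
  unfolding ar_def by (metis sat_rename)

lemma ar_term: "ar (\<lambda>X Z e. evalt e s = evalt e t)" "ar (\<lambda>X Z e. evalt e s < evalt e t)"
  "ar (\<lambda>X Z e. X (evalt e t))" "ar (\<lambda>X Z e. Z (evalt e t))"
  unfolding ar_def by (metis sat.simps(1), metis sat.simps(2), metis sat.simps(3), metis sat.simps(4))

lemma ar_subst:
  assumes "ar (\<lambda>X Z e. R X Z (\<lambda>i. e (Suc i)) (e 0))" "af f"
  shows "ar (\<lambda>X Z e. R X Z e (f X Z e))"
proof -
  have "ar (\<lambda>X Z e. \<exists>n. f X Z e = n \<and> R X Z e n)"
    by (rule ar_ex) (rule ar_and[OF assms(2)[unfolded af_def] assms(1)])
  then show ?thesis by simp
qed

lemma af_rename: "af f \<Longrightarrow> af (\<lambda>X Z e. f X Z (\<lambda>i. e (\<rho> i)))"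
  unfolding af_def
  by (drule ar_rename[where \<rho> = "\<lambda>i. case i of 0 \<Rightarrow> 0 | Suc j \<Rightarrow> Suc (\<rho> j)"]) simp

lemma af_shift: "af f \<Longrightarrow> af (\<lambda>X Z e. f X Z (\<lambda>i. e (Suc i)))"
  by (rule af_rename)

lemma ar_shift1:
  "ar (\<lambda>X Z e. R X Z (\<lambda>i. e (Suc i)) (e 0)) \<Longrightarrow> ar (\<lambda>X Z e. R X Z (\<lambda>i. e (Suc (Suc i))) (e 0))"
  by (drule ar_rename[where \<rho> = "\<lambda>i. case i of 0 \<Rightarrow> 0 | Suc j \<Rightarrow> Suc (Suc j)"]) simp

lemma af_evalt: "af (\<lambda>X Z e. evalt e t)"
proof -
  obtain t' where "\<And>e. evalt e t' = evalt (\<lambda>i. e (Suc i)) t" using evalt_rename by metis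
  with ar_term(1)[of t' "TVar 0"] show ?thesis unfolding af_def by simp
qed

lemma af_var: "af (\<lambda>X Z e. e i)"
  using af_evalt[of "TVar i"] by simp

lemma af_0: "af (\<lambda>X Z e. 0)"
  using af_evalt[of "TZero"] by simp

lemma ar_eq: "af f \<Longrightarrow> af g \<Longrightarrow> ar (\<lambda>X Z e. f X Z e = g X Z e)"
  by (rule ar_subst[where R = "\<lambda>X Z e n. f X Z e = n"]) (simp add: af_def)

lemma ar_rel2:
  assumes "ar (\<lambda>X Z e. R (e 0) (e 1))" "af f" "af g"
  shows "ar (\<lambda>X Z e. R (f X Z e) (g X Z e))"
proof (rule ar_subst[where R = "\<lambda>X Z e n. R (f X Z e) n", OF _ assms(3)])
  show "ar (\<lambda>X Z e. R (f X Z (\<lambda>i. e (Suc i))) (e 0))"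
  proof (rule ar_subst[where R = "\<lambda>X Z e n. R n (e 0)"])
    show "ar (\<lambda>X Z e. R (e 0) (e (Suc 0)))" using assms(1) by simp
  qed (rule af_shift[OF assms(2)])
qed

lemma af_fun2:
  assumes "\<And>t. ar (\<lambda>X Z e. h (e 0) (e 1) = e 2)" "af f" "af g"
  shows "af (\<lambda>X Z e. h (f X Z e) (g X Z e))"
  unfolding af_def
proof (rule ar_subst[where R = "\<lambda>X Z e n. h (f X Z (\<lambda>i. e (Suc i))) n = e 0", OF _ af_shift[OF assms(3)]])
  show "ar (\<lambda>X Z e. h (f X Z (\<lambda>i. e (Suc (Suc i)))) (e 0) = e (Suc 0))"
  proof (rule ar_subst[where R = "\<lambda>X Z e n. h n (e 0) = e (Suc 0)"])
    show "ar (\<lambda>X Z e. h (e 0) (e (Suc 0)) = e (Suc (Suc 0)))"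
      using assms(1) by (simp add: numeral_2_eq_2)
  qed (rule af_rename[OF assms(2)])
qed

lemma ar_less: "af f \<Longrightarrow> af g \<Longrightarrow> ar (\<lambda>X Z e. f X Z e < g X Z e)"
  by (rule ar_rel2) (use ar_term(2)[of "TVar 0" "TVar 1"] in simp)

lemma af_plus: "af f \<Longrightarrow> af g \<Longrightarrow> af (\<lambda>X Z e. f X Z e + g X Z e)"
  by (rule af_fun2) (use ar_term(1)[of "TPlus (TVar 0) (TVar 1)" "TVar 2"] in simp_all)

lemma af_times: "af f \<Longrightarrow> af g \<Longrightarrow> af (\<lambda>X Z e. f X Z e * g X Z e)"
  by (rule af_fun2) (use ar_term(1)[of "TTimes (TVar 0) (TVar 1)" "TVar 2"] in simp_all)

lemma af_Suc: "af f \<Longrightarrow> af (\<lambda>X Z e. Suc (f X Z e))"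
  by (rule af_fun2[where h = "\<lambda>a b. Suc a" and g = f])
    (use ar_term(1)[of "TSuc (TVar 0)" "TVar 2"] in simp_all)

lemma ar_X: "af f \<Longrightarrow> ar (\<lambda>X Z e. X (f X Z e))"
  by (rule ar_subst[where R = "\<lambda>X Z e n. X n"]) (use ar_term(3)[of "TVar 0"] in simp_all)

lemma ar_Z: "af f \<Longrightarrow> ar (\<lambda>X Z e. Z (f X Z e))"
  by (rule ar_subst[where R = "\<lambda>X Z e n. Z n"]) (use ar_term(4)[of "TVar 0"] in simp_all)

lemma af_evalt_subst: "(\<And>i. af (\<lambda>X Z e. \<rho> X Z e i)) \<Longrightarrow> af (\<lambda>X Z e. evalt (\<rho> X Z e) t)"
  by (induction t) (simp_all add: af_0 af_Suc af_plus af_times)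

text \<open>Later rearrangements of the set variable (taking halves or columns, dropping the
  parameter) are instances of this substitution of arithmetical predicates for the set
  symbols.\<close>

lemma ar_sat:
  assumes "ar (\<lambda>X Z e. A X Z (\<lambda>i. e (Suc i)) (e 0))"
    and "ar (\<lambda>X Z e. B X Z (\<lambda>i. e (Suc i)) (e 0))"
    and "\<And>i. af (\<lambda>X Z e. \<rho> X Z e i)"
  shows "ar (\<lambda>X Z e. sat (A X Z e) (B X Z e) (\<rho> X Z e) \<phi>)"
  using assms
proof (induction \<phi> arbitrary: A B \<rho>)
  case (FEq s t)
  then show ?case by (simp add: ar_eq af_evalt_subst)
next
  case (FLess s t)
  then show ?case by (simp add: ar_less af_evalt_subst)
next
  case (InX t)
  then show ?case by (simp add: ar_subst[where R = A] af_evalt_subst)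
next
  case (InZ t)
  then show ?case by (simp add: ar_subst[where R = B] af_evalt_subst)
next
  case (FNeg \<phi>)
  then show ?case by (simp add: ar_not)
next
  case (FConj \<phi> \<psi>)
  then show ?case by (simp add: ar_and)
next
  case (FEx \<phi>)
  have "ar (\<lambda>X Z e. sat (A X Z (\<lambda>i. e (Suc i))) (B X Z (\<lambda>i. e (Suc i))) (push (e 0) (\<rho> X Z (\<lambda>i. e (Suc i)))) \<phi>)"
  proof (rule FEx.IH)
    show "af (\<lambda>X Z e. push (e 0) (\<rho> X Z (\<lambda>i. e (Suc i))) i)" for i
      by (cases i) (simp_all add: af_var af_shift[OF FEx.prems(3)])
  qed (use FEx.prems(1,2) ar_shift1 in blast)+
  then show ?case by (simp add: ar_ex)
qed

section \<open>Sigma-1-1 and Delta-1-1 relations between a real and numbers\<close>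

definition join :: "cantor \<Rightarrow> cantor \<Rightarrow> cantor" where
  "join w Z m = (if even m then w (m div 2) else Z (m div 2))"

lemma double_eq [simp]: "a + a = b + b \<longleftrightarrow> a = (b::nat)" "Suc (a + a) \<noteq> b + b" "b + b \<noteq> Suc (a + a)"
  by presburger+

lemma join_simps [simp]: "join w Z (k + k) = w k" "join w Z (Suc (k + k)) = Z k"
  by (simp_all add: join_def flip: mult_2)

text \<open>In \<^term>\<open>S11 x R\<close> the real \<^term>\<open>x\<close> is a fixed parameter, while the real argument of
  \<^term>\<open>R\<close> is a variable; it serves to state conditions on a real that is to be defined.\<close>

definition S11 :: "cantor \<Rightarrow> (cantor \<Rightarrow> (nat \<Rightarrow> nat) \<Rightarrow> bool) \<Rightarrow> bool" where
  "S11 x R \<longleftrightarrow> (\<exists>\<phi>. \<forall>w e. R w e \<longleftrightarrow> (\<exists>Z. sat x (join w Z) e \<phi>))"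

definition D11 :: "cantor \<Rightarrow> (cantor \<Rightarrow> (nat \<Rightarrow> nat) \<Rightarrow> bool) \<Rightarrow> bool" where
  "D11 x R \<longleftrightarrow> S11 x R \<and> S11 x (\<lambda>w e. \<not> R w e)"

lemma even_odd_cases: 
  fixes m :: nat obtains k where "m = k + k" | k where "m = Suc (k + k)"
  by (metis evenE oddE mult_2 Suc_eq_plus1)

lemma ar_conv:
  fixes Wc Zc :: "cantor \<Rightarrow> cantor \<Rightarrow> (nat \<Rightarrow> nat) \<Rightarrow> nat \<Rightarrow> bool"
  assumes "ar (\<lambda>X Z e. Wc X Z (\<lambda>i. e (Suc i)) (e 0))" "ar (\<lambda>X Z e. Zc X Z (\<lambda>i. e (Suc i)) (e 0))"
    and "\<And>i. af (\<lambda>X Z e. \<rho> X Z e i)"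
  shows "ar (\<lambda>X Z e. sat X (join (Wc X Z e) (Zc X Z e)) (\<rho> X Z e) \<phi>)"
proof (rule ar_sat[where A = "\<lambda>X Z e. X"])
  have *: "join w Z m \<longleftrightarrow> (\<exists>k. (m = k + k \<and> w k) \<or> (m = Suc (k + k) \<and> Z k))" for w Z m
    by (cases m rule: even_odd_cases) auto
  show "ar (\<lambda>X Z e. join (Wc X Z (\<lambda>i. e (Suc i))) (Zc X Z (\<lambda>i. e (Suc i))) (e 0))"
    unfolding * 
    by (intro ar_ex ar_or ar_and ar_eq af_var af_plus af_Suc ar_shift1[OF assms(1)] ar_shift1[OF assms(2)])
qed (intro ar_X af_var assms)+


lemma push_collapse [simp]: "push (e 0) (\<lambda>i. e (Suc i)) = e"
  by (auto simp: push_def fun_eq_iff split: nat.split)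

lemma af_prod_encode:
  "af f \<Longrightarrow> af g \<Longrightarrow> af (\<lambda>X Z e. prod_encode (f X Z e, g X Z e))"
proof (rule af_fun2[where h = "\<lambda>a b. prod_encode (a, b)"])
  \<comment> \<open>Doubling removes the division from the triangular number and leaves an equation
    between terms.\<close>
  have *: "prod_encode (a, b) = c \<longleftrightarrow> (a + b) * Suc (a + b) + (a + a) = c + c" for a b c
  proof -
    have "triangle n + triangle n = n * Suc n" for n
      by (induction n) simp_all
    from this[of "a + b"] have "(a + b) * Suc (a + b) + (a + a) = prod_encode (a, b) + prod_encode (a, b)"
      by (simp add: prod_encode_def)
    then show ?thesis by auto
  qed
  show "ar (\<lambda>X Z e. prod_encode (e 0, e 1) = e 2)"
    unfolding * by (intro ar_eq af_plus af_times af_Suc af_var)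
qed

lemma S11_ar:
  assumes "ar R"
  shows "S11 x (\<lambda>w e. R x w e)"
proof -
  obtain \<phi> where "\<And>X Z e. R X Z e = sat X Z e \<phi>"
    using assms unfolding ar_def by blast
  moreover have "ar (\<lambda>X Z e. sat X (\<lambda>k. Z (k + k)) e \<phi>)"
    by (rule ar_sat) (intro ar_X ar_Z af_var af_plus)+
  then obtain \<phi>' where "\<And>X Z e. sat X (\<lambda>k. Z (k + k)) e \<phi> = sat X Z e \<phi>'"
    unfolding ar_def by blast
  from this[of x "join _ _", symmetric] 
  have "\<And>w Z e. sat x (join w Z) e \<phi>' = sat x w e \<phi>" by simp
  ultimately show ?thesis unfolding S11_def by (intro exI[of _ \<phi>']) simp
qed

lemma D11_ar: "ar R \<Longrightarrow> D11 x (\<lambda>w e. R x w e)"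
  unfolding D11_def using S11_ar[of R] S11_ar[OF ar_not[of R]] by blast

lemma S11_ex:
  assumes "S11 x (\<lambda>w e. R w (\<lambda>i. e (Suc i)) (e 0))"
  shows "S11 x (\<lambda>w e. \<exists>n. R w e n)"
proof -
  obtain \<phi> where "\<And>w e. R w (\<lambda>i. e (Suc i)) (e 0) \<longleftrightarrow> (\<exists>Z. sat x (join w Z) e \<phi>)"
    using assms unfolding S11_def by blast
  from this[of _ "push _ _"] have "R w e n \<longleftrightarrow> (\<exists>Z. sat x (join w Z) (push n e) \<phi>)" for w e n by simp
  then have "(\<exists>n. R w e n) = (\<exists>Z. sat x (join w Z) e (FEx \<phi>))" for w e
    unfolding sat.simps by blast
  then show ?thesis unfolding S11_def by blast
qed

text \<open>By countable choice the witnesses for all \<open>n\<close> become the columns of a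
  single real, so that the number quantifier moves into the matrix.\<close>

lemma S11_all:
  assumes "S11 x (\<lambda>w e. R w (\<lambda>i. e (Suc i)) (e 0))"
  shows "S11 x (\<lambda>w e. \<forall>n. R w e n)"
proof -
  obtain \<phi> where "\<And>w e. R w (\<lambda>i. e (Suc i)) (e 0) \<longleftrightarrow> (\<exists>Z. sat x (join w Z) e \<phi>)"
    using assms unfolding S11_def by blast
  from this[of _ "push _ _"] have R: "R w e n \<longleftrightarrow> (\<exists>Z. sat x (join w Z) (push n e) \<phi>)" for w e n by simp
  define pe where "pe n k = prod_encode (n, k)" for n k
  have af_pe: "af f \<Longrightarrow> af g \<Longrightarrow> af (\<lambda>X Z e. pe (f X Z e) (g X Z e))" for f g
    unfolding pe_def by (rule af_prod_encode)
  have "ar (\<lambda>X Y e. \<forall>n. sat X (join (\<lambda>k. Y (k + k)) (\<lambda>k. Y (Suc (pe n k + pe n k)))) (push n e) \<phi>)"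
    by (rule ar_all, rule ar_conv, unfold push_collapse)
      (intro ar_X ar_Z af_var af_plus af_Suc af_pe)+
  then obtain \<phi>' where *: "\<And>X Y e. (\<forall>n. sat X (join (\<lambda>k. Y (k + k)) (\<lambda>k. Y (Suc (pe n k + pe n k)))) (push n e) \<phi>) = sat X Y e \<phi>'"
    unfolding ar_def by blast
  have \<phi>': "sat x (join w Z) e \<phi>' = (\<forall>n. sat x (join w (\<lambda>k. Z (pe n k))) (push n e) \<phi>)" for w Z e
    using *[of x "join w Z" e] by simp
  have "(\<forall>n. R w e n) = (\<exists>Z. sat x (join w Z) e \<phi>')" for w e
  proof
    assume "\<forall>n. R w e n"
    then obtain Z where Z: "\<And>n. sat x (join w (Z n)) (push n e) \<phi>" unfolding R by metis
    show "\<exists>Z. sat x (join w Z) e \<phi>'"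
      by (rule exI[of _ "\<lambda>m. case prod_decode m of (n, k) \<Rightarrow> Z n k"]) (simp add: \<phi>' Z pe_def)
  next
    assume "\<exists>Z. sat x (join w Z) e \<phi>'"
    then show "\<forall>n. R w e n" unfolding R \<phi>' by blast
  qed
  then show ?thesis unfolding S11_def by blast
qed

lemma S11_and:
  assumes "S11 x R" "S11 x R'"
  shows "S11 x (\<lambda>w e. R w e \<and> R' w e)"
proof -
  obtain \<phi> \<psi> where R: "\<And>w e. R w e \<longleftrightarrow> (\<exists>Z. sat x (join w Z) e \<phi>)" "\<And>w e. R' w e \<longleftrightarrow> (\<exists>Z. sat x (join w Z) e \<psi>)"
    using assms unfolding S11_def by metis
  have "ar (\<lambda>X Y e. sat X (join (\<lambda>k. Y (k + k)) (\<lambda>k. Y (Suc ((k + k) + (k + k))))) e \<phi>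
      \<and> sat X (join (\<lambda>k. Y (k + k)) (\<lambda>k. Y (Suc (Suc (k + k) + Suc (k + k))))) e \<psi>)"
    by (rule ar_and) (rule ar_conv; intro ar_X ar_Z af_var af_plus af_Suc)+
  then obtain \<phi>' where *: "\<And>X Y e. (sat X (join (\<lambda>k. Y (k + k)) (\<lambda>k. Y (Suc ((k + k) + (k + k))))) e \<phi>
      \<and> sat X (join (\<lambda>k. Y (k + k)) (\<lambda>k. Y (Suc (Suc (k + k) + Suc (k + k))))) e \<psi>) = sat X Y e \<phi>'"
    unfolding ar_def by blast
  have \<phi>': "sat x (join w Z) e \<phi>' = (sat x (join w (\<lambda>k. Z (k + k))) e \<phi> \<and> sat x (join w (\<lambda>k. Z (Suc (k + k)))) e \<psi>)" for w Z e
    unfolding *[of x "join w Z" e, symmetric] join_simps ..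
  have "(R w e \<and> R' w e) = (\<exists>Z. sat x (join w Z) e \<phi>')" for w e
  proof
    assume "R w e \<and> R' w e"
    then obtain Z Z' where Z: "sat x (join w Z) e \<phi>" "sat x (join w Z') e \<psi>" unfolding R by metis
    show "\<exists>Z. sat x (join w Z) e \<phi>'"
      by (rule exI[of _ "join Z Z'"]) (simp add: \<phi>' Z)
  next
    assume "\<exists>Z. sat x (join w Z) e \<phi>'"
    then show "R w e \<and> R' w e" unfolding R \<phi>' by blast
  qed
  then show ?thesis unfolding S11_def by blast
qed

lemma S11_or:
  assumes "S11 x R" "S11 x R'"
  shows "S11 x (\<lambda>w e. R w e \<or> R' w e)"
proof -
  obtain \<phi> \<psi> where R: "\<And>w e. R w e \<longleftrightarrow> (\<exists>Z. sat x (join w Z) e \<phi>)" "\<And>w e. R' w e \<longleftrightarrow> (\<exists>Z. sat x (join w Z) e \<psi>)"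
    using assms unfolding S11_def by metis
  show ?thesis unfolding S11_def
    by (rule exI[of _ "FNeg (FConj (FNeg \<phi>) (FNeg \<psi>))"]) (auto simp: R)
qed

lemma S11_rename:
  assumes "S11 x R"
  shows "S11 x (\<lambda>w e. R w (\<lambda>i. e (\<rho> i)))"
proof -
  obtain \<phi> where R: "\<And>w e. R w e \<longleftrightarrow> (\<exists>Z. sat x (join w Z) e \<phi>)"
    using assms unfolding S11_def by blast
  obtain \<phi>' where "\<And>X Z e. sat X Z e \<phi>' = sat X Z (\<lambda>i. e (\<rho> i)) \<phi>" using sat_rename by metis
  then show ?thesis unfolding S11_def R by (intro exI[of _ \<phi>']) simp
qed

text \<open>The quantified real and the old witness are the two halves of one new witness, and every
  real is such a \<open>join\<close>.\<close>

lemma S11_ex_real: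
  assumes "S11 x R"
  shows "S11 x (\<lambda>w e. \<exists>w'. R w' e)"
proof -
  obtain \<phi> where R: "\<And>w e. R w e \<longleftrightarrow> (\<exists>Z. sat x (join w Z) e \<phi>)"
    using assms unfolding S11_def by blast
  have "ar (\<lambda>X Z e. sat X (\<lambda>k. Z (Suc (k + k))) e \<phi>)"
    by (rule ar_sat) (intro ar_X ar_Z af_var af_plus af_Suc)+
  then obtain \<phi>' where "\<And>X Z e. sat X (\<lambda>k. Z (Suc (k + k))) e \<phi> = sat X Z e \<phi>'"
    unfolding ar_def by blast
  from this[of x "join _ _", symmetric] 
  have \<phi>': "\<And>w Z e. sat x (join w Z) e \<phi>' = sat x Z e \<phi>" by simp
  have "join (\<lambda>k. Z (k + k)) (\<lambda>k. Z (Suc (k + k))) = Z" for Z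
  proof
    fix m show "join (\<lambda>k. Z (k + k)) (\<lambda>k. Z (Suc (k + k))) m = Z m"
      by (cases m rule: even_odd_cases) auto
  qed
  then have "(\<exists>w Z. sat x (join w Z) e \<phi>) = (\<exists>Z. sat x Z e \<phi>)" for e by metis
  then show ?thesis unfolding S11_def R by (intro exI[of _ \<phi>']) (simp add: \<phi>')
qed

lemma D11_not: "D11 x R \<Longrightarrow> D11 x (\<lambda>w e. \<not> R w e)"
  unfolding D11_def by simp

lemma D11_and: "D11 x R \<Longrightarrow> D11 x R' \<Longrightarrow> D11 x (\<lambda>w e. R w e \<and> R' w e)"
  unfolding D11_def de_Morgan_conj by (elim conjE, intro conjI S11_and S11_or)

lemma D11_or: "D11 x R \<Longrightarrow> D11 x R' \<Longrightarrow> D11 x (\<lambda>w e. R w e \<or> R' w e)"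
  unfolding D11_def de_Morgan_disj by (elim conjE, intro conjI S11_and S11_or)

lemma D11_imp: "D11 x R \<Longrightarrow> D11 x R' \<Longrightarrow> D11 x (\<lambda>w e. R w e \<longrightarrow> R' w e)"
  unfolding imp_conv_disj by (intro D11_or D11_not)

lemma D11_iff: "D11 x R \<Longrightarrow> D11 x R' \<Longrightarrow> D11 x (\<lambda>w e. R w e \<longleftrightarrow> R' w e)"
  unfolding iff_conv_conj_imp by (intro D11_and D11_imp)

lemma D11_if: "D11 x P \<Longrightarrow> D11 x R \<Longrightarrow> D11 x R' \<Longrightarrow> D11 x (\<lambda>w e. if P w e then R w e else R' w e)"
  unfolding if_bool_eq_conj by (intro D11_and D11_imp D11_not)

lemma D11_const: "D11 x (\<lambda>w e. b)"
proof -
  have "D11 x (\<lambda>w e. e 0 = e 0)" "D11 x (\<lambda>w e. e 0 \<noteq> e 0)"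
    by (rule D11_ar; intro ar_not ar_eq af_var)+
  then show ?thesis by (cases b) simp_all
qed

lemma D11_ex: "D11 x (\<lambda>w e. R w (\<lambda>i. e (Suc i)) (e 0)) \<Longrightarrow> D11 x (\<lambda>w e. \<exists>n. R w e n)"
  unfolding D11_def using S11_ex[of x R] S11_all[of x "\<lambda>w e n. \<not> R w e n"] by simp

lemma D11_all: "D11 x (\<lambda>w e. R w (\<lambda>i. e (Suc i)) (e 0)) \<Longrightarrow> D11 x (\<lambda>w e. \<forall>n. R w e n)"
  unfolding D11_def using S11_all[of x R] S11_ex[of x "\<lambda>w e n. \<not> R w e n"] by simp

lemma D11_rename: "D11 x R \<Longrightarrow> D11 x (\<lambda>w e. R w (\<lambda>i. e (\<rho> i)))"
  unfolding D11_def using S11_rename[of x R \<rho>] S11_rename[of x "\<lambda>w e. \<not> R w e" \<rho>] by simp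

section \<open>Functions with Delta-1-1 graph\<close>

definition Df :: "cantor \<Rightarrow> (cantor \<Rightarrow> (nat \<Rightarrow> nat) \<Rightarrow> nat) \<Rightarrow> bool" where
  "Df x f \<longleftrightarrow> D11 x (\<lambda>w e. f w (\<lambda>i. e (Suc i)) = e 0)"

lemma Df_af: "af f \<Longrightarrow> Df x (\<lambda>w e. f x w e)"
  unfolding Df_def af_def by (rule D11_ar)

lemma D11_subst:
  assumes "D11 x (\<lambda>w e. R w (\<lambda>i. e (Suc i)) (e 0))" "Df x f"
  shows "D11 x (\<lambda>w e. R w e (f w e))"
proof -
  have "D11 x (\<lambda>w e. \<exists>n. f w e = n \<and> R w e n)"
    by (rule D11_ex) (rule D11_and[OF assms(2)[unfolded Df_def] assms(1)])
  then show ?thesis by simp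
qed

lemma Df_rename: "Df x f \<Longrightarrow> Df x (\<lambda>w e. f w (\<lambda>i. e (\<rho> i)))"
  unfolding Df_def
  by (drule D11_rename[where \<rho> = "\<lambda>i. case i of 0 \<Rightarrow> 0 | Suc j \<Rightarrow> Suc (\<rho> j)"]) simp

lemma Df_subst:
  assumes "Df x (\<lambda>w e. h w (\<lambda>i. e (Suc i)) (e 0))" "Df x f"
  shows "Df x (\<lambda>w e. h w e (f w e))"
  unfolding Df_def
proof (rule D11_subst[where R = "\<lambda>w e n. h w (\<lambda>i. e (Suc i)) n = e 0", OF _ Df_rename[OF assms(2)]])
  show "D11 x (\<lambda>w e. h w (\<lambda>i. e (Suc (Suc i))) (e 0) = e (Suc 0))"
    by (use D11_rename[OF assms(1)[unfolded Df_def], where \<rho> = "\<lambda>i. case i of 0 \<Rightarrow> Suc 0 | Suc 0 \<Rightarrow> 0 | Suc (Suc j) \<Rightarrow> Suc (Suc j)"] in simp)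
qed

lemma D11_rel1:
  assumes "D11 x (\<lambda>w e. R (e 0))" "Df x f"
  shows "D11 x (\<lambda>w e. R (f w e))"
  by (rule D11_subst[where R = "\<lambda>w e n. R n"]) (use assms in simp_all)

lemma D11_rel2:
  assumes "D11 x (\<lambda>w e. R (e 0) (e 1))" "Df x f" "Df x g"
  shows "D11 x (\<lambda>w e. R (f w e) (g w e))"
proof (rule D11_subst[where R = "\<lambda>w e n. R (f w e) n", OF _ assms(3)])
  show "D11 x (\<lambda>w e. R (f w (\<lambda>i. e (Suc i))) (e 0))"
    by (rule D11_subst[where R = "\<lambda>w e n. R n (e 0)"]) (use assms(1) Df_rename[OF assms(2)] in simp_all)
qed

lemma D11_rel3:
  assumes "D11 x (\<lambda>w e. R (e 0) (e 1) (e 2))" "Df x f" "Df x g" "Df x h"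
  shows "D11 x (\<lambda>w e. R (f w e) (g w e) (h w e))"
proof (rule D11_subst[where R = "\<lambda>w e n. R (f w e) (g w e) n", OF _ assms(4)])
  show "D11 x (\<lambda>w e. R (f w (\<lambda>i. e (Suc i))) (g w (\<lambda>i. e (Suc i))) (e 0))"
  proof (rule D11_subst[where R = "\<lambda>w e n. R (f w (\<lambda>i. e (Suc i))) n (e 0)", OF _ Df_rename[OF assms(3)]])
    show "D11 x (\<lambda>w e. R (f w (\<lambda>i. e (Suc (Suc i)))) (e 0) (e (Suc 0)))"
      by (rule D11_subst[where R = "\<lambda>w e n. R n (e 0) (e (Suc 0))"]) 
       (use assms(1) Df_rename[OF assms(2), of "\<lambda>i. Suc (Suc i)"] in \<open>simp_all add: numeral_2_eq_2\<close>)
  qed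
qed

lemma Df_fun1:
  assumes "D11 x (\<lambda>w e. h (e 0) = e 1)" "Df x f"
  shows "Df x (\<lambda>w e. h (f w e))"
  by (rule Df_subst[where h = "\<lambda>w e n. h n"])
   (use assms D11_rename[OF assms(1), of "\<lambda>i. if i = 0 then 1 else 0"] in \<open>simp_all add: Df_def\<close>)

lemma Df_fun2:
  assumes "D11 x (\<lambda>w e. h (e 0) (e 1) = e 2)" "Df x f" "Df x g"
  shows "Df x (\<lambda>w e. h (f w e) (g w e))"
  unfolding Df_def
  by (rule D11_rel3[where R = "\<lambda>a b c. h a b = c"])
    (use assms(1) assms(2,3)[THEN Df_rename] Df_af[OF af_var] in simp_all)

lemma Df_var: "Df x (\<lambda>w e. e i)" by (rule Df_af[OF af_var])

lemma Df_plus: "Df x f \<Longrightarrow> Df x g \<Longrightarrow> Df x (\<lambda>w e. f w e + g w e)"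
  by (rule Df_fun2, rule D11_ar) (intro ar_eq af_plus af_var)

lemma Df_times: "Df x f \<Longrightarrow> Df x g \<Longrightarrow> Df x (\<lambda>w e. f w e * g w e)"
  by (rule Df_fun2, rule D11_ar) (intro ar_eq af_times af_var)

lemma Df_prod_encode: "Df x f \<Longrightarrow> Df x g \<Longrightarrow> Df x (\<lambda>w e. prod_encode (f w e, g w e))"
  by (rule Df_fun2[where h = "\<lambda>a b. prod_encode (a, b)"], rule D11_ar) (intro ar_eq af_prod_encode af_var)

lemma Df_Suc: "Df x f \<Longrightarrow> Df x (\<lambda>w e. Suc (f w e))"
  by (rule Df_fun1, rule D11_ar) (intro ar_eq af_Suc af_var)

lemma Df_const: "Df x (\<lambda>w e. n)"
  by (induction n) (simp_all add: Df_Suc Df_af[OF af_0])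

lemma D11_eq: "Df x f \<Longrightarrow> Df x g \<Longrightarrow> D11 x (\<lambda>w e. f w e = g w e)"
  by (rule D11_rel2[OF D11_ar]) (intro ar_eq af_var)

lemma D11_less: "Df x f \<Longrightarrow> Df x g \<Longrightarrow> D11 x (\<lambda>w e. f w e < g w e)"
  by (rule D11_rel2[OF D11_ar]) (intro ar_less af_var)

lemma D11_le: "Df x f \<Longrightarrow> Df x g \<Longrightarrow> D11 x (\<lambda>w e. f w e \<le> g w e)"
  unfolding linorder_not_less[symmetric] by (intro D11_not D11_less)

lemma D11_param: "Df x f \<Longrightarrow> D11 x (\<lambda>w e. x (f w e))"
  by (rule D11_rel1[OF D11_ar]) (intro ar_X af_var)

lemma D11_real: "Df x f \<Longrightarrow> D11 x (\<lambda>w e. w (f w e))"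
  by (rule D11_subst[where R = "\<lambda>w e n. w n", OF D11_ar]) (intro ar_Z af_var)

lemmas D11_intros = D11_not D11_and D11_or D11_imp D11_iff D11_if D11_ex D11_all
  D11_eq D11_less D11_le D11_const
  Df_var Df_plus Df_times Df_prod_encode Df_Suc Df_const

text \<open>Because of this lemma no ordinal notations are needed: the solution of an arithmetical
  recursion along a well-founded tree is unique.\<close>

lemma D11_unique:
  assumes W: "\<And>w e. \<Theta> w e \<longleftrightarrow> w = W e" and "D11 x \<Theta>" "Df x f"
  shows "D11 x (\<lambda>w e. W e (f w e))"
proof (rule D11_subst[where R = "\<lambda>w e n. W e n", OF _ assms(3)])
  \<comment> \<open>As there is exactly one solution, a bit of it is set iff some solution has it
    set, and unset iff some solution has it unset. Both conditions are Sigma-1-1.\<close>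
  have eq: "(\<exists>w'. \<Theta> w' (\<lambda>i. e (Suc i)) \<and> w' (e 0)) = W (\<lambda>i. e (Suc i)) (e 0)"
    "(\<exists>w'. \<Theta> w' (\<lambda>i. e (Suc i)) \<and> \<not> w' (e 0)) = (\<not> W (\<lambda>i. e (Suc i)) (e 0))" for e
    unfolding W by auto
  have "D11 x (\<lambda>w e. \<Theta> w (\<lambda>i. e (Suc i)) \<and> w (e 0))" "D11 x (\<lambda>w e. \<Theta> w (\<lambda>i. e (Suc i)) \<and> \<not> w (e 0))"
    by (intro D11_and D11_not D11_rename[OF assms(2)] D11_real Df_var)+
  note this[unfolded D11_def, THEN conjunct1, THEN S11_ex_real]
  then show "D11 x (\<lambda>w e. W (\<lambda>i. e (Suc i)) (e 0))" unfolding D11_def eq by blast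
qed

section \<open>Delta-1-1 relations and hyperarithmetic reducibility\<close>

lemma hyp_le_D11:
  assumes "hyp_le y x" "Df x f"
  shows "D11 x (\<lambda>w e. y (f w e))"
proof (rule D11_subst[where R = "\<lambda>w e n. y n", OF _ assms(2)])
  obtain \<phi> \<psi> where y: "\<And>n. y n \<longleftrightarrow> (\<exists>Z. sat x Z (push n (\<lambda>_. 0)) \<phi>)"
    "\<And>n. \<not> y n \<longleftrightarrow> (\<exists>Z. sat x Z (push n (\<lambda>_. 0)) (FNeg \<psi>))"
    using assms(1) unfolding hyp_le_def Sigma11_def Pi11_def by (metis sat.simps(5))
  have "S11 x (\<lambda>w e. \<exists>Z. sat x Z (push (e 0) (\<lambda>_. 0)) \<phi>)" for \<phi>
  proof (rule S11_ex_real, rule S11_ar, rule ar_sat[where A = "\<lambda>X Z e. X" and B = "\<lambda>X Z e. Z" and \<rho> = "\<lambda>X Z e. push (e 0) (\<lambda>_. 0)"])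
    show "af (\<lambda>X Z e. push (e 0) (\<lambda>_. 0) i)" for i
      by (cases i) (simp_all add: af_var af_0)
  qed (intro ar_X ar_Z af_var)+
  then have "S11 x (\<lambda>w e. y (e 0))" "S11 x (\<lambda>w e. \<not> y (e 0))"
    unfolding y(2) unfolding y(1) by blast+
  then show "D11 x (\<lambda>w e. y (e 0))" unfolding D11_def ..
qed

lemma D11_hyp_le:
  assumes "D11 x (\<lambda>w e. y (e 0))"
  shows "hyp_le y x"
proof -
  obtain \<phi> \<psi> where "\<And>w e. y (e 0) \<longleftrightarrow> (\<exists>Z. sat x (join w Z) e \<phi>)"
    "\<And>w e. \<not> y (e 0) \<longleftrightarrow> (\<exists>Z. sat x (join w Z) e \<psi>)"
    using assms unfolding D11_def S11_def by metis
  from this(1)[of "push _ (\<lambda>_. 0)"] this(2)[of "push _ (\<lambda>_. 0)"]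
  have y: "\<And>w n. y n \<longleftrightarrow> (\<exists>Z. sat x (join w Z) (push n (\<lambda>_. 0)) \<phi>)"
    "\<And>w n. \<not> y n \<longleftrightarrow> (\<exists>Z. sat x (join w Z) (push n (\<lambda>_. 0)) \<psi>)" by simp_all
  \<comment> \<open>The existence of \<open>Z\<close> does not depend on \<open>w\<close>, so
    \<open>w\<close> may be quantified together with \<open>Z\<close>; then \<open>join w Z\<close>
    runs through all reals.\<close>
  have join: "join (\<lambda>k. Z (k + k)) (\<lambda>k. Z (Suc (k + k))) = Z" for Z
  proof
    fix m show "join (\<lambda>k. Z (k + k)) (\<lambda>k. Z (Suc (k + k))) m = Z m"
      by (cases m rule: even_odd_cases) auto
  qed
  have "\<forall>n. y n \<longleftrightarrow> (\<exists>Z. sat x Z (push n (\<lambda>_. 0)) \<phi>)" 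
    "\<forall>n. y n \<longleftrightarrow> (\<forall>Z. sat x Z (push n (\<lambda>_. 0)) (FNeg \<psi>))"
    using y join by (metis, metis sat.simps(5))
  then show ?thesis unfolding hyp_le_def Sigma11_def Pi11_def by blast
qed

text \<open>Inside the formula the empty parameter can be replaced by an absurd arithmetical
  condition; the resulting formula ignores \<open>x\<close>.\<close>

lemma D11_mono:
  assumes "D11 (\<lambda>_. False) R" shows "D11 x R"
proof -
  have "S11 x R" if S: "S11 (\<lambda>_. False) R" for R
  proof -
    obtain \<phi> where R: "\<And>w e. R w e \<longleftrightarrow> (\<exists>Z. sat (\<lambda>_. False) (join w Z) e \<phi>)"
      using S unfolding S11_def by blast
    have "ar (\<lambda>X Z e. e 0 \<noteq> e 0)"
      by (intro ar_not ar_eq af_var)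
    then have F: "ar (\<lambda>X Z e. False)" by simp
    have "ar (\<lambda>X Z e. sat (\<lambda>_. False) Z e \<phi>)"
      by (rule ar_sat) (intro F ar_Z af_var)+
    then obtain \<phi>' where "\<And>X Z e. sat (\<lambda>_. False) Z e \<phi> = sat X Z e \<phi>'"
      unfolding ar_def by blast
    then show ?thesis unfolding S11_def R by metis
  qed
  then show ?thesis using assms unfolding D11_def by blast
qed

section \<open>Definability by recursion and closed normal forms\<close>

lemma Df_if: "D11 x P \<Longrightarrow> Df x f \<Longrightarrow> Df x g \<Longrightarrow> Df x (\<lambda>w e. if P w e then f w e else g w e)"
  unfolding Df_def if_distrib[where f = "\<lambda>a. a = _"]
  by (rule D11_if) (simp_all add: D11_rename)

text \<open>The graph is the only real that satisfies the recursion equations, so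
  \<open>D11_unique\<close> applies. \<open>f\<close> and \<open>g\<close> must not depend on
  \<open>w\<close>, because in \<open>\<Theta>\<close> that argument is the graph being
  defined.\<close>

lemma Df_rec_nat:
  assumes f: "Df x (\<lambda>w e. f e)" and g: "Df x (\<lambda>w e. g (\<lambda>i. e (Suc (Suc i))) (e 0) (e 1))" and h: "Df x h"
  shows "Df x (\<lambda>w e. rec_nat (f e) (g e) (h w e))"
proof -
  define W where "W e = (\<lambda>m. case prod_decode m of (n, v) \<Rightarrow> rec_nat (f e) (g e) n = v)" for e
  define \<Theta> where "\<Theta> w e \<longleftrightarrow> (\<forall>n v. w (prod_encode (n, v)) \<longleftrightarrow>
    (n = 0 \<and> v = f e) \<or> (\<exists>n' v'. n = Suc n' \<and> w (prod_encode (n', v')) \<and> v = g e n' v'))" for w e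
  have \<Theta>: "\<Theta> w e \<longleftrightarrow> w = W e" for w e
  proof
    assume "\<Theta> w e"
    then have *: "w (prod_encode (n, v)) \<longleftrightarrow>
      (n = 0 \<and> v = f e) \<or> (\<exists>n' v'. n = Suc n' \<and> w (prod_encode (n', v')) \<and> v = g e n' v')" for n v
      unfolding \<Theta>_def by blast
    have "w (prod_encode (n, v)) \<longleftrightarrow> rec_nat (f e) (g e) n = v" for n v
      by (induction n arbitrary: v; subst *) auto
    then show "w = W e" unfolding W_def
      by (auto simp: fun_eq_iff split: prod.split) (metis prod_decode_inverse)+
  next
    assume w: "w = W e"
    have "rec_nat (f e) (g e) n = v \<longleftrightarrow>
      (n = 0 \<and> v = f e) \<or> (\<exists>n' v'. n = Suc n' \<and> rec_nat (f e) (g e) n' = v' \<and> v = g e n' v')" for n v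
      by (cases n) auto
    then show "\<Theta> w e" unfolding \<Theta>_def w W_def prod_encode_inverse prod.case by blast
  qed
  have g': "Df x (\<lambda>w e. g (\<lambda>i. e (Suc (Suc (Suc (Suc (Suc i)))))) (e 1) (e 0))"
    using Df_rename[OF g, where \<rho> = "\<lambda>i. case i of 0 \<Rightarrow> 1 | Suc 0 \<Rightarrow> 0 | Suc (Suc j) \<Rightarrow> Suc (Suc (Suc (Suc (Suc j))))"]
    by simp
  have "D11 x (\<lambda>w e. \<Theta> w (\<lambda>i. e (Suc i)))"
    unfolding \<Theta>_def
    by (intro D11_intros D11_real Df_rename[OF f] g'[simplified])
  then have "D11 x (\<lambda>w e. W (\<lambda>i. e (Suc i)) (prod_encode (h w (\<lambda>i. e (Suc i)), e 0)))"
    by (rule D11_unique[rotated]) (intro \<Theta> Df_prod_encode Df_rename[OF h] Df_var)+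
  then show ?thesis unfolding Df_def W_def by simp
qed

lemma Df_card:
  assumes R: "D11 x (\<lambda>w e. R (\<lambda>i. e (Suc i)) (e 0))" and h: "Df x h"
  shows "Df x (\<lambda>w e. card {t. t < h w e \<and> R e t})"
proof -
  have *: "card {t. t < n \<and> R e t} = rec_nat 0 (\<lambda>t v. if R e t then Suc v else v) n" for n e
  proof (induction n)
    case (Suc n)
    have "{t. t < Suc n \<and> R e t} = (if R e n then insert n {t. t < n \<and> R e t} else {t. t < n \<and> R e t})"
      by (auto simp: less_Suc_eq)
    then show ?case using Suc by simp
  qed simp
  show ?thesis unfolding *
    by (rule Df_rec_nat)
      (intro Df_if Df_Suc Df_const Df_var h D11_rename[OF R, where \<rho> = "\<lambda>i. case i of 0 \<Rightarrow> 0 | Suc j \<Rightarrow> Suc (Suc j)", simplified])+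
qed

lemma Df_power: "Df x f \<Longrightarrow> Df x g \<Longrightarrow> Df x (\<lambda>w e. f w e ^ g w e)"
proof (rule Df_fun2[where h = "\<lambda>a n. a ^ n"])
  have "a ^ n = rec_nat 1 (\<lambda>_ v. a * v) n" for a n :: nat
    by (induction n) simp_all
  then show "D11 x (\<lambda>w e. e 0 ^ e 1 = e 2)"
    by (simp only:) (rule D11_eq, rule Df_rec_nat[where g = "\<lambda>e _ v. e 0 * v" and h = "\<lambda>w e. e 1"]; intro Df_const Df_times Df_var)
qed

lemma D11_bit: "Df x f \<Longrightarrow> Df x g \<Longrightarrow> D11 x (\<lambda>w e. bit (f w e :: nat) (g w e))"
proof (rule D11_rel2)
  \<comment> \<open>Division-free form: \<open>q\<close> is the part of \<open>t\<close> above bit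
    \<open>i\<close>, and \<open>r\<close> the part below.\<close>
  have "bit t i \<longleftrightarrow> (\<exists>q r. t = Suc (q + q) * 2 ^ i + r \<and> r < 2 ^ i)" for t i :: nat
  proof
    assume "bit t i"
    then have "odd (t div 2 ^ i)" by (simp add: bit_iff_odd)
    then obtain q where "t div 2 ^ i = Suc (q + q)" by (metis oddE mult_2 Suc_eq_plus1)
    then have "t = Suc (q + q) * 2 ^ i + t mod 2 ^ i" by (metis div_mult_mod_eq)
    then show "\<exists>q r. t = Suc (q + q) * 2 ^ i + r \<and> r < 2 ^ i"
      by (metis mod_less_divisor zero_less_numeral zero_less_power)
  next
    assume "\<exists>q r. t = Suc (q + q) * 2 ^ i + r \<and> r < 2 ^ i"
    then obtain q r where "t = Suc (q + q) * 2 ^ i + r" "r < 2 ^ i" by blast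
    then have "t div 2 ^ i = Suc (q + q)" by (simp only: div_mult_self3) simp
    then show "bit t i" by (simp add: bit_iff_odd)
  qed
  then show "D11 x (\<lambda>w e. bit (e 0) (e 1))"
    by (simp only:) (intro D11_intros Df_power)
qed

text \<open>Most significant bit first, so that the lexicographic order of reals is the order of the values.\<close>

fun str :: "cantor \<Rightarrow> nat \<Rightarrow> nat" where
  "str y 0 = 0"
| "str y (Suc k) = 2 * str y k + (if y k then 1 else 0)"

lemma Df_str:
  assumes Y: "D11 x (\<lambda>w e. Y (\<lambda>i. e (Suc i)) (e 0))" and h: "Df x h"
  shows "Df x (\<lambda>w e. str (Y e) (h w e))"
proof -
  have "str y n = rec_nat 0 (\<lambda>k v. 2 * v + (if y k then 1 else 0)) n" for y n
    by (induction n) simp_all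
  then show ?thesis
    by (simp only:) (rule Df_rec_nat; 
       intro Df_if Df_plus Df_times Df_const Df_var h D11_rename[OF Y, where \<rho> = "\<lambda>i. case i of 0 \<Rightarrow> 0 | Suc j \<Rightarrow> Suc (Suc j)", simplified])
qed

section \<open>Coded finite sequences\<close>

abbreviation ncons :: "nat \<Rightarrow> nat \<Rightarrow> nat" where
  "ncons i c \<equiv> Suc (prod_encode (i, c))"

definition len :: "nat \<Rightarrow> nat" where
  "len c = length (list_decode c)"

text \<open>\<open>ncons\<close> puts the newest entry at the head of the list; reversal numbers the
  entries by age, so that indices stay fixed when a node of the tree is extended.\<close>

definition lookup :: "nat \<Rightarrow> nat \<Rightarrow> nat" where
  "lookup c n = (if n < len c then rev (list_decode c) ! n else 0)"

lemma len_simps [simp]: "len 0 = 0" "len (ncons i c) = Suc (len c)"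
  by (simp_all add: len_def)

lemma lookup_simps [simp]: "lookup 0 n = 0" "lookup (ncons i c) n = (if n = len c then i else lookup c n)"
  by (auto simp: lookup_def len_def nth_append)

lemma ncons_cases: obtains "c = 0" | i c' where "c = ncons i c'"
  by (metis not0_implies_Suc prod_decode_inverse surj_pair)

lemma Df_len: "Df x f \<Longrightarrow> Df x (\<lambda>w e. len (f w e))"
proof (rule Df_fun1[where h = len])
  define W where "W = (\<lambda>m. case prod_decode m of (c, v) \<Rightarrow> len c = v)"
  define \<Theta> where "\<Theta> w \<longleftrightarrow> (\<forall>c v. w (prod_encode (c, v)) \<longleftrightarrow>
    (c = 0 \<and> v = 0) \<or> (\<exists>i c' v'. c = ncons i c' \<and> w (prod_encode (c', v')) \<and> v = Suc v'))" for w
  have \<Theta>: "\<Theta> w \<longleftrightarrow> w = W" for w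
  proof
    assume "\<Theta> w"
    then have *: "w (prod_encode (c, v)) \<longleftrightarrow>
      (c = 0 \<and> v = 0) \<or> (\<exists>i c' v'. c = ncons i c' \<and> w (prod_encode (c', v')) \<and> v = Suc v')" for c v
      unfolding \<Theta>_def by blast
    have "w (prod_encode (c, v)) \<longleftrightarrow> len c = v" for c v
    proof (induction c arbitrary: v rule: less_induct)
      case (less c)
      show ?case
      proof (cases c rule: ncons_cases)
        case (2 i c')
        then have "c' < c" using le_prod_encode_2 by (simp add: less_Suc_eq_le)
        show ?thesis using less.IH[OF \<open>c' < c\<close>] 2 by (subst *) auto
      qed (subst *, auto)
    qed
    then show "w = W" unfolding W_def
      by (auto simp: fun_eq_iff split: prod.split) (metis prod_decode_inverse)+
  next
    assume w: "w = W"
    have "len c = v \<longleftrightarrow> (c = 0 \<and> v = 0) \<or> (\<exists>i c' v'. c = ncons i c' \<and> len c' = v' \<and> v = Suc v')" for c v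
      by (cases c rule: ncons_cases) auto
    then show "\<Theta> w" unfolding \<Theta>_def w W_def prod_encode_inverse prod.case by blast
  qed
  have "D11 x (\<lambda>w e. W (prod_encode (e 0, e 1)))"
    by (rule D11_unique[where W = "\<lambda>e. W", OF \<Theta>], unfold \<Theta>_def) (intro D11_intros D11_real)+
  then show "D11 x (\<lambda>w e. len (e 0) = e 1)" by (simp add: W_def)
qed

lemma Df_lookup: "Df x f \<Longrightarrow> Df x g \<Longrightarrow> Df x (\<lambda>w e. lookup (f w e) (g w e))"
proof (rule Df_fun2[where h = lookup])
  define W where "W = (\<lambda>m. case prod_decode m of (c, m') \<Rightarrow> case prod_decode m' of (n, v) \<Rightarrow> lookup c n = v)"
  define \<Theta> where "\<Theta> w \<longleftrightarrow> (\<forall>c n v. w (prod_encode (c, prod_encode (n, v))) \<longleftrightarrow>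
    (c = 0 \<and> v = 0) \<or> (\<exists>i c'. c = ncons i c' \<and> (if n = len c' then v = i else w (prod_encode (c', prod_encode (n, v))))))" for w
  have \<Theta>: "\<Theta> w \<longleftrightarrow> w = W" for w
  proof
    assume "\<Theta> w"
    then have *: "w (prod_encode (c, prod_encode (n, v))) \<longleftrightarrow>
      (c = 0 \<and> v = 0) \<or> (\<exists>i c'. c = ncons i c' \<and> (if n = len c' then v = i else w (prod_encode (c', prod_encode (n, v)))))" for c n v
      unfolding \<Theta>_def by blast
    have "w (prod_encode (c, prod_encode (n, v))) \<longleftrightarrow> lookup c n = v" for c n v
    proof (induction c arbitrary: v rule: less_induct)
      case (less c)
      show ?case
      proof (cases c rule: ncons_cases)
        case (2 i c')
        then have "c' < c" using le_prod_encode_2 by (simp add: less_Suc_eq_le)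
        show ?thesis using less.IH[OF \<open>c' < c\<close>] 2 by (subst *) auto
      qed (subst *, auto)
    qed
    then show "w = W" unfolding W_def
      by (auto simp: fun_eq_iff split: prod.split) (metis prod_decode_inverse)+
  next
    assume w: "w = W"
    have "lookup c n = v \<longleftrightarrow> (c = 0 \<and> v = 0) \<or> (\<exists>i c'. c = ncons i c' \<and> (if n = len c' then v = i else lookup c' n = v))" for c n v
      by (cases c rule: ncons_cases) auto
    then show "\<Theta> w" unfolding \<Theta>_def w W_def prod_encode_inverse prod.case by blast
  qed
  have "D11 x (\<lambda>w e. W (prod_encode (e 0, prod_encode (e 1, e 2))))"
    by (rule D11_unique[where W = "\<lambda>e. W", OF \<Theta>], unfold \<Theta>_def) (intro D11_intros D11_real Df_len)+
  then show "D11 x (\<lambda>w e. lookup (e 0) (e 1) = e 2)" by (simp add: W_def)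
qed

lemma lookup_realize: "\<exists>d. \<forall>i<k. lookup d i = f i"
proof -
  have "\<exists>d. len d = k \<and> (\<forall>i<k. lookup d i = f i)"
  proof (induction k)
    case 0
    show ?case by (rule exI[of _ 0]) simp
  next
    case (Suc k)
    then obtain d where "len d = k" "\<forall>i<k. lookup d i = f i" by blast
    then show ?case by (intro exI[of _ "ncons (f k) d"]) (auto simp: less_Suc_eq)
  qed
  then show ?thesis by blast
qed

section \<open>Closed normal form of satisfaction\<close>

lemma Df_evalt: "(\<And>i. Df x (\<lambda>w e. \<rho> w e i)) \<Longrightarrow> Df x (\<lambda>w e. evalt (\<rho> w e) t)"
  by (induction t) (simp_all add: Df_const Df_Suc Df_plus Df_times)

text \<open>Skolem normal form: \<^term>\<open>f\<close> codes the witnesses for \<^term>\<open>sat X Z e \<phi> = b\<close>, and stage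
  \<^term>\<open>k\<close> of the verification only looks at the first \<^term>\<open>k\<close> values of \<^term>\<open>X\<close>,
  \<^term>\<open>Z\<close> and \<^term>\<open>f\<close>.\<close>

primrec clo :: "fm \<Rightarrow> bool \<Rightarrow> nat \<Rightarrow> cantor \<Rightarrow> cantor \<Rightarrow> (nat \<Rightarrow> nat) \<Rightarrow> (nat \<Rightarrow> nat) \<Rightarrow> bool" where
  "clo (FEq s t) b k X Z f e \<longleftrightarrow> (evalt e s = evalt e t) = b"
| "clo (FLess s t) b k X Z f e \<longleftrightarrow> (evalt e s < evalt e t) = b"
| "clo (InX t) b k X Z f e \<longleftrightarrow> (evalt e t < k \<longrightarrow> X (evalt e t) = b)"
| "clo (InZ t) b k X Z f e \<longleftrightarrow> (evalt e t < k \<longrightarrow> Z (evalt e t) = b)"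
| "clo (FNeg \<phi>) b k X Z f e \<longleftrightarrow> clo \<phi> (\<not> b) k X Z f e"
| "clo (FConj \<phi> \<psi>) b k X Z f e \<longleftrightarrow> (if b
     then (\<forall>n j. k = prod_encode (n, j) \<longrightarrow> (if n = 0 then clo \<phi> True j X Z (\<lambda>i. f (prod_encode (n, i))) e
        else clo \<psi> True j X Z (\<lambda>i. f (prod_encode (n, i))) e))
     else (\<forall>j. k = Suc j \<longrightarrow> (if f 0 = 0 then clo \<phi> False j X Z (\<lambda>i. f (Suc i)) e
        else clo \<psi> False j X Z (\<lambda>i. f (Suc i)) e)))"
| "clo (FEx \<phi>) b k X Z f e \<longleftrightarrow> (if b
     then (\<forall>j. k = Suc j \<longrightarrow> clo \<phi> True j X Z (\<lambda>i. f (Suc i)) (push (f 0) e))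
     else (\<forall>n j. k = prod_encode (n, j) \<longrightarrow> clo \<phi> False j X Z (\<lambda>i. f (prod_encode (n, i))) (push n e)))"

text \<open>Where a choice has to be made (true \<open>FEx\<close>, false \<open>FConj\<close>),
  \<open>f 0\<close> is the choice and the tail of \<open>f\<close> its witness. Where all instances
  have to be met (true \<open>FConj\<close>, false \<open>FEx\<close>), column \<open>n\<close> of
  \<open>f\<close> serves instance \<open>n\<close>, and stage \<open>prod_encode (n, j)\<close>
  runs stage \<open>j\<close> of that instance. The induction splits or glues \<open>f\<close>
  accordingly.\<close>

lemma sat_clo: "sat X Z e \<phi> = b \<longleftrightarrow> (\<exists>f. \<forall>k. clo \<phi> b k X Z f e)"
proof (induction \<phi> arbitrary: b e)
  case (FConj \<phi> \<psi>)
  show ?case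
  proof (cases b)
    case True
    have "(\<exists>f. \<forall>k. clo (FConj \<phi> \<psi>) True k X Z f e) \<longleftrightarrow> (\<exists>f. \<forall>k. clo \<phi> True k X Z f e) \<and> (\<exists>f. \<forall>k. clo \<psi> True k X Z f e)"
      (is "?L \<longleftrightarrow> ?A \<and> ?B")
    proof
      assume ?L
      then obtain f where f: "\<And>n j. if n = 0 then clo \<phi> True j X Z (\<lambda>i. f (prod_encode (n, i))) e
        else clo \<psi> True j X Z (\<lambda>i. f (prod_encode (n, i))) e" by auto
      from f[of 0] f[of 1] show "?A \<and> ?B" by auto
    next
      assume "?A \<and> ?B"
      then obtain f g where "\<And>k. clo \<phi> True k X Z f e" "\<And>k. clo \<psi> True k X Z g e" by blast
      then show ?L
        by (intro exI[of _ "\<lambda>m. case prod_decode m of (n, i) \<Rightarrow> if n = 0 then f i else g i"]) auto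
    qed
    then show ?thesis using FConj[of e True] True by simp
  next
    case False
    have "(\<exists>f. \<forall>k. clo (FConj \<phi> \<psi>) False k X Z f e) \<longleftrightarrow> (\<exists>f. \<forall>k. clo \<phi> False k X Z f e) \<or> (\<exists>f. \<forall>k. clo \<psi> False k X Z f e)"
      (is "?L \<longleftrightarrow> ?A \<or> ?B")
    proof
      assume ?L
      then obtain f where "\<And>j. if f 0 = 0 then clo \<phi> False j X Z (\<lambda>i. f (Suc i)) e
        else clo \<psi> False j X Z (\<lambda>i. f (Suc i)) e" by auto
      then show "?A \<or> ?B" by (cases "f 0 = 0") auto
    next
      assume "?A \<or> ?B"
      then show ?L
      proof
        assume ?A
        then obtain f where "\<And>k. clo \<phi> False k X Z f e" by blast
        then show ?L by (intro exI[of _ "\<lambda>m. case m of 0 \<Rightarrow> 0 | Suc i \<Rightarrow> f i"]) auto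
      next
        assume ?B
        then obtain f where "\<And>k. clo \<psi> False k X Z f e" by blast
        then show ?L by (intro exI[of _ "\<lambda>m. case m of 0 \<Rightarrow> 1 | Suc i \<Rightarrow> f i"]) auto
      qed
    qed
    then show ?thesis using FConj[of e False] False by auto
  qed
next
  case (FEx \<phi>)
  show ?case
  proof (cases b)
    case True
    have "(\<exists>f. \<forall>k. clo (FEx \<phi>) True k X Z f e) \<longleftrightarrow> (\<exists>n f. \<forall>k. clo \<phi> True k X Z f (push n e))"
      (is "?L \<longleftrightarrow> ?R")
    proof
      assume ?R
      then obtain f n where "\<And>k. clo \<phi> True k X Z f (push n e)" by blast
      then show ?L by (intro exI[of _ "\<lambda>m. case m of 0 \<Rightarrow> n | Suc i \<Rightarrow> f i"]) auto
    qed auto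
    then show ?thesis using FEx[of _ True] True by simp
  next
    case False
    have "(\<exists>f. \<forall>k. clo (FEx \<phi>) False k X Z f e) \<longleftrightarrow> (\<forall>n. \<exists>f. \<forall>k. clo \<phi> False k X Z f (push n e))"
      (is "?L \<longleftrightarrow> ?R")
    proof
      assume ?R
      then obtain f where "\<And>n k. clo \<phi> False k X Z (f n) (push n e)" by metis
      then show ?L by (intro exI[of _ "\<lambda>m. case prod_decode m of (n, i) \<Rightarrow> f n i"]) auto
    qed auto
    then show ?thesis using FEx[of _ False] False by simp
  qed
next
  case (FNeg \<phi>)
  have "sat X Z e (FNeg \<phi>) = b \<longleftrightarrow> sat X Z e \<phi> = (\<not> b)" by auto
  then show ?case using FNeg[of e "\<not> b"] by simp
next
  case (InX t)
  have "(\<forall>k. evalt e t < k \<longrightarrow> P) \<longleftrightarrow> P" for P by auto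
  then show ?case by (simp only: sat.simps clo.simps simp_thms)
next
  case (InZ t)
  have "(\<forall>k. evalt e t < k \<longrightarrow> P) \<longleftrightarrow> P" for P by auto
  then show ?case by (simp only: sat.simps clo.simps simp_thms)
qed (simp_all only: sat.simps clo.simps simp_thms)

text \<open>It lets stage \<open>prod_encode (n, j)\<close> of \<open>clo\<close> consult the first
  \<open>j\<close> entries of column \<open>n\<close>: their positions lie below the stage.\<close>

lemma prod_encode_less: "i < j \<Longrightarrow> prod_encode (n, i) < prod_encode (n, j)"
proof -
  assume "i < j"
  then have "triangle (n + i) \<le> triangle (n + j)"
    using lift_Suc_mono_le[of triangle "n + i" "n + j"] by simp
  moreover have "prod_encode (n, i) \<noteq> prod_encode (n, j)" using \<open>i < j\<close> by simp
  ultimately show ?thesis by (simp add: prod_encode_def)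
qed

lemma clo_local:
  assumes "\<And>i. i < k \<Longrightarrow> X i = X' i" "\<And>i. i < k \<Longrightarrow> Z i = Z' i" "\<And>i. i < k \<Longrightarrow> f i = f' i"
  shows "clo \<phi> b k X Z f e = clo \<phi> b k X' Z' f' e"
  using assms
proof (induction \<phi> arbitrary: b k f f' e)
  case (FConj \<phi> \<psi>)
  have 1: "clo \<theta> c j X Z (\<lambda>i. f (prod_encode (n, i))) e' = clo \<theta> c j X' Z' (\<lambda>i. f' (prod_encode (n, i))) e'"
    if "k = prod_encode (n, j)" "\<theta> = \<phi> \<or> \<theta> = \<psi>" for \<theta> c j n e'
  proof -
    have "j \<le> k" using that(1) le_prod_encode_2 by simp
    then have e1: "\<And>i. i < j \<Longrightarrow> X i = X' i" and e2: "\<And>i. i < j \<Longrightarrow> Z i = Z' i"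
      and e3: "\<And>i. i < j \<Longrightarrow> f (prod_encode (n, i)) = f' (prod_encode (n, i))"
      using that(1) FConj.prems prod_encode_less by auto
    show ?thesis using that(2) FConj.IH(1)[where k = j and b = c and e = e' and f = "\<lambda>i. f (prod_encode (n, i))" and f' = "\<lambda>i. f' (prod_encode (n, i))", OF e1 e2 e3] FConj.IH(2)[where k = j and b = c and e = e' and f = "\<lambda>i. f (prod_encode (n, i))" and f' = "\<lambda>i. f' (prod_encode (n, i))", OF e1 e2 e3] by blast
  qed
  have 2: "clo \<theta> c j X Z (\<lambda>i. f (Suc i)) e' = clo \<theta> c j X' Z' (\<lambda>i. f' (Suc i)) e'"
    if "k = Suc j" "\<theta> = \<phi> \<or> \<theta> = \<psi>" for \<theta> c j e'
  proof -
    have e1: "\<And>i. i < j \<Longrightarrow> X i = X' i" and e2: "\<And>i. i < j \<Longrightarrow> Z i = Z' i"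
      and e3: "\<And>i. i < j \<Longrightarrow> f (Suc i) = f' (Suc i)"
      using that(1) FConj.prems by auto
    show ?thesis using that(2) FConj.IH(1)[where k = j and b = c and e = e' and f = "\<lambda>i. f (Suc i)" and f' = "\<lambda>i. f' (Suc i)", OF e1 e2 e3] FConj.IH(2)[where k = j and b = c and e = e' and f = "\<lambda>i. f (Suc i)" and f' = "\<lambda>i. f' (Suc i)", OF e1 e2 e3] by blast
  qed
  have 3: "k = Suc j \<Longrightarrow> f 0 = f' 0" for j using FConj.prems(3) by simp
  show ?case by (cases b) (auto simp: 1 2 3)
next
  case (FEx \<phi>)
  have 1: "clo \<phi> c j X Z (\<lambda>i. f (prod_encode (n, i))) e' = clo \<phi> c j X' Z' (\<lambda>i. f' (prod_encode (n, i))) e'"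
    if "k = prod_encode (n, j)" for c j n e'
  proof -
    have "j \<le> k" using that(1) le_prod_encode_2 by simp
    then have e1: "\<And>i. i < j \<Longrightarrow> X i = X' i" and e2: "\<And>i. i < j \<Longrightarrow> Z i = Z' i"
      and e3: "\<And>i. i < j \<Longrightarrow> f (prod_encode (n, i)) = f' (prod_encode (n, i))"
      using that(1) FEx.prems prod_encode_less by auto
    show ?thesis using FEx.IH[where k = j and b = c and e = e' and f = "\<lambda>i. f (prod_encode (n, i))" and f' = "\<lambda>i. f' (prod_encode (n, i))", OF e1 e2 e3] by blast
  qed
  have 2: "clo \<phi> c j X Z (\<lambda>i. f (Suc i)) e' = clo \<phi> c j X' Z' (\<lambda>i. f' (Suc i)) e'"
    if "k = Suc j" for c j e'
  proof -
    have e1: "\<And>i. i < j \<Longrightarrow> X i = X' i" and e2: "\<And>i. i < j \<Longrightarrow> Z i = Z' i"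
      and e3: "\<And>i. i < j \<Longrightarrow> f (Suc i) = f' (Suc i)"
      using that(1) FEx.prems by auto
    show ?thesis using FEx.IH[where k = j and b = c and e = e' and f = "\<lambda>i. f (Suc i)" and f' = "\<lambda>i. f' (Suc i)", OF e1 e2 e3] by blast
  qed
  have 3: "k = Suc j \<Longrightarrow> f 0 = f' 0" for j using FEx.prems(3) by simp
  show ?case by (cases b) (auto simp: 1 2 3)
next
  case (FNeg \<phi>)
  then show ?case unfolding clo.simps by blast
qed auto

lemma D11_app:
  assumes "D11 x (\<lambda>w e. R w (\<lambda>i. e (Suc i)) (e 0))" "Df x g"
  shows "D11 x (\<lambda>w e. R w (\<lambda>i. e (\<rho> i)) (g w e))"
  by (rule D11_subst[where R = "\<lambda>w e. R w (\<lambda>i. e (\<rho> i))", OF _ assms(2)])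
    (use D11_rename[OF assms(1), where \<rho> = "\<lambda>i. case i of 0 \<Rightarrow> 0 | Suc j \<Rightarrow> Suc (\<rho> j)"] in simp)

lemma Df_app:
  assumes "Df x (\<lambda>w e. f w (\<lambda>i. e (Suc i)) (e 0))" "Df x g"
  shows "Df x (\<lambda>w e. f w (\<lambda>i. e (\<rho> i)) (g w e))"
  by (rule Df_subst[where h = "\<lambda>w e. f w (\<lambda>i. e (\<rho> i))", OF _ assms(2)])
    (use Df_rename[OF assms(1), where \<rho> = "\<lambda>i. case i of 0 \<Rightarrow> 0 | Suc j \<Rightarrow> Suc (\<rho> j)"] in simp)

lemma D11_clo:
  assumes "Df x k" "D11 x (\<lambda>w e. X w (\<lambda>i. e (Suc i)) (e 0))" "D11 x (\<lambda>w e. Z w (\<lambda>i. e (Suc i)) (e 0))"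
    "Df x (\<lambda>w e. f w (\<lambda>i. e (Suc i)) (e 0))" "\<And>i. Df x (\<lambda>w e. \<rho> w e i)"
  shows "D11 x (\<lambda>w e. clo \<phi> b (k w e) (X w e) (Z w e) (f w e) (\<rho> w e))"
  using assms
proof (induction \<phi> arbitrary: b k X Z f \<rho>)
  case (FEq s t)
  then show ?case unfolding clo.simps by (intro D11_intros Df_evalt)
next
  case (FLess s t)
  then show ?case unfolding clo.simps by (intro D11_intros Df_evalt)
next
  case (InX t)
  then show ?case unfolding clo.simps by (intro D11_imp D11_less D11_iff D11_const Df_evalt D11_subst[where R = X])
next
  case (InZ t)
  then show ?case unfolding clo.simps by (intro D11_imp D11_less D11_iff D11_const Df_evalt D11_subst[where R = Z])
next
  case (FNeg \<phi>)
  then show ?case unfolding clo.simps by blast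
next
  case (FConj \<phi> \<psi>)
  show ?case unfolding clo.simps
    by (intro D11_intros FConj.IH Df_rename[OF FConj.prems(1)] Df_rename[OF FConj.prems(5)] 
       D11_app[OF FConj.prems(2)] D11_app[OF FConj.prems(3)] Df_app[OF FConj.prems(4)])
next
  case (FEx \<phi>)
  have p: "Df x (\<lambda>w e. push (g w e) (\<rho> w (\<lambda>i. e (r i))) i)" if "Df x g" for g r i
    by (cases i) (simp_all add: that Df_rename[OF FEx.prems(5)])
  show ?case unfolding clo.simps
    by (intro D11_intros FEx.IH Df_rename[OF FEx.prems(1)] p
       D11_app[OF FEx.prems(2)] D11_app[OF FEx.prems(3)] Df_app[OF FEx.prems(4)])
qed

section \<open>Cluster points and the measure on Cantor space\<close>

lemma ex1_course_of_values:
  fixes \<Phi> :: "(nat \<Rightarrow> 'a) \<Rightarrow> nat \<Rightarrow> 'a"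
  assumes "\<And>i f g. (\<And>j. j < i \<Longrightarrow> f j = g j) \<Longrightarrow> \<Phi> f i = \<Phi> g i"
  shows "\<exists>!f. \<forall>i. f i = \<Phi> f i"
proof (rule ex_ex1I)
  have "adm_wf less_than \<Phi>" unfolding adm_wf_def by (intro allI impI assms) auto
  then have "wfrec less_than \<Phi> = \<Phi> (wfrec less_than \<Phi>)" by (rule wfrec_fixpoint[OF wf_less_than])
  then show "\<exists>f. \<forall>i. f i = \<Phi> f i" by metis
next
  fix f g assume f: "\<forall>i. f i = \<Phi> f i" and g: "\<forall>i. g i = \<Phi> g i"
  have "f i = g i" for i
  proof (induction i rule: less_induct)
    case (less i)
    then show ?case using assms[of i f g] f g by metis
  qed
  then show "f = g" by blast
qed

lemma ex_frequent_value:
  fixes v :: "nat \<Rightarrow> nat"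
  assumes "\<And>N. \<exists>m\<ge>N. P m \<and> v m \<le> B"
  shows "\<exists>a. \<forall>N. \<exists>m\<ge>N. P m \<and> v m = a"
proof (rule ccontr)
  assume "\<not> ?thesis"
  then obtain N where N: "\<And>a m. m \<ge> N a \<Longrightarrow> P m \<Longrightarrow> v m \<noteq> a" by metis
  obtain m where "m \<ge> Max (N ` {..B})" "P m" "v m \<le> B" using assms by blast
  then have "m \<ge> N (v m)" by (meson Max_ge atMost_iff finite_atMost finite_imageI imageI le_trans)
  with N \<open>P m\<close> show False by blast
qed

text \<open>Compactness of a product of finite sets: the values are chosen one at a time, each
  shared by infinitely many members that agree with the earlier choices. The bound at
  \<open>i\<close> may fail for the finitely many \<open>m \<le> i\<close>.\<close>

lemma bounded_cluster_point:
  fixes s :: "nat \<Rightarrow> nat \<Rightarrow> nat"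
  assumes b: "\<And>m i. i < m \<Longrightarrow> s m i \<le> b i"
  obtains f where "\<And>K N. \<exists>m\<ge>N. \<forall>i<K. s m i = f i"
proof -
  define \<Phi> where "\<Phi> f i = (SOME v. \<forall>N. \<exists>m\<ge>N. (\<forall>j<i. s m j = f j) \<and> s m i = v)" for f i
  have "\<exists>!f. \<forall>i. f i = \<Phi> f i"
    unfolding \<Phi>_def by (rule ex1_course_of_values) simp
  then obtain f where f: "\<And>i. f i = \<Phi> f i" by blast
  have "\<forall>N. \<exists>m\<ge>N. \<forall>i<K. s m i = f i" for K
  proof (induction K)
    case (Suc K)
    have "\<exists>v. \<forall>N. \<exists>m\<ge>N. (\<forall>j<K. s m j = f j) \<and> s m K = v"
    proof (rule ex_frequent_value)
      fix N
      obtain m where "m \<ge> max N (Suc K)" "\<forall>i<K. s m i = f i" using Suc by blast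
      then show "\<exists>m\<ge>N. (\<forall>j<K. s m j = f j) \<and> s m K \<le> b K" using b[of K m] by auto
    qed
    then have "\<forall>N. \<exists>m\<ge>N. (\<forall>j<K. s m j = f j) \<and> s m K = f K"
      unfolding f[of K] \<Phi>_def by (rule someI_ex)
    then show ?case by (metis less_Suc_eq)
  qed auto
  then show ?thesis using that by blast
qed

text \<open>The canonical cluster point of a sequence of reals: a bit is False whenever this is possible
  for infinitely many members that agree with the previous bits.\<close>

definition lcp_cond :: "(nat \<Rightarrow> cantor) \<Rightarrow> cantor \<Rightarrow> nat \<Rightarrow> bool" where
  "lcp_cond s w m \<longleftrightarrow> \<not> (\<forall>N. \<exists>i. N \<le> i \<and> (\<forall>j. j < m \<longrightarrow> (s i j \<longleftrightarrow> w j)) \<and> \<not> s i m)"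

definition lcp :: "(nat \<Rightarrow> cantor) \<Rightarrow> cantor" where
  "lcp s = (THE w. \<forall>m. w m = lcp_cond s w m)"

text \<open>Each bit of a solution is determined by the earlier bits, so there is exactly one. In
  \<open>D11_H\<close> this replaces the description \<open>lcp\<close> by a condition on
  bits.\<close>

lemma lcp_iff: "(\<forall>m. w m = lcp_cond s w m) \<longleftrightarrow> w = lcp s"
proof -
  have ex1: "\<exists>!w. \<forall>m. w m = lcp_cond s w m"
    unfolding lcp_cond_def by (rule ex1_course_of_values) simp
  show ?thesis
  proof
    assume "\<forall>m. w m = lcp_cond s w m"
    then show "w = lcp s" unfolding lcp_def by (rule the1_equality[OF ex1, symmetric])
  next
    assume "w = lcp s"
    then show "\<forall>m. w m = lcp_cond s w m" unfolding lcp_def using theI'[OF ex1] by simp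
  qed
qed

lemma lcp_cluster: "\<exists>i\<ge>N. \<forall>m<K. s i m = lcp s m"
proof -
  have lcp: "lcp s m \<longleftrightarrow> \<not> (\<forall>N. \<exists>i. N \<le> i \<and> (\<forall>j. j < m \<longrightarrow> (s i j \<longleftrightarrow> lcp s j)) \<and> \<not> s i m)" for m
    using lcp_iff[of "lcp s" s] unfolding lcp_cond_def by blast
  have "\<forall>N. \<exists>i\<ge>N. \<forall>m<K. s i m = lcp s m"
  proof (induction K)
    case (Suc K)
    show ?case
    proof (cases "lcp s K")
      case True
      with lcp[of K] obtain N0 where N0: "\<And>i. N0 \<le> i \<Longrightarrow> (\<forall>j<K. s i j = lcp s j) \<Longrightarrow> s i K" by blast
      show ?thesis
      proof
        fix N
        obtain i where "i \<ge> max N N0" "\<forall>m<K. s i m = lcp s m" using Suc by blast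
        then show "\<exists>i\<ge>N. \<forall>m<Suc K. s i m = lcp s m" using N0[of i] True by (auto simp: less_Suc_eq)
      qed
    next
      case False
      with lcp[of K] show ?thesis by (metis less_Suc_eq)
    qed
  qed auto
  then show ?thesis by blast
qed

section \<open>The uniform measure, and sets determined by finitely many coordinates\<close>

interpretation cantor: prob_space cantor_measure
  unfolding cantor_measure_def
  by (rule prob_space_PiM) (rule measure_pmf.prob_space_axioms)

lemma space_cantor [simp]: "space cantor_measure = UNIV"
  by (simp add: cantor_measure_def space_PiM)

lemma coordinate_measurable: "{x. x i \<in> B} \<in> sets cantor_measure"
  unfolding cantor_measure_def
  using measurable_sets[OF measurable_component_singleton[of i UNIV "\<lambda>_. measure_pmf (bernoulli_pmf (1/2))"], of B]
  by (simp add: vimage_def space_PiM)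

lemma cylinder_measurable: "{x. \<forall>i<k. x i = b i} \<in> sets cantor_measure"
proof -
  have "{x. \<forall>i<k. x i = b i} = space cantor_measure \<inter> (\<Inter>i\<in>{..<k}. {x. x i \<in> {b i}})" by auto
  also have "\<dots> \<in> sets cantor_measure"
    using coordinate_measurable[of _ "{b _}"] sets.top[of cantor_measure]
    by (cases "k = 0") (auto intro!: sets.finite_INT)
  finally show ?thesis .
qed

lemma cylinder_measure: "measure cantor_measure {x. \<forall>i<k. x i = b i} = (1/2) ^ k"
proof -
  interpret product_prob_space "\<lambda>_::nat. measure_pmf (bernoulli_pmf (1/2))" UNIV
    by standard
  have "emeasure cantor_measure {x. \<forall>i<k. x i = b i} = (\<Prod>i<k. emeasure (measure_pmf (bernoulli_pmf (1/2))) {b i})"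
    using emeasure_PiM_Collect[of "{..<k}" "\<lambda>i. {b i}"] unfolding cantor_measure_def by (simp add: space_PiM Ball_def)
  also have "\<dots> = (\<Prod>i<k. ennreal (1/2))"
    by (intro prod.cong refl) (simp add: emeasure_pmf_single)
  also have "\<dots> = ennreal (\<Prod>i<k. 1/2)" by (rule prod_ennreal) simp
  finally show ?thesis by (simp add: measure_def)
qed

definition dets :: "nat \<Rightarrow> cantor set \<Rightarrow> bool" where
  "dets k S \<longleftrightarrow> (\<forall>x x'. (\<forall>i<k. x i = x' i) \<longrightarrow> x \<in> S \<longrightarrow> x' \<in> S)"

lemma ex_bits: "\<exists>t<2^k. \<forall>i<k. bit (t::nat) i = x i"
proof (induction k)
  case (Suc k)
  then obtain t :: nat where t: "\<forall>i<k. bit t i = x i" by blast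
  define t' where "t' = take_bit (Suc k) (if x k then set_bit k t else unset_bit k t)"
  have "bit t' i = x i" if "i < Suc k" for i
    using t that by (cases "i = k") (auto simp: t'_def bit_take_bit_iff bit_set_bit_iff bit_unset_bit_iff)
  moreover have "t' < 2 ^ Suc k" unfolding t'_def by (rule take_bit_nat_less_exp)
  ultimately show ?case by blast
qed auto

lemma bits_inj:
  fixes s t :: nat
  assumes "s < 2 ^ k" "t < 2 ^ k" "\<And>i. i < k \<Longrightarrow> bit s i = bit t i"
  shows "s = t"
proof -
  have "take_bit k s = take_bit k t"
    by (rule bit_eqI) (auto simp: bit_take_bit_iff assms(3))
  then show ?thesis using assms(1,2) by (simp add: take_bit_nat_eq_self)
qed

text \<open>Such a set is a disjoint union of cylinders, one for each \<open>t < 2 ^ k\<close> read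
  as the real \<open>bit t\<close>. This turns measures into cardinalities, which Delta-1-1
  definitions can express.\<close>

lemma dets_measure:
  assumes "dets k S"
  shows "S \<in> sets cantor_measure"
    and "measure cantor_measure S = card {t. t < 2^k \<and> bit (t::nat) \<in> S} / 2^k"
proof -
  define C where "C t = {x. \<forall>i<k. x i = bit (t::nat) i}" for t
  let ?T = "{t. t < 2^k \<and> bit (t::nat) \<in> S}"
  have fin: "finite ?T" by simp
  have S: "S = (\<Union>t\<in>?T. C t)"
  proof (intro set_eqI iffI)
    fix x assume x: "x \<in> S"
    obtain t where t: "t < 2^k" "\<forall>i<k. bit (t::nat) i = x i" using ex_bits by blast
    with assms x have "bit t \<in> S" unfolding dets_def by metis
    with t show "x \<in> (\<Union>t\<in>?T. C t)" unfolding C_def by auto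
  next
    fix x assume "x \<in> (\<Union>t\<in>?T. C t)"
    then obtain t where "bit t \<in> S" "\<forall>i<k. x i = bit (t::nat) i" by (auto simp: C_def)
    with assms show "x \<in> S" unfolding dets_def by metis
  qed
  have C: "C t \<in> sets cantor_measure" for t unfolding C_def by (rule cylinder_measurable)
  show "S \<in> sets cantor_measure" by (subst S) (use fin C in blast)
  have "disjoint_family_on C ?T"
    unfolding disjoint_family_on_def C_def by (auto intro: bits_inj)
  then have "measure cantor_measure (\<Union>t\<in>?T. C t) = (\<Sum>t\<in>?T. measure cantor_measure (C t))"
    by (intro cantor.finite_measure_finite_Union fin) (auto simp: C)
  also have "\<dots> = card ?T / 2^k"
    by (simp add: C_def cylinder_measure power_divide)
  finally show "measure cantor_measure S = card ?T / 2^k" unfolding S[symmetric] .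
qed

section \<open>Approximation by open and closed sets\<close>

definition opn :: "cantor set \<Rightarrow> bool" where
  "opn U \<longleftrightarrow> (\<forall>x\<in>U. \<exists>k. \<forall>x'. (\<forall>i<k. x' i = x i) \<longrightarrow> x' \<in> U)"

definition inner_cyl :: "cantor set \<Rightarrow> nat \<Rightarrow> cantor set" where
  "inner_cyl U k = {x. \<forall>x'. (\<forall>i<k. x' i = x i) \<longrightarrow> x' \<in> U}"

lemma dets_inner_cyl: "dets k (inner_cyl U k)"
  unfolding dets_def inner_cyl_def by auto

lemma incseq_inner_cyl: "incseq (inner_cyl U)"
  unfolding incseq_def inner_cyl_def by auto

lemma inner_cyl_subset: "inner_cyl U k \<subseteq> U"
  unfolding inner_cyl_def by auto

lemma UN_inner_cyl: "opn U \<Longrightarrow> (\<Union>k. inner_cyl U k) = U"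
  using inner_cyl_subset unfolding opn_def inner_cyl_def by auto

lemma opn_measurable: "opn U \<Longrightarrow> U \<in> sets cantor_measure"
  by (subst UN_inner_cyl[symmetric]) (auto intro: dets_measure(1) dets_inner_cyl)

lemma opn_UN: "(\<And>n. opn (U n)) \<Longrightarrow> opn (\<Union>n. U n)"
  unfolding opn_def by (metis UN_iff)

lemma opn_Int:
  assumes "opn U" "opn V" shows "opn (U \<inter> V)"
  unfolding opn_def
proof
  fix x assume "x \<in> U \<inter> V"
  then obtain k l where "\<And>x'. (\<forall>i<k. x' i = x i) \<Longrightarrow> x' \<in> U" "\<And>x'. (\<forall>i<l. x' i = x i) \<Longrightarrow> x' \<in> V"
    using assms unfolding opn_def by (metis Int_iff)
  then show "\<exists>k. \<forall>x'. (\<forall>i<k. x' i = x i) \<longrightarrow> x' \<in> U \<inter> V"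
    by (intro exI[of _ "max k l"]) auto
qed

lemma opn_INT: "finite I \<Longrightarrow> (\<And>i. i \<in> I \<Longrightarrow> opn (U i)) \<Longrightarrow> opn (\<Inter>i\<in>I. U i)"
  by (induction I rule: finite_induct) (auto intro: opn_Int simp: opn_def[of UNIV])

text \<open>The closed sets \<open>F\<close> are carried along for the induction: complementation
  exchanges the inner closed set with the outer open one.\<close>

lemma cantor_regular:
  assumes "E \<in> sets cantor_measure" "\<delta> > 0"
  shows "\<exists>F U. opn U \<and> opn (- F) \<and> F \<subseteq> E \<and> E \<subseteq> U \<and> measure cantor_measure (U - F) < \<delta>"
proof -
  have "E \<in> sigma_sets UNIV {{f. f i \<in> A} |i A. True}"
    using assms(1) unfolding cantor_measure_def sets_PiM_single by simp
  then show ?thesis using assms(2)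
  proof (induction arbitrary: \<delta> rule: sigma_sets.induct)
    case (Basic E)
    then obtain i A where E: "E = {f. f i \<in> A}" by blast
    have "opn E" "opn (- E)" unfolding E opn_def by (auto intro!: exI[of _ "Suc i"])
    then show ?case using \<open>\<delta> > 0\<close> by (intro exI[of _ E] conjI) auto
  next
    case Empty
    then show ?case by (intro exI[of _ "{}"]) (auto simp: opn_def)
  next
    case (Compl E)
    then obtain F U where "opn U" "opn (- F)" "F \<subseteq> E" "E \<subseteq> U" "measure cantor_measure (U - F) < \<delta>" by blast
    moreover have "- F - - U = U - F" by auto
    ultimately show ?case by (intro exI[of _ "- U"] exI[of _ "- F"]) auto
  next
    case (Union E)
    \<comment> \<open>Half of \<open>\<delta>\<close> is distributed over the pairs. The other half
      pays for replacing the union of all \<open>F n\<close> by a finite one, which is sure to be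
      closed.\<close>
    have "\<exists>F U. opn U \<and> opn (- F) \<and> F \<subseteq> E n \<and> E n \<subseteq> U \<and> measure cantor_measure (U - F) < (\<delta>/2) * (1/2)^Suc n" for n
      using Union.IH[of "(\<delta>/2) * (1/2)^Suc n" n] Union.prems by simp
    then obtain F U where FU: "\<And>n. opn (U n)" "\<And>n. opn (- F n)" "\<And>n. F n \<subseteq> E n" "\<And>n. E n \<subseteq> U n" 
      "\<And>n. measure cantor_measure (U n - F n) < (\<delta>/2) * (1/2)^Suc n" by metis
    have mU: "U n \<in> sets cantor_measure" for n by (rule opn_measurable) (rule FU)
    have mF: "F n \<in> sets cantor_measure" for n
      using sets.compl_sets[OF opn_measurable[OF FU(2)[of n]]] by (simp add: Compl_eq_Diff_UNIV[symmetric])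
    have sums: "(\<lambda>n. (\<delta>/2) * (1/2)^Suc n) sums (\<delta>/2 * 1)"
      by (intro sums_mult power_half_series)
    have le: "measure cantor_measure (U n - F n) \<le> (\<delta>/2) * (1/2)^Suc n" for n using FU(5)[of n] by simp
    have summ: "summable (\<lambda>n. measure cantor_measure (U n - F n))"
      by (rule summable_comparison_test'[OF sums_summable[OF sums]]) (use le in auto)
    have 1: "measure cantor_measure (\<Union>n. U n - F n) \<le> \<delta>/2"
    proof -
      have "measure cantor_measure (\<Union>n. U n - F n) \<le> (\<Sum>n. measure cantor_measure (U n - F n))"
        by (rule cantor.finite_measure_subadditive_countably[OF _ summ]) (auto simp: mU mF)
      also have "\<dots> \<le> (\<Sum>n. (\<delta>/2) * (1/2)^Suc n)"
        by (rule suminf_le[OF le summ sums_summable[OF sums]])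
      also have "\<dots> = \<delta>/2" using sums_unique[OF sums] by simp
      finally show ?thesis .
    qed
    define G where "G m = (\<Union>n\<le>m. F n)" for m
    have mG: "G m \<in> sets cantor_measure" for m unfolding G_def using mF by auto
    have mG': "(\<Union>m. G m) \<in> sets cantor_measure" using mG by blast
    have mUF: "(\<Union>n. U n - F n) \<in> sets cantor_measure" using mU mF by blast
    have FG: "F n \<subseteq> G n" for n unfolding G_def by blast
    have "(\<lambda>m. measure cantor_measure (G m)) \<longlonglongrightarrow> measure cantor_measure (\<Union>m. G m)"
      by (rule cantor.finite_Lim_measure_incseq) (use mG in blast, unfold incseq_def G_def, fastforce)
    from LIMSEQ_D[OF this half_gt_zero[OF \<open>\<delta> > 0\<close>]]
    obtain m where "norm (measure cantor_measure (G m) - measure cantor_measure (\<Union>m. G m)) < \<delta>/2"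
      by blast
    then have m: "measure cantor_measure (\<Union>m. G m) - measure cantor_measure (G m) < \<delta>/2"
      unfolding real_norm_def by linarith
    have "measure cantor_measure ((\<Union>m. G m) - G m) < \<delta>/2"
      using m by (subst cantor.finite_measure_Diff) (auto simp: mG)
    moreover have "measure cantor_measure ((\<Union>n. U n) - G m) \<le> measure cantor_measure ((\<Union>n. U n - F n) \<union> ((\<Union>m. G m) - G m))"
      by (rule cantor.finite_measure_mono) (use FG in blast, use mG mG' mUF in blast)
    moreover have "\<dots> \<le> measure cantor_measure (\<Union>n. U n - F n) + measure cantor_measure ((\<Union>m. G m) - G m)"
      by (rule measure_Un_le) (use mG mG' mUF in blast)+
    ultimately have "measure cantor_measure ((\<Union>n. U n) - G m) < \<delta>" using 1 by simp
    moreover have "opn (\<Union>n. U n)" by (rule opn_UN) (rule FU)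
    moreover have "opn (- G m)"
      using opn_INT[of "{..m}" "\<lambda>n. - F n"] FU(2) by (simp add: G_def)
    moreover have "G m \<subseteq> (\<Union>n. E n)" "(\<Union>n. E n) \<subseteq> (\<Union>n. U n)" using FU(3,4) unfolding G_def by blast+
    ultimately show ?case by blast
  qed
qed

lemma ex_open_cover:
  assumes "E \<in> sets cantor_measure" "\<delta> > 0"
  obtains U where "opn U" "E \<subseteq> U" "measure cantor_measure U < measure cantor_measure E + \<delta>"
proof -
  obtain F U where FU: "opn U" "opn (- F)" "F \<subseteq> E" "E \<subseteq> U" "measure cantor_measure (U - F) < \<delta>"
    using cantor_regular[OF assms] by blast
  have mU: "U \<in> sets cantor_measure" using FU by (simp add: opn_measurable)
  have mF: "F \<in> sets cantor_measure" using sets.compl_sets[OF opn_measurable[OF FU(2)]] by (simp add: Compl_eq_Diff_UNIV[symmetric])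
  have "measure cantor_measure U \<le> measure cantor_measure (E \<union> (U - F))"
    by (rule cantor.finite_measure_mono) (use FU mF mU assms in auto)
  also have "\<dots> \<le> measure cantor_measure E + measure cantor_measure (U - F)"
    by (rule measure_Un_le) (use mF mU assms in auto)
  finally show ?thesis using that FU by fastforce
qed

section \<open>Bounds on outer measure\<close>

definition covered :: "cantor set \<Rightarrow> real \<Rightarrow> bool" where
  "covered Y B \<longleftrightarrow> (\<exists>W\<in>sets cantor_measure. Y \<subseteq> W \<and> measure cantor_measure W \<le> B)"

lemma covered_mono: "covered Y B \<Longrightarrow> Y' \<subseteq> Y \<Longrightarrow> B \<le> B' \<Longrightarrow> covered Y' B'"
  unfolding covered_def by (meson order_trans)

text \<open>Measurability of \<open>Y n\<close> is not at stake: \<open>Y n\<close> lies in every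
  later cover, and the intersections \<open>V n\<close> of all later covers are measurable and
  increase.\<close>

lemma covered_incseq:
  assumes "incseq Y" "\<And>n. covered (Y n) B"
  shows "covered (\<Union>n. Y n) B"
proof -
  obtain W where W: "\<And>n. W n \<in> sets cantor_measure" "\<And>n. Y n \<subseteq> W n" "\<And>n. measure cantor_measure (W n) \<le> B"
    using assms(2) unfolding covered_def by metis
  define V where "V n = (\<Inter>p\<in>{n..}. W p)" for n
  have mV: "V n \<in> sets cantor_measure" for n
    unfolding V_def using W(1) by (intro sets.countable_INT') auto
  have "Y n \<subseteq> V n" for n unfolding V_def using W(2) assms(1) unfolding incseq_def by blast
  then have "(\<Union>n. Y n) \<subseteq> (\<Union>n. V n)" by blast
  moreover have "measure cantor_measure (\<Union>n. V n) \<le> B"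
  proof (rule LIMSEQ_le_const2)
    show "(\<lambda>n. measure cantor_measure (V n)) \<longlonglongrightarrow> measure cantor_measure (\<Union>n. V n)"
      by (rule cantor.finite_Lim_measure_incseq) (use mV in blast, auto simp: incseq_def V_def)
    have "measure cantor_measure (V n) \<le> B" for n
      by (rule order_trans[OF cantor.finite_measure_mono W(3)[of n]]) (auto simp: V_def W(1))
    then show "\<exists>N. \<forall>n\<ge>N. measure cantor_measure (V n) \<le> B" by blast
  qed
  ultimately show ?thesis unfolding covered_def using mV by blast
qed

section \<open>Coded distribution functions and the approximation tree\<close>

abbreviation cut_code :: "nat \<Rightarrow> nat \<Rightarrow> nat \<Rightarrow> nat \<Rightarrow> nat" where
  "cut_code k s a b \<equiv> prod_encode (k, prod_encode (s, prod_encode (a, b)))"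

text \<open>\<^term>\<open>M k s\<close> stands for the mass of the reals lexicographically below the dyadic
  point \<^term>\<open>s / 2 ^ k\<close>; at cut points equal to \<^term>\<open>M k s\<close> the code is unconstrained,
  so that limits of codes are codes.\<close>

definition codes :: "cantor \<Rightarrow> (nat \<Rightarrow> nat \<Rightarrow> real) \<Rightarrow> bool" where
  "codes w M \<longleftrightarrow> (\<forall>k s a b. s \<le> 2^k \<longrightarrow>
     (w (cut_code k s a b) \<longrightarrow> a / 2^b \<le> M k s) \<and> (\<not> w (cut_code k s a b) \<longrightarrow> M k s \<le> a / 2^b))"

text \<open>The gap \<open>1 / 2 ^ Suc k\<close> is half the uniform mass of a cylinder. Unlike bare
  strict monotonicity it is a closed condition, so it survives the limits in
  \<open>codes_lcp\<close>.\<close>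

definition dyadic_cdf :: "(nat \<Rightarrow> nat \<Rightarrow> real) \<Rightarrow> bool" where
  "dyadic_cdf M \<longleftrightarrow> (\<forall>k. M k 0 = 0 \<and> M k (2^k) = 1 \<and> (\<forall>s\<le>2^k. M (Suc k) (2 * s) = M k s) \<and>
     (\<forall>s<2^k. M k s + 1 / 2^Suc k \<le> M k (Suc s)))"

lemma dyadic_cdf_mono:
  assumes "dyadic_cdf M" "s \<le> t" "t \<le> 2^k"
  shows "M k s \<le> M k t"
  using assms(2,3)
proof (induction t rule: dec_induct)
  case (step n)
  then have "M k n + 1 / 2^Suc k \<le> M k (Suc n)" using assms(1) unfolding dyadic_cdf_def by auto
  moreover have "0 \<le> 1 / (2::real)^Suc k" by simp
  ultimately show ?case using step by linarith
qed simp

lemma dyadic_cdf_strict: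
  assumes "dyadic_cdf M" "s < t" "t \<le> 2^k"
  shows "M k s < M k t"
proof -
  have "M k s + 1 / 2^Suc k \<le> M k (Suc s)" using assms unfolding dyadic_cdf_def by auto
  moreover have "0 < 1 / (2::real)^Suc k" by simp
  moreover have "M k (Suc s) \<le> M k t" using assms by (intro dyadic_cdf_mono) auto
  ultimately show ?thesis by linarith
qed

lemma dyadic_cdf_bounds:
  assumes "dyadic_cdf M" "s \<le> 2^k"
  shows "0 \<le> M k s" "M k s \<le> 1"
  using dyadic_cdf_mono[OF assms(1), of 0 s k] dyadic_cdf_mono[OF assms(1) assms(2), of k] assms unfolding dyadic_cdf_def by auto

lemma codes_close:
  assumes "codes w M" "codes w' M'" "s \<le> 2^k" "0 \<le> M k s" "M k s \<le> 1"
    and agree: "\<And>a. a \<le> 2^Suc b \<Longrightarrow> w (cut_code k s a b) = w' (cut_code k s a b)"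
  shows "M' k s \<le> M k s + 1 / 2^b"
proof (rule ccontr)
  assume *: "\<not> ?thesis"
  \<comment> \<open>\<open>a / 2 ^ b\<close> is the first multiple of \<open>1 / 2 ^ b\<close>
    strictly above \<open>M k s\<close>. If the claim failed, it would be strictly below
    \<open>M' k s\<close>, and the two codes would differ there; \<open>M k s \<le> 1\<close> keeps
    \<open>a\<close> in the range of \<open>agree\<close>.\<close>
  define a where "a = nat \<lfloor>M k s * 2^b\<rfloor> + 1"
  have fl: "real (nat \<lfloor>M k s * 2^b\<rfloor>) = \<lfloor>M k s * 2^b\<rfloor>" using assms(4) by simp
  have "real a > M k s * 2^b" "real a \<le> M k s * 2^b + 1" unfolding a_def of_nat_add fl by linarith+
  then have a: "M k s < a / 2^b" "a / 2^b \<le> M k s + 1 / 2^b" by (simp_all add: field_simps)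
  have "M k s * 2^b \<le> 1 * 2^b" by (intro mult_right_mono assms) simp
  then have "real a \<le> 2^b + 1" using \<open>real a \<le> M k s * 2^b + 1\<close> by linarith
  then have "real a \<le> real (2^b + 1)" by simp
  then have "a \<le> 2^b + 1" by (simp only: of_nat_le_iff)
  also have "\<dots> \<le> 2^Suc b" by simp
  finally have "w (cut_code k s a b) = w' (cut_code k s a b)" by (rule agree)
  moreover have "\<not> w (cut_code k s a b)" using assms(1,3) a(1) unfolding codes_def by fastforce
  moreover have "w' (cut_code k s a b)"
    using assms(2,3) a(2) * unfolding codes_def by (smt (verit))
  ultimately show False by blast
qed

lemma abs_le_all_imp_eq:
  fixes u v :: real
  assumes "\<And>\<delta>. \<delta> > 0 \<Longrightarrow> \<bar>u - v\<bar> \<le> \<delta>"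
  shows "u = v"
proof (rule ccontr)
  assume "u \<noteq> v"
  then show False using assms[of "\<bar>u - v\<bar> / 2"] by simp
qed

text \<open>A cut condition concerns one or two bits, so it passes to \<open>lcp S\<close> through a
  member that agrees on them. Up to precision \<open>1 / 2 ^ b\<close> the levels up to
  \<open>k\<close> depend on finitely many cuts; hence some late member is close to \<open>L\<close>
  on all of them, and the closed conditions of \<open>dyadic_cdf\<close> carry over.\<close>

lemma codes_lcp:
  assumes M: "\<And>i. codes (S i) (M i)" "\<And>i. dyadic_cdf (M i)"
  obtains L where "codes (lcp S) L" "dyadic_cdf L"
    "\<And>k \<delta> N. \<delta> > 0 \<Longrightarrow> \<exists>i\<ge>N. \<forall>k'\<le>k. \<forall>s\<le>2^k'. \<bar>M i k' s - L k' s\<bar> \<le> \<delta>"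
proof -
  define T where "T k s = {real a / 2^b |a b. lcp S (cut_code k s a b)}" for k s
  \<comment> \<open>The added 0 keeps the set nonempty and \<open>L\<close> nonnegative.\<close>
  define L where "L k s = Sup (insert 0 (T k s))" for k s
  have ag: "\<exists>i\<ge>N. S i m = lcp S m \<and> S i m' = lcp S m'" for m m' N
    using lcp_cluster[of N "Suc (max m m')" S] by (metis le_imp_less_Suc max.cobounded1 max.cobounded2)
  have sep: "real a / 2^b \<le> real a' / 2^b'"
    if h: "lcp S (cut_code k s a b)" "\<not> lcp S (cut_code k s a' b')" "s \<le> 2^k" for k s a b a' b'
  proof -
    obtain i where "S i (cut_code k s a b)" "\<not> S i (cut_code k s a' b')" using ag h(1,2) by metis
    then have "real a / 2^b \<le> M i k s" "M i k s \<le> real a' / 2^b'"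
      using M(1)[of i] h(3) unfolding codes_def by blast+
    then show ?thesis by linarith
  qed
  have le1: "real a / 2^b \<le> 1" if h: "lcp S (cut_code k s a b)" "s \<le> 2^k" for k s a b
  proof -
    obtain i where "S i (cut_code k s a b)" using ag h(1) by metis
    then have "real a / 2^b \<le> M i k s" using M(1)[of i] h(2) unfolding codes_def by blast
    then show ?thesis using dyadic_cdf_bounds(2)[OF M(2) h(2), of i] by linarith
  qed
  have bdd: "bdd_above (insert 0 (T k s))" if "s \<le> 2^k" for k s
    unfolding bdd_above_def T_def using le1[OF _ that] by (intro exI[of _ 1]) auto
  have L01: "0 \<le> L k s" "L k s \<le> 1" if "s \<le> 2^k" for k s
  proof -
    show "0 \<le> L k s" unfolding L_def by (rule cSup_upper[OF _ bdd[OF that]]) simp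
    show "L k s \<le> 1" unfolding L_def by (rule cSup_least) (use le1[OF _ that] in \<open>auto simp: T_def\<close>)
  qed
  have codes: "codes (lcp S) L"
    unfolding codes_def
  proof (intro allI impI conjI)
    fix k s a b :: nat assume s: "s \<le> 2^k"
    show "real a / 2^b \<le> L k s" if "lcp S (cut_code k s a b)"
      unfolding L_def by (rule cSup_upper[OF _ bdd[OF s]]) (use that in \<open>auto simp: T_def\<close>)
    show "L k s \<le> real a / 2^b" if "\<not> lcp S (cut_code k s a b)"
      unfolding L_def by (rule cSup_least) (use sep[OF _ that s] in \<open>auto simp: T_def\<close>)
  qed
  have close: "\<exists>i\<ge>N. \<forall>k'\<le>k. \<forall>s\<le>2^k'. \<bar>M i k' s - L k' s\<bar> \<le> \<delta>" if d: "\<delta> > 0" for k \<delta> N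
  proof -
    obtain b where b: "(1/2)^b < \<delta>" using real_arch_pow_inv[OF d, of "1/2"] by auto
    define C where "C = (\<lambda>(k', s, a). cut_code k' s a b) ` ({..k} \<times> {..2^k} \<times> {..2^Suc b})"
    have "finite C" unfolding C_def by (intro finite_imageI finite_cartesian_product finite_atMost)
    then obtain K where K: "\<forall>m\<in>C. m < K" unfolding finite_nat_set_iff_bounded ..
    obtain i where i: "i \<ge> N" "\<forall>m<K. S i m = lcp S m"
      using lcp_cluster[of N K S] by blast
    have "\<bar>M i k' s - L k' s\<bar> \<le> \<delta>" if "k' \<le> k" "s \<le> 2^k'" for k' s
    proof -
      have "s \<le> 2^k" using order_trans[OF that(2) power_increasing[OF that(1)]] by simp
      then have "cut_code k' s a b \<in> C" if "a \<le> 2^Suc b" for a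
        unfolding C_def using that \<open>k' \<le> k\<close> by (intro image_eqI[where x = "(k', s, a)"]) auto
      then have ag: "S i (cut_code k' s a b) = lcp S (cut_code k' s a b)" if "a \<le> 2^Suc b" for a
        using that i(2) K by blast
      have "L k' s \<le> M i k' s + 1 / 2^b"
        by (rule codes_close[OF M(1) codes]) (use that dyadic_cdf_bounds[OF M(2)] ag in auto)
      moreover have "M i k' s \<le> L k' s + 1 / 2^b"
        by (rule codes_close[OF codes M(1)]) (use that L01 ag in auto)
      ultimately show ?thesis using b by (simp add: power_divide abs_le_iff)
    qed
    with i(1) show ?thesis by blast
  qed
  have "dyadic_cdf L" unfolding dyadic_cdf_def
  proof (intro allI conjI impI)
    fix k
    show "L k 0 = 0"
    proof (rule abs_le_all_imp_eq)
      fix \<delta> :: real assume "\<delta> > 0"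
      from close[OF this, of 0 k] obtain i where "\<bar>M i k 0 - L k 0\<bar> \<le> \<delta>" by blast
      moreover have "M i k 0 = 0" using M(2) unfolding dyadic_cdf_def by blast
      ultimately show "\<bar>L k 0 - 0\<bar> \<le> \<delta>" by simp
    qed
    show "L k (2^k) = 1"
    proof (rule abs_le_all_imp_eq)
      fix \<delta> :: real assume "\<delta> > 0"
      from close[OF this, of 0 k] obtain i where "\<bar>M i k (2^k) - L k (2^k)\<bar> \<le> \<delta>" by blast
      moreover have "M i k (2^k) = 1" using M(2) unfolding dyadic_cdf_def by blast
      ultimately show "\<bar>L k (2^k) - 1\<bar> \<le> \<delta>" by (simp add: abs_minus_commute)
    qed
    fix s :: nat
    show "L (Suc k) (2 * s) = L k s" if "s \<le> 2^k"
    proof (rule abs_le_all_imp_eq)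
      fix \<delta> :: real assume "\<delta> > 0"
      then have "\<delta>/2 > 0" by simp
      from close[OF this, of 0 "Suc k"] obtain i where
        i: "\<And>k' s. k' \<le> Suc k \<Longrightarrow> s \<le> 2^k' \<Longrightarrow> \<bar>M i k' s - L k' s\<bar> \<le> \<delta>/2" by blast
      have "\<bar>M i (Suc k) (2 * s) - L (Suc k) (2 * s)\<bar> \<le> \<delta>/2" "\<bar>M i k s - L k s\<bar> \<le> \<delta>/2"
        by (rule i; use that in simp)+
      moreover have "M i (Suc k) (2 * s) = M i k s" using M(2) that unfolding dyadic_cdf_def by blast
      ultimately show "\<bar>L (Suc k) (2 * s) - L k s\<bar> \<le> \<delta>" by linarith
    qed
    show "L k s + 1 / 2^Suc k \<le> L k (Suc s)" if "s < 2^k"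
    proof (rule field_le_epsilon)
      fix \<delta> :: real assume "\<delta> > 0"
      then have "\<delta>/2 > 0" by simp
      from close[OF this, of 0 k] obtain i where
        i: "\<And>k' s. k' \<le> k \<Longrightarrow> s \<le> 2^k' \<Longrightarrow> \<bar>M i k' s - L k' s\<bar> \<le> \<delta>/2" by blast
      have "\<bar>M i k s - L k s\<bar> \<le> \<delta>/2" "\<bar>M i k (Suc s) - L k (Suc s)\<bar> \<le> \<delta>/2"
        by (rule i; use that in simp)+
      moreover have "M i k s + 1 / 2^Suc k \<le> M i k (Suc s)" using M(2) that unfolding dyadic_cdf_def by blast
      ultimately show "L k s + 1 / 2^Suc k \<le> L k (Suc s) + \<delta>" by linarith
    qed
  qed
  with codes close show ?thesis using that by blast
qed

lemma str_less: "str y k < 2^k"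
  by (induction k) auto

lemma str_cong: "(\<And>i. i < k \<Longrightarrow> x i = y i) \<Longrightarrow> str x k = str y k"
  by (induction k) auto

lemma D11_finite_ex:
  assumes "finite S" "\<And>s. s \<in> S \<Longrightarrow> D11 x (R s)"
  shows "D11 x (\<lambda>w e. \<exists>s\<in>S. R s w e)"
  using assms by (induction S rule: finite_induct) (auto intro: D11_const D11_or)

text \<open>The assumption \<open>small\<close> is what remains of the outer measure of \<^term>\<open>X\<close>: inside the clopen
  set \<^term>\<open>N\<close> almost nothing is disjoint from \<^term>\<open>X\<close>.\<close>

locale pushforward =
  fixes \<Gamma> :: "bool \<Rightarrow> nat \<Rightarrow> nat \<Rightarrow> cantor \<Rightarrow> (nat \<Rightarrow> nat) \<Rightarrow> bool"
    and X N :: "cantor set" and \<Phi> :: "cantor \<Rightarrow> cantor" and K p :: nat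
  assumes local: "\<And>b n k x x' f f'. (\<And>i. i < k \<Longrightarrow> x i = x' i) \<Longrightarrow> (\<And>i. i < k \<Longrightarrow> f i = f' i) \<Longrightarrow>
      \<Gamma> b n k x f = \<Gamma> b n k x' f'"
    and D11_\<Gamma>: "\<And>b f g h d. Df (\<lambda>_. False) f \<Longrightarrow> Df (\<lambda>_. False) g \<Longrightarrow> Df (\<lambda>_. False) h \<Longrightarrow> Df (\<lambda>_. False) d \<Longrightarrow>
      D11 (\<lambda>_. False) (\<lambda>w e. \<Gamma> b (f w e) (g w e) (bit (h w e)) (lookup (d w e)))"
    and \<Phi>: "\<And>x b n. x \<in> X \<Longrightarrow> (\<exists>f. \<forall>k. \<Gamma> b n k x f) \<longleftrightarrow> \<Phi> x n = b"
    and dets_N: "dets K N"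
    and small: "\<And>Q. Q \<in> sets cantor_measure \<Longrightarrow> Q \<inter> X = {} \<Longrightarrow> measure cantor_measure (N \<inter> Q) < 1 / 2^p"
begin

text \<open>A nonempty node \<^term>\<open>c\<close> codes a number \<open>j = lookup c 0\<close> and a finite sequence
  \<open>g\<close>, with \<open>g i = lookup c (Suc i)\<close>. \<^term>\<open>P b c n x\<close> is the clopen approximation, at stage
  \<^term>\<open>len c\<close>, to the existence of a witness bounded by \<open>g\<close> for the value \<^term>\<open>b\<close> of bit
  \<^term>\<open>n\<close>; \<^term>\<open>Q c x\<close> says that both values have such witnesses for some bit below \<open>j\<close>.\<close>

definition P :: "bool \<Rightarrow> nat \<Rightarrow> nat \<Rightarrow> cantor \<Rightarrow> bool" where
  "P b c n x \<longleftrightarrow> (\<exists>d. (\<forall>i. Suc i < len c \<longrightarrow> lookup d i \<le> lookup c (Suc i)) \<and>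
     (\<forall>k. k < len c \<longrightarrow> \<Gamma> b n k x (lookup d)))"

definition Q :: "nat \<Rightarrow> cantor \<Rightarrow> bool" where
  "Q c x \<longleftrightarrow> (\<exists>n. n < lookup c 0 \<and> P True c n x \<and> P False c n x)"

text \<open>Counting over \<open>len c + K\<close> bits, which decide both \<open>N\<close> and
  \<open>Q c\<close>, expresses a measure below \<open>1 / 2 ^ p\<close> without real numbers; see
  \<open>leaf_iff\<close>. The root is excluded because it does not name \<open>j\<close>
  yet.\<close>

definition leaf :: "nat \<Rightarrow> bool" where
  "leaf c \<longleftrightarrow> 0 < len c \<and> card {t::nat. t < 2^(len c + K) \<and> bit t \<in> N \<and> Q c (bit t)} * 2^p < 2^(len c + K)"

text \<open>\<open>P True c n\<close> is the guess for \<open>\<Phi> x n\<close>. Below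
  \<open>lookup c 0\<close> it is right if the witnesses for the true values obey the bounds in
  \<open>c\<close> and \<open>Q c x\<close> fails.\<close>

definition cnt :: "nat \<Rightarrow> nat \<Rightarrow> nat \<Rightarrow> nat" where
  "cnt c k s = card {t::nat. t < 2^(len c + K) \<and> str (\<lambda>n. P True c n (bit t)) k < s}"

text \<open>The inequality is \<open>a / 2 ^ b < leafM c k s\<close> with denominators
  cleared.\<close>

definition leafw :: "nat \<Rightarrow> cantor" where
  "leafw c m \<longleftrightarrow> (\<exists>k s a b. m = cut_code k s a b \<and>
     2 * a * 2^(len c + K) * 2^k < 2^b * (cnt c k s * 2^k + s * 2^(len c + K)))"

text \<open>The average of the image of the uniform measure under the clopen approximation to \<^term>\<open>\<Phi>\<close>
  and the uniform measure; the latter makes the distribution function strictly increasing.\<close>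

definition leafM :: "nat \<Rightarrow> nat \<Rightarrow> nat \<Rightarrow> real" where
  "leafM c k s = (cnt c k s / 2^(len c + K) + s / 2^k) / 2"

lemma dets_P: "dets (len c) {x. P b c n x}"
  unfolding dets_def
proof (intro allI impI)
  fix x x' :: cantor assume *: "\<forall>i<len c. x i = x' i" "x \<in> {x. P b c n x}"
  then obtain d where d: "\<forall>i. Suc i < len c \<longrightarrow> lookup d i \<le> lookup c (Suc i)"
    "\<And>k. k < len c \<Longrightarrow> \<Gamma> b n k x (lookup d)" unfolding P_def by blast
  have "\<Gamma> b n k x' (lookup d)" if "k < len c" for k
    using d(2)[OF that] local[of k x x' "lookup d" "lookup d" b n] *(1) that by simp
  with d(1) show "x' \<in> {x. P b c n x}" unfolding P_def by blast
qed

lemma P_cong: "(\<And>i. i < len c \<Longrightarrow> x i = x' i) \<Longrightarrow> P b c n x = P b c n x'"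
  using dets_P[of c b n] unfolding dets_def by (metis mem_Collect_eq)

lemma dets_Q: "dets (len c + K) {x. x \<in> N \<and> Q c x}" "dets (len c) {x. Q c x}"
proof -
  have "Q c x = Q c x'" if "\<forall>i<len c. x i = x' i" for x x'
    using P_cong[of c x x'] that unfolding Q_def by metis
  note Q = this
  show "dets (len c) {x. Q c x}" unfolding dets_def using Q by blast
  show "dets (len c + K) {x. x \<in> N \<and> Q c x}" unfolding dets_def
  proof (intro allI impI)
    fix x x' :: cantor assume *: "\<forall>i<len c + K. x i = x' i" "x \<in> {x. x \<in> N \<and> Q c x}"
    then have "x' \<in> N" using dets_N unfolding dets_def by (metis (mono_tags, lifting) mem_Collect_eq trans_less_add2)
    moreover have "Q c x'" using Q[of x x'] * by simp
    ultimately show "x' \<in> {x. x \<in> N \<and> Q c x}" by simp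
  qed
qed

lemma leaf_iff: "leaf c \<longleftrightarrow> 0 < len c \<and> measure cantor_measure {x. x \<in> N \<and> Q c x} < 1 / 2^p"
proof -
  let ?n = "card {t::nat. t < 2^(len c + K) \<and> bit (t::nat) \<in> N \<and> Q c (bit t)}"
  have "measure cantor_measure {x. x \<in> N \<and> Q c x} = ?n / 2^(len c + K)"
    using dets_measure(2)[OF dets_Q(1)] by simp
  moreover have "?n * 2^p < 2^(len c + K) \<longleftrightarrow> real ?n * 2^p < 2^(len c + K)"
    by (metis (no_types, lifting) of_nat_less_iff of_nat_mult of_nat_numeral of_nat_power)
  moreover have "real ?n * 2^p < 2^(len c + K) \<longleftrightarrow> ?n / 2^(len c + K) < 1 / 2^p"
    by (simp add: field_simps)
  ultimately show ?thesis unfolding leaf_def by simp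
qed

lemma P_parent: "P b (ncons i c) n x \<Longrightarrow> P b c n x"
  unfolding P_def by (metis (no_types, lifting) len_simps(2) less_SucI less_irrefl_nat lookup_simps(2))

text \<open>On a path without leaves, contradictions persist on a subset of \<open>N\<close> of
  measure at least \<open>1 / 2 ^ p\<close>. At each of its points one bit below \<open>j\<close> is
  contradictory at every level, and compactness turns the bounded approximate witnesses into true
  ones for both values. So the point lies outside \<open>X\<close>, against
  \<open>small\<close>.\<close>

lemma wf_tree: "wf {(ncons i c, c) |i c. \<not> leaf c}"
  unfolding wf_iff_no_infinite_down_chain
proof
  assume "\<exists>F. \<forall>i. (F (Suc i), F i) \<in> {(ncons i c, c) |i c. \<not> leaf c}"
  then obtain F where F: "\<And>m. \<exists>i. F (Suc m) = ncons i (F m)" "\<And>m. \<not> leaf (F m)" by blast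
  have len: "len (F m) = len (F 0) + m" for m
    by (induction m) (use F(1) in \<open>auto, metis len_simps(2)\<close>)
  have lk: "lookup (F (m + a)) i = lookup (F m) i" if "i < len (F m)" for m a i
  proof (induction a)
    case (Suc a)
    obtain j where "F (Suc (m + a)) = ncons j (F (m + a))" using F(1) by blast
    moreover have "i \<noteq> len (F (m + a))" using that len[of m] len[of "m + a"] by simp
    ultimately show ?case using Suc by simp
  qed simp
  \<comment> \<open>The path may start at the empty node, which does not contain \<open>j\<close>;
    hence the index 1 here and \<open>Suc m\<close> below.\<close>
  define j where "j = lookup (F 1) 0"
  have j: "lookup (F (Suc m)) 0 = j" for m
    using lk[of 0 1 m] len[of 1] unfolding j_def by simp
  define G where "G i = lookup (F (Suc (Suc i))) (Suc i)" for i
  have G: "lookup (F m) (Suc i) = G i" if "i < m" "Suc i < len (F m)" for i m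
  proof (cases "m \<le> Suc i")
    case True
    with that have "m = Suc i" by simp
    then show ?thesis using lk[of "Suc i" m 1] that unfolding G_def by simp
  next
    case False
    then have "Suc (Suc i) + (m - Suc (Suc i)) = m" by simp
    moreover have "Suc i < len (F (Suc (Suc i)))" using len[of "Suc (Suc i)"] by simp
    ultimately show ?thesis using lk unfolding G_def by metis
  qed
  define R where "R m = {x. x \<in> N \<and> Q (F (Suc m)) x}" for m
  have PS: "P b (F (Suc m)) n x \<Longrightarrow> P b (F m) n x" for b m n x
    using F(1)[of m] P_parent by metis
  have P_mono: "P b (F (m + a)) n x \<Longrightarrow> P b (F m) n x" for b m n x a
    by (induction a) (auto dest: PS)
  have Q_mono: "Q (F (Suc (Suc m))) x \<Longrightarrow> Q (F (Suc m)) x" for m x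
    unfolding Q_def j using PS by blast
  have mR: "R m \<in> sets cantor_measure" for m
    unfolding R_def by (rule dets_measure(1)[OF dets_Q(1)])
  have "1 / 2^p \<le> measure cantor_measure (R m)" for m
    using F(2)[of "Suc m"] len[of "Suc m"] unfolding R_def leaf_iff by simp
  moreover have "(\<lambda>m. measure cantor_measure (R m)) \<longlonglongrightarrow> measure cantor_measure (\<Inter>m. R m)"
    by (rule cantor.finite_Lim_measure_decseq) (use mR in blast, rule decseq_SucI, use Q_mono in \<open>auto simp: R_def\<close>)
  ultimately have ge: "1 / 2^p \<le> measure cantor_measure (\<Inter>m. R m)"
    by (intro LIMSEQ_le_const) blast+
  define E where "E = (\<Inter>m. {x. Q (F (Suc m)) x})"
  have mE: "E \<in> sets cantor_measure"
    unfolding E_def using dets_measure(1)[OF dets_Q(2)] by blast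
  have "E \<inter> X = {}"
  proof (rule ccontr)
    assume "E \<inter> X \<noteq> {}"
    then obtain x where x: "x \<in> X" "\<And>m. Q (F (Suc m)) x" unfolding E_def by blast
    then obtain v where v: "\<And>m. v m < j" "\<And>m. P True (F (Suc m)) (v m) x" "\<And>m. P False (F (Suc m)) (v m) x"
      unfolding Q_def j by metis
    \<comment> \<open>The contradictory bit may change with the level. As it stays below
      \<open>j\<close>, some value recurs infinitely often, and \<open>P_mono\<close> spreads it to
      every level.\<close>
    have "\<exists>a. \<forall>N. \<exists>m\<ge>N. True \<and> v m = a"
      by (rule ex_frequent_value[where B = j]) (use v(1) less_imp_le in blast)
    then obtain n where n: "\<And>N. \<exists>m\<ge>N. v m = n" by blast
    have Pn: "P b (F (Suc m)) n x" for b m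
    proof -
      obtain m' where m': "m' \<ge> m" "v m' = n" using n by blast
      then have "P b (F (Suc m')) n x" using v(2,3)[of m'] by (cases b) auto
      then show ?thesis using P_mono[of b "Suc m" "m' - m" n x] m'(1) by simp
    qed
    have "\<exists>f. \<forall>k. \<Gamma> b n k x f" for b
    proof -
      from Pn[of b] obtain d where d: "\<And>m i. Suc i < len (F (Suc m)) \<Longrightarrow> lookup (d m) i \<le> lookup (F (Suc m)) (Suc i)"
        "\<And>m k. k < len (F (Suc m)) \<Longrightarrow> \<Gamma> b n k x (lookup (d m))" unfolding P_def by metis
      have "lookup (d m) i \<le> G i" if "i < m" for m i
        using d(1)[of i m] G[of i "Suc m"] len[of "Suc m"] that by simp
      then obtain f where f: "\<And>K N. \<exists>m\<ge>N. \<forall>i<K. lookup (d m) i = f i"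
        using bounded_cluster_point[of "\<lambda>m. lookup (d m)" G] by blast
      \<comment> \<open>Stage \<open>k\<close> reads only \<open>k\<close> values of the witness, so
        it transfers from a late \<open>d m\<close> to the cluster point.\<close>
      have "\<Gamma> b n k x f" for k
      proof -
        obtain m where m: "m \<ge> k" "\<forall>i<k. lookup (d m) i = f i" using f by blast
        then have "\<Gamma> b n k x (lookup (d m))" using d(2) len[of "Suc m"] by simp
        then show ?thesis using local[of k x x "lookup (d m)" f b n] m(2) by simp
      qed
      then show ?thesis by blast
    qed
    then show False using \<Phi>[OF x(1), of True n] \<Phi>[OF x(1), of False n] by simp
  qed
  from small[OF mE this] have "measure cantor_measure (N \<inter> E) < 1 / 2^p" .
  moreover have "N \<inter> E = (\<Inter>m. R m)" unfolding E_def R_def by auto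
  ultimately show False using ge by simp
qed

end

section \<open>A hyperarithmetic dominating measure\<close>

context pushforward
begin

abbreviation (input) "O\<^sub>0 \<equiv> \<lambda>_::nat. False"

lemma D11_P:
  assumes "Df O\<^sub>0 f" "Df O\<^sub>0 g" "Df O\<^sub>0 h"
  shows "D11 O\<^sub>0 (\<lambda>w e. P b (f w e) (g w e) (bit (h w e)))"
proof (rule D11_rel3[where R = "\<lambda>c n t. P b c n (bit t)", OF _ assms])
  show "D11 O\<^sub>0 (\<lambda>w e. P b (e 0) (e 1) (bit (e 2)))"
    unfolding P_def by (intro D11_intros Df_len Df_lookup D11_\<Gamma>)
qed

lemma D11_Q:
  assumes "Df O\<^sub>0 f" "Df O\<^sub>0 h"
  shows "D11 O\<^sub>0 (\<lambda>w e. Q (f w e) (bit (h w e)))"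
proof (rule D11_rel2[where R = "\<lambda>c t. Q c (bit t)", OF _ assms])
  show "D11 O\<^sub>0 (\<lambda>w e. Q (e 0) (bit (e 1)))"
    unfolding Q_def by (intro D11_intros Df_lookup D11_P)
qed

lemma D11_N:
  assumes "Df O\<^sub>0 f"
  shows "D11 O\<^sub>0 (\<lambda>w e. bit (f w e) \<in> N)"
proof (rule D11_rel1[where R = "\<lambda>t. bit t \<in> N", OF _ assms])
  \<comment> \<open>Finitely many patterns of length \<open>K\<close> decide membership in
    \<open>N\<close>, and a fixed finite list of them can be built into the definition.\<close>
  define S where "S = {s. s < 2^K \<and> bit (s::nat) \<in> N}"
  have *: "bit (t::nat) \<in> N \<longleftrightarrow> (\<exists>s\<in>S. \<forall>i. i < K \<longrightarrow> (bit t i \<longleftrightarrow> bit s i))" for t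
  proof
    assume t: "bit t \<in> N"
    obtain s where s: "s < 2^K" "\<forall>i<K. bit (s::nat) i = bit t i" using ex_bits by blast
    then have "bit s \<in> N" using dets_N t unfolding dets_def by (metis (full_types))
    with s show "\<exists>s\<in>S. \<forall>i. i < K \<longrightarrow> (bit t i \<longleftrightarrow> bit s i)" by (auto simp: S_def)
  next
    assume "\<exists>s\<in>S. \<forall>i. i < K \<longrightarrow> (bit t i \<longleftrightarrow> bit s i)"
    then show "bit t \<in> N" unfolding S_def using dets_N unfolding dets_def by (metis (mono_tags, lifting) mem_Collect_eq)
  qed
  show "D11 O\<^sub>0 (\<lambda>w e. bit (e 0) \<in> N)"
    unfolding * by (intro D11_finite_ex D11_intros D11_bit) (simp add: S_def)
qed

lemma D11_leaf:
  assumes "Df O\<^sub>0 f"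
  shows "D11 O\<^sub>0 (\<lambda>w e. leaf (f w e))"
proof (rule D11_rel1[OF _ assms])
  show "D11 O\<^sub>0 (\<lambda>w e. leaf (e 0))"
    unfolding leaf_def by (intro D11_intros Df_len Df_card Df_power D11_Q D11_N)
qed

lemma D11_leafw:
  assumes "Df O\<^sub>0 f" "Df O\<^sub>0 g"
  shows "D11 O\<^sub>0 (\<lambda>w e. leafw (f w e) (g w e))"
proof (rule D11_rel2[OF _ assms])
  show "D11 O\<^sub>0 (\<lambda>w e. leafw (e 0) (e 1))"
    unfolding leafw_def cnt_def by (intro D11_intros Df_len Df_card Df_power Df_str D11_P)
qed

definition H :: "nat \<Rightarrow> cantor" where
  "H = wfrec {(ncons i c, c) |i c. \<not> leaf c} (\<lambda>h c. if leaf c then leafw c else lcp (\<lambda>i. h (ncons i c)))"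

lemma H_eq: "H c = (if leaf c then leafw c else lcp (\<lambda>i. H (ncons i c)))"
proof (cases "leaf c")
  case True
  then show ?thesis unfolding H_def by (subst wfrec[OF wf_tree]) simp
next
  case False
  then have "cut H {(ncons i c, c) |i c. \<not> leaf c} c (ncons i c) = H (ncons i c)" for i
    by (intro cut_apply) blast
  moreover have "H c = (if leaf c then leafw c else lcp (\<lambda>i. cut H {(ncons i c, c) |i c. \<not> leaf c} c (ncons i c)))"
    unfolding H_def by (rule wfrec[OF wf_tree])
  ultimately show ?thesis by simp
qed

text \<open>All \<open>H c\<close> are columns of one real \<open>W\<close>, and
  \<open>\<Theta>\<close> states the recursion node by node. Using \<open>lcp_cond\<close> in place
  of the description \<open>lcp\<close> keeps it Delta-1-1; induction along \<open>wf_tree\<close>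
  excludes other solutions.\<close>

lemma D11_H:
  assumes "Df O\<^sub>0 f" "Df O\<^sub>0 g"
  shows "D11 O\<^sub>0 (\<lambda>w e. H (f w e) (g w e))"
proof (rule D11_rel2[OF _ assms])
  define W where "W = (\<lambda>u. case prod_decode u of (c, m) \<Rightarrow> H c m)"
  define \<Theta> where "\<Theta> w \<longleftrightarrow> (\<forall>c m. w (prod_encode (c, m)) \<longleftrightarrow> (if leaf c then leafw c m
    else lcp_cond (\<lambda>i j. w (prod_encode (ncons i c, j))) (\<lambda>j. w (prod_encode (c, j))) m))" for w
  have \<Theta>: "\<Theta> w \<longleftrightarrow> w = W" for w
  proof
    assume "\<Theta> w"
    then have *: "w (prod_encode (c, m)) = (if leaf c then leafw c m
        else lcp_cond (\<lambda>i j. w (prod_encode (ncons i c, j))) (\<lambda>j. w (prod_encode (c, j))) m)" for c m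
      unfolding \<Theta>_def by blast
    have "(\<lambda>j. w (prod_encode (c, j))) = H c" for c
    proof (induction c rule: wf_induct_rule[OF wf_tree])
      case (1 c)
      show ?case
      proof (cases "leaf c")
        case True
        then show ?thesis using H_eq[of c] by (simp add: fun_eq_iff *[of c])
      next
        case False
        then have IH: "(\<lambda>j. w (prod_encode (ncons i c, j))) = H (ncons i c)" for i
          by (intro 1) blast
        have "\<forall>m. (\<lambda>j. w (prod_encode (c, j))) m = lcp_cond (\<lambda>i. H (ncons i c)) (\<lambda>j. w (prod_encode (c, j))) m"
        proof
          fix m
          have "w (prod_encode (c, m)) = lcp_cond (\<lambda>i j. w (prod_encode (ncons i c, j))) (\<lambda>j. w (prod_encode (c, j))) m"
            by (rule trans[OF *[of c m]]) (simp only: False if_False)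
          then show "w (prod_encode (c, m)) = lcp_cond (\<lambda>i. H (ncons i c)) (\<lambda>j. w (prod_encode (c, j))) m"
            unfolding IH .
        qed
        then show ?thesis unfolding lcp_iff using H_eq[of c] False by simp
      qed
    qed
    then have "w (prod_encode (c, j)) = H c j" for c j by (rule fun_cong)
    then show "w = W" unfolding W_def
      by (auto simp: fun_eq_iff split: prod.split) (metis prod_decode_inverse)+
  next
    assume w: "w = W"
    have "H c m = (if leaf c then leafw c m else lcp_cond (\<lambda>i j. H (ncons i c) j) (\<lambda>j. H c j) m)" for c m
    proof (cases "leaf c")
      case False
      then have "H c = lcp (\<lambda>i. H (ncons i c))" using H_eq by simp
      then show ?thesis using False unfolding lcp_iff[symmetric] by simp
    qed (simp add: H_eq)
    then show "\<Theta> w" unfolding \<Theta>_def w W_def prod_encode_inverse prod.case by blast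
  qed
  have "D11 O\<^sub>0 (\<lambda>w e. W (prod_encode (e 0, e 1)))"
    by (rule D11_unique[where W = "\<lambda>e. W", OF \<Theta>], unfold \<Theta>_def lcp_cond_def) 
      (intro D11_intros D11_real D11_leaf D11_leafw)+
  then show "D11 O\<^sub>0 (\<lambda>w e. H (e 0) (e 1))" by (simp add: W_def)
qed

lemma hyp_H: "hyp_le (H c) O\<^sub>0"
  by (rule D11_hyp_le) (intro D11_H Df_const Df_var)

section \<open>Covering bounds at the nodes\<close>

definition bnd :: "nat \<Rightarrow> cantor \<Rightarrow> bool" where
  "bnd c x \<longleftrightarrow> (\<forall>n<lookup c 0. \<exists>f. (\<forall>i. Suc i < len c \<longrightarrow> f i \<le> lookup c (Suc i)) \<and> (\<forall>k. \<Gamma> (\<Phi> x n) n k x f))"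

text \<open>The factor 2 undoes the averaging in \<open>leafM\<close>, \<open>1 / 2 ^ p\<close> pays
  for the contradictory points of a leaf, and \<open>\<delta>\<close> leaves room for limits. A node
  controls only the bits below \<open>lookup c 0\<close>, hence the restriction on
  \<open>k\<close>.\<close>

definition dominates :: "nat \<Rightarrow> (nat \<Rightarrow> nat \<Rightarrow> real) \<Rightarrow> bool" where
  "dominates c M \<longleftrightarrow> (\<forall>k V \<delta>. k \<le> lookup c 0 \<longrightarrow> V \<subseteq> {..<2^k} \<longrightarrow> \<delta> > 0 \<longrightarrow>
     covered {x. x \<in> X \<and> x \<in> N \<and> bnd c x \<and> str (\<Phi> x) k \<in> V} (2 * (\<Sum>s\<in>V. M k (Suc s) - M k s) + 1 / 2^p + \<delta>))"

lemma codes_leafM: "codes (leafw c) (leafM c)"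
  unfolding codes_def
proof (intro allI impI)
  fix k s a b :: nat
  let ?L = "len c + K"
  have "leafw c (cut_code k s a b) \<longleftrightarrow> 2 * a * 2^?L * 2^k < 2^b * (cnt c k s * 2^k + s * 2^?L)"
    unfolding leafw_def by simp
  also have "\<dots> \<longleftrightarrow> real (2 * a * 2^?L * 2^k) < real (2^b * (cnt c k s * 2^k + s * 2^?L))"
    by (rule of_nat_less_iff[symmetric])
  also have "\<dots> \<longleftrightarrow> a / 2^b < leafM c k s"
    unfolding leafM_def by (simp add: field_simps)
  finally have "leafw c (cut_code k s a b) \<longleftrightarrow> a / 2^b < leafM c k s" .
  then show "(leafw c (cut_code k s a b) \<longrightarrow> a / 2^b \<le> leafM c k s) \<and> (\<not> leafw c (cut_code k s a b) \<longrightarrow> leafM c k s \<le> a / 2^b)"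
    by auto
qed

lemma cnt_mono: "s \<le> t \<Longrightarrow> cnt c k s \<le> cnt c k t"
  unfolding cnt_def by (rule card_mono) auto

lemma dyadic_cdf_leafM: "dyadic_cdf (leafM c)"
  unfolding dyadic_cdf_def
proof (intro allI conjI impI)
  fix k s :: nat
  show "leafM c k 0 = 0" by (simp add: leafM_def cnt_def)
  have "cnt c k (2^k) = 2^(len c + K)" by (simp add: cnt_def str_less)
  then show "leafM c k (2^k) = 1" by (simp add: leafM_def)
  have "str y (Suc k) < 2 * s \<longleftrightarrow> str y k < s" for y by auto
  then have "cnt c (Suc k) (2 * s) = cnt c k s" unfolding cnt_def by (simp only:)
  then show "leafM c (Suc k) (2 * s) = leafM c k s" by (simp add: leafM_def)
  have "real (cnt c k s) / 2^(len c + K) \<le> real (cnt c k (Suc s)) / 2^(len c + K)"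
    by (intro divide_right_mono) (simp_all add: cnt_mono)
  then show "leafM c k s + 1 / 2^Suc k \<le> leafM c k (Suc s)"
    unfolding leafM_def by (simp add: add_divide_distrib)
qed

lemma card_str_sum:
  assumes "finite V"
  shows "card {t::nat. t < 2^(len c + K) \<and> str (\<lambda>n. P True c n (bit t)) k \<in> V} = (\<Sum>s\<in>V. real (cnt c k (Suc s)) - real (cnt c k s))"
  using assms
proof (induction V rule: finite_induct)
  case (insert s V)
  let ?T = "\<lambda>V. {t::nat. t < 2^(len c + K) \<and> str (\<lambda>n. P True c n (bit t)) k \<in> V}"
  have "?T (insert s V) = ?T {s} \<union> ?T V" by auto
  moreover have "?T {s} \<inter> ?T V = {}" using insert by auto
  ultimately have "card (?T (insert s V)) = card (?T {s}) + card (?T V)" by (simp add: card_Un_disjoint)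
  moreover have "?T {..<Suc s} = ?T {s} \<union> ?T {..<s}" by auto
  then have "card (?T {..<Suc s}) = card (?T {s}) + card (?T {..<s})" 
    by (simp only:) (rule card_Un_disjoint, auto)
  then have "cnt c k (Suc s) = card (?T {s}) + cnt c k s" unfolding cnt_def by simp
  ultimately show ?case using insert by simp
qed simp

text \<open>A point of the set either has contradictory answers, which is cheap at a leaf, or its
  guessed bits are the true ones, so that \<open>cnt\<close> accounts for it.\<close>

lemma dominates_leafM:
  assumes "leaf c"
  shows "dominates c (leafM c)"
  unfolding dominates_def
proof (intro allI impI)
  fix k and V :: "nat set" and \<delta> :: real
  assume k: "k \<le> lookup c 0" and V: "V \<subseteq> {..<2^k}" and \<delta>: "\<delta> > 0"
  have fin: "finite V" using V finite_subset by blast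
  let ?S = "{x. str (\<lambda>n. P True c n x) k \<in> V}"
  have dS: "dets (len c + K) ?S"
    unfolding dets_def
  proof (intro allI impI)
    fix x x' :: cantor assume *: "\<forall>i<len c + K. x i = x' i" "x \<in> ?S"
    then have "(\<lambda>n. P True c n x) = (\<lambda>n. P True c n x')" by (intro ext P_cong) auto
    with * show "x' \<in> ?S" by simp
  qed
  have "measure cantor_measure ?S = (\<Sum>s\<in>V. real (cnt c k (Suc s)) - real (cnt c k s)) / 2^(len c + K)"
    unfolding dets_measure(2)[OF dS] using card_str_sum[OF fin, of c k] by simp
  also have "\<dots> = (\<Sum>s\<in>V. (real (cnt c k (Suc s)) - real (cnt c k s)) / 2^(len c + K))"
    by (rule sum_divide_distrib)
  also have "\<dots> \<le> (\<Sum>s\<in>V. 2 * (leafM c k (Suc s) - leafM c k s))"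
    by (rule sum_mono) (simp add: leafM_def diff_divide_distrib add_divide_distrib)
  finally have mS: "measure cantor_measure ?S \<le> 2 * (\<Sum>s\<in>V. leafM c k (Suc s) - leafM c k s)"
    by (simp add: sum_distrib_left)
  let ?R = "{x. x \<in> N \<and> Q c x}"
  have sub: "{x. x \<in> X \<and> x \<in> N \<and> bnd c x \<and> str (\<Phi> x) k \<in> V} \<subseteq> ?R \<union> ?S"
  proof
    fix x assume "x \<in> {x. x \<in> X \<and> x \<in> N \<and> bnd c x \<and> str (\<Phi> x) k \<in> V}"
    then have x: "x \<in> N" "bnd c x" "str (\<Phi> x) k \<in> V" by auto
    show "x \<in> ?R \<union> ?S"
    proof (cases "Q c x")
      case False
      have PP: "P (\<Phi> x n) c n x" if n: "n < lookup c 0" for n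
      proof -
        obtain f where f: "\<forall>i. Suc i < len c \<longrightarrow> f i \<le> lookup c (Suc i)" "\<And>k. \<Gamma> (\<Phi> x n) n k x f"
          using x(2) n unfolding bnd_def by blast
        \<comment> \<open>A finite code can stand in for \<open>f\<close>, because the stages below
          \<open>len c\<close> see only its first values.\<close>
        obtain d where d: "\<forall>i<len c. lookup d i = f i" using lookup_realize by blast
        have "\<Gamma> (\<Phi> x n) n k x (lookup d)" if "k < len c" for k
          using f(2)[of k] local[of k x x f "lookup d" "\<Phi> x n" n] d that by simp
        with d f(1) show ?thesis unfolding P_def by (intro exI[of _ d]) auto
      qed
      have "P True c n x = \<Phi> x n" if n: "n < lookup c 0" for n
        using PP[OF n] False n unfolding Q_def by (cases "\<Phi> x n") auto
      then have "str (\<lambda>n. P True c n x) k = str (\<Phi> x) k"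
        using k by (intro str_cong) auto
      with x show ?thesis by simp
    qed (use x in simp)
  qed
  have "measure cantor_measure (?R \<union> ?S) \<le> measure cantor_measure ?R + measure cantor_measure ?S"
    by (rule measure_Un_le) (rule dets_measure(1)[OF dets_Q(1)], rule dets_measure(1)[OF dS])
  then have "measure cantor_measure (?R \<union> ?S) \<le> 2 * (\<Sum>s\<in>V. leafM c k (Suc s) - leafM c k s) + 1 / 2^p + \<delta>"
    using mS assms \<delta> unfolding leaf_iff by linarith
  moreover have "?R \<union> ?S \<in> sets cantor_measure"
    using dets_measure(1)[OF dets_Q(1)[of c]] dets_measure(1)[OF dS] by blast
  ultimately show "covered {x. x \<in> X \<and> x \<in> N \<and> bnd c x \<and> str (\<Phi> x) k \<in> V} (2 * (\<Sum>s\<in>V. leafM c k (Suc s) - leafM c k s) + 1 / 2^p + \<delta>)"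
    unfolding covered_def using sub by blast
qed

text \<open>There are at most \<open>2 ^ k\<close> increments, each with two endpoints that are off
  by at most \<open>\<delta> / (4 * 2 ^ k)\<close>.\<close>

lemma increments_close:
  fixes L M :: "nat \<Rightarrow> nat \<Rightarrow> real"
  assumes "V \<subseteq> {..<2^k}" "\<And>s. s \<le> 2^k \<Longrightarrow> \<bar>M k s - L k s\<bar> \<le> \<delta> / (4 * 2^k)"
  shows "(\<Sum>s\<in>V. M k (Suc s) - M k s) \<le> (\<Sum>s\<in>V. L k (Suc s) - L k s) + \<delta> / 2"
proof -
  have "(\<Sum>s\<in>V. M k (Suc s) - M k s) \<le> (\<Sum>s\<in>V. (L k (Suc s) - L k s) + \<delta> / (2 * 2^k))"
  proof (rule sum_mono)
    fix s assume "s \<in> V"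
    then have "s \<le> 2^k" "Suc s \<le> 2^k" using assms(1) by auto
    from this[THEN assms(2)] show "M k (Suc s) - M k s \<le> (L k (Suc s) - L k s) + \<delta> / (2 * 2^k)"
      by (simp add: abs_le_iff)
  qed
  also have "\<dots> = (\<Sum>s\<in>V. L k (Suc s) - L k s) + card V * (\<delta> / (2 * 2^k))"
    by (simp add: sum.distrib)
  also have "card V * (\<delta> / (2 * 2^k)) \<le> 2^k * (\<delta> / (2 * 2^k))"
  proof (rule mult_right_mono)
    have "card V \<le> 2^k" using card_mono[OF _ assms(1)] by simp
    then show "real (card V) \<le> 2^k" by (metis of_nat_le_iff of_nat_numeral of_nat_power)
    have "0 \<le> \<delta> / (4 * 2^k)" using order_trans[OF abs_ge_zero assms(2)[of 0]] by simp
    moreover have "\<delta> / (2 * 2^k) = 2 * (\<delta> / (4 * 2^k))" by simp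
    ultimately show "0 \<le> \<delta> / (2 * 2^k)" by linarith
  qed
  finally show ?thesis by simp
qed

lemma bnd_child: "0 < len c \<Longrightarrow> bnd c x \<Longrightarrow> \<exists>i. bnd (ncons i c) x"
proof -
  assume c: "0 < len c" and "bnd c x"
  then obtain f where f: "\<And>n i. n < lookup c 0 \<Longrightarrow> Suc i < len c \<Longrightarrow> f n i \<le> lookup c (Suc i)"
    "\<And>n k. n < lookup c 0 \<Longrightarrow> \<Gamma> (\<Phi> x n) n k x (f n)" unfolding bnd_def by metis
  \<comment> \<open>Entry 0 of a node holds \<open>j\<close>, so the new entry \<open>len c\<close>
    bounds the witness value at \<open>len c - 1\<close>. The sum bounds it for all of the finitely
    many bits at once.\<close>
  define i where "i = (\<Sum>n<lookup c 0. f n (len c - 1))"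
  have i: "f n (len c - 1) \<le> i" if "n < lookup c 0" for n
    unfolding i_def using member_le_sum[of n "{..<lookup c 0}" "\<lambda>n. f n (len c - 1)"] that by simp
  have "bnd (ncons i c) x" unfolding bnd_def
  proof (intro allI impI)
    fix n assume "n < lookup (ncons i c) 0"
    then have n: "n < lookup c 0" using c by simp
    show "\<exists>f. (\<forall>j. Suc j < len (ncons i c) \<longrightarrow> f j \<le> lookup (ncons i c) (Suc j)) \<and> (\<forall>k. \<Gamma> (\<Phi> x n) n k x f)"
    proof (intro exI[of _ "f n"] conjI allI impI)
      fix j assume "Suc j < len (ncons i c)"
      then have "Suc j < len c \<or> Suc j = len c \<and> j = len c - 1" by auto
      then show "f n j \<le> lookup (ncons i c) (Suc j)"
        using f(1)[OF n, of j] i[OF n] by (elim disjE conjE) simp_all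
    qed (rule f(2)[OF n])
  qed
  then show ?thesis by blast
qed

lemma bnd_mono:
  assumes "i \<le> i'" "0 < len c" "bnd (ncons i c) x"
  shows "bnd (ncons i' c) x"
  unfolding bnd_def
proof (intro allI impI)
  fix n assume "n < lookup (ncons i' c) 0"
  then have "n < lookup (ncons i c) 0" using assms(2) by simp
  then obtain f where f: "\<And>j. Suc j < len (ncons i c) \<Longrightarrow> f j \<le> lookup (ncons i c) (Suc j)" "\<And>k. \<Gamma> (\<Phi> x n) n k x f"
    using assms(3) unfolding bnd_def by metis
  have "f j \<le> lookup (ncons i' c) (Suc j)" if "Suc j < len (ncons i' c)" for j
    using f(1)[of j] that assms(1) by (auto split: if_splits)
  with f(2) show "\<exists>f. (\<forall>j. Suc j < len (ncons i' c) \<longrightarrow> f j \<le> lookup (ncons i' c) (Suc j)) \<and> (\<forall>k. \<Gamma> (\<Phi> x n) n k x f)"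
    by blast
qed

lemma node_measure: "\<exists>M. codes (H c) M \<and> dyadic_cdf M \<and> (0 < len c \<longrightarrow> dominates c M)"
proof (induction c rule: wf_induct_rule[OF wf_tree])
  case (1 c)
  show ?case
  proof (cases "leaf c")
    case True
    then show ?thesis using codes_leafM dyadic_cdf_leafM dominates_leafM H_eq[of c] by (intro exI[of _ "leafM c"]) simp
  next
    case False
    then have "\<exists>M. codes (H (ncons i c)) M \<and> dyadic_cdf M \<and> dominates (ncons i c) M" for i
      using 1[of "ncons i c"] by auto
    then obtain M where M: "\<And>i. codes (H (ncons i c)) (M i)" "\<And>i. dyadic_cdf (M i)" "\<And>i. dominates (ncons i c) (M i)"
      by metis
    obtain L where L: "codes (lcp (\<lambda>i. H (ncons i c))) L" "dyadic_cdf L"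
      "\<And>k \<delta> N. \<delta> > 0 \<Longrightarrow> \<exists>i\<ge>N. \<forall>k'\<le>k. \<forall>s\<le>2^k'. \<bar>M i k' s - L k' s\<bar> \<le> \<delta>"
      using codes_lcp[of "\<lambda>i. H (ncons i c)" M, OF M(1,2)] by blast
    have "dominates c L" if c: "0 < len c" unfolding dominates_def
    proof (intro allI impI)
      fix k and V :: "nat set" and \<delta> :: real
      assume k: "k \<le> lookup c 0" and V: "V \<subseteq> {..<2^k}" and \<delta>: "\<delta> > 0"
      let ?B = "2 * (\<Sum>s\<in>V. L k (Suc s) - L k s) + 1 / 2^p + \<delta>"
      define Y where "Y i = {x. x \<in> X \<and> x \<in> N \<and> bnd (ncons i c) x \<and> str (\<Phi> x) k \<in> V}" for i
      have "incseq Y" unfolding incseq_def Y_def using bnd_mono[OF _ c] by blast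
      moreover have "covered (Y i) ?B" for i
      proof -
        have "\<delta>/2 / (4 * 2^k) > 0" using \<delta> by simp
        \<comment> \<open>\<open>L\<close> is only a cluster point, so closeness is available merely
          at some later \<open>i'\<close>; as \<open>Y\<close> increases, a bound for
          \<open>Y i'\<close> also serves \<open>Y i\<close>.\<close>
        from L(3)[OF this, of i k] obtain i' where i': "i' \<ge> i" 
          "\<And>s. s \<le> 2^k \<Longrightarrow> \<bar>M i' k s - L k s\<bar> \<le> \<delta>/2 / (4 * 2^k)" by blast
        have "covered (Y i') (2 * (\<Sum>s\<in>V. M i' k (Suc s) - M i' k s) + 1 / 2^p + \<delta>/2)"
          using M(3)[of i'] k V \<delta> c unfolding dominates_def Y_def by simp
        moreover have "Y i \<subseteq> Y i'" using \<open>incseq Y\<close> i'(1) unfolding incseq_def by blast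
        moreover have "(\<Sum>s\<in>V. M i' k (Suc s) - M i' k s) \<le> (\<Sum>s\<in>V. L k (Suc s) - L k s) + \<delta>/2/2"
          by (rule increments_close[where M = "M i'" and L = L and k = k and \<delta> = "\<delta>/2", OF V i'(2)])
        ultimately show ?thesis by (elim covered_mono) auto
      qed
      ultimately have "covered (\<Union>i. Y i) ?B" by (rule covered_incseq)
      then show "covered {x. x \<in> X \<and> x \<in> N \<and> bnd c x \<and> str (\<Phi> x) k \<in> V} ?B"
        by (rule covered_mono) (use bnd_child[OF c] in \<open>auto simp: Y_def\<close>)
    qed
    then show ?thesis using L(1,2) H_eq[of c] False by (intro exI[of _ L]) simp
  qed
qed

text \<open>The child \<open>ncons j 0\<close> of the root fixes \<open>j\<close> but bounds no
  witness, so \<open>bnd\<close> holds for every point of \<open>X\<close>. It controls the first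
  \<open>j\<close> bits; the cluster point over \<open>j\<close> controls all of them.\<close>

theorem hyp_measure:
  obtains w M where "hyp_le w (\<lambda>_. False)" "codes w M" "dyadic_cdf M"
    "\<And>k V \<delta>. V \<subseteq> {..<2^k} \<Longrightarrow> \<delta> > 0 \<Longrightarrow>
       covered {x. x \<in> X \<and> x \<in> N \<and> str (\<Phi> x) k \<in> V} (2 * (\<Sum>s\<in>V. M k (Suc s) - M k s) + 1 / 2^p + \<delta>)"
proof -
  obtain M where M: "\<And>j. codes (H (ncons j 0)) (M j)" "\<And>j. dyadic_cdf (M j)" "\<And>j. dominates (ncons j 0) (M j)"
    using node_measure[of "ncons _ 0"] by (metis len_simps(2) zero_less_Suc)
  obtain L where L: "codes (lcp (\<lambda>i. H (ncons i 0))) L" "dyadic_cdf L"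
    "\<And>k \<delta> N. \<delta> > 0 \<Longrightarrow> \<exists>i\<ge>N. \<forall>k'\<le>k. \<forall>s\<le>2^k'. \<bar>M i k' s - L k' s\<bar> \<le> \<delta>"
    using codes_lcp[of "\<lambda>i. H (ncons i 0)" M, OF M(1,2)] by blast
  have "\<not> leaf 0" by (simp add: leaf_def)
  then have H0: "H 0 = lcp (\<lambda>i. H (ncons i 0))" using H_eq[of 0] by simp
  have "covered {x. x \<in> X \<and> x \<in> N \<and> str (\<Phi> x) k \<in> V} (2 * (\<Sum>s\<in>V. L k (Suc s) - L k s) + 1 / 2^p + \<delta>)"
    if V: "V \<subseteq> {..<2^k}" and \<delta>: "\<delta> > 0" for k V \<delta>
  proof -
    have "\<delta>/2 / (4 * 2^k) > 0" using \<delta> by simp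
    from L(3)[OF this, of k k] obtain j where j: "j \<ge> k" 
      "\<And>s. s \<le> 2^k \<Longrightarrow> \<bar>M j k s - L k s\<bar> \<le> \<delta>/2 / (4 * 2^k)" by blast
    have "covered {x. x \<in> X \<and> x \<in> N \<and> bnd (ncons j 0) x \<and> str (\<Phi> x) k \<in> V} (2 * (\<Sum>s\<in>V. M j k (Suc s) - M j k s) + 1 / 2^p + \<delta>/2)"
      using M(3)[of j] j(1) V \<delta> unfolding dominates_def by simp
    moreover have "bnd (ncons j 0) x" if "x \<in> X" for x
      using \<Phi>[OF that] unfolding bnd_def by simp
    then have "{x. x \<in> X \<and> x \<in> N \<and> str (\<Phi> x) k \<in> V} \<subseteq> {x. x \<in> X \<and> x \<in> N \<and> bnd (ncons j 0) x \<and> str (\<Phi> x) k \<in> V}" by blast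
    moreover have "(\<Sum>s\<in>V. M j k (Suc s) - M j k s) \<le> (\<Sum>s\<in>V. L k (Suc s) - L k s) + \<delta>/2/2"
      by (rule increments_close[where M = "M j" and L = L and k = k and \<delta> = "\<delta>/2", OF V j(2)])
    ultimately show ?thesis by (elim covered_mono) auto
  qed
  then show ?thesis using that[of "H 0" L] hyp_H[of 0] H0 L(1,2) by simp
qed

end

section \<open>Quantiles and hyperdegrees\<close>

lemma ex_dyadic_between:
  fixes u v :: real
  assumes "0 \<le> u" "u < v"
  obtains a b :: nat where "u < a / 2^b" "a / 2^b < v"
proof -
  obtain b where b: "(1/2)^b < v - u" using real_arch_pow_inv[of "v - u" "1/2"] assms by auto
  define a where "a = nat \<lfloor>u * 2^b\<rfloor> + 1"
  have "real (nat \<lfloor>u * 2^b\<rfloor>) = \<lfloor>u * 2^b\<rfloor>" using assms(1) by simp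
  then have "real a > u * 2^b" "real a \<le> u * 2^b + 1" unfolding a_def of_nat_add by linarith+
  then have "u < a / 2^b" "a / 2^b \<le> u + 1 / 2^b" by (simp_all add: field_simps)
  moreover have "u + 1 / 2^b < v" using b by (simp add: power_divide)
  ultimately show ?thesis using that[of a b] by linarith
qed

lemma dyadic_less_iff: "real a / 2^b < real a' / 2^b' \<longleftrightarrow> a * 2^b' < a' * 2^b"
proof -
  have "real a / 2^b < real a' / 2^b' \<longleftrightarrow> real (a * 2^b') < real (a' * 2^b)" by (simp add: field_simps)
  then show ?thesis by (simp only: of_nat_less_iff)
qed

text \<open>At a cut equal to \<open>M k s\<close> a code is arbitrary. Strict comparisons are
  recovered by asking for a second dyadic number strictly in between.\<close>

definition cut_below :: "cantor \<Rightarrow> nat \<Rightarrow> nat \<Rightarrow> nat \<Rightarrow> nat \<Rightarrow> bool" where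
  "cut_below w k s a b \<longleftrightarrow> (\<exists>a' b'. a * 2^b' < a' * 2^b \<and> w (cut_code k s a' b'))"

definition cut_above :: "cantor \<Rightarrow> nat \<Rightarrow> nat \<Rightarrow> nat \<Rightarrow> nat \<Rightarrow> bool" where
  "cut_above w k s a b \<longleftrightarrow> (\<exists>a' b'. a' * 2^b < a * 2^b' \<and> \<not> w (cut_code k s a' b'))"

lemma cut_below_iff:
  assumes "codes w M" "dyadic_cdf M" "s \<le> 2^k"
  shows "cut_below w k s a b \<longleftrightarrow> a / 2^b < M k s"
proof
  assume "cut_below w k s a b"
  then obtain a' b' where "real a / 2^b < real a' / 2^b'" "w (cut_code k s a' b')"
    unfolding cut_below_def dyadic_less_iff by blast
  moreover from this(2) have "a' / 2^b' \<le> M k s" using assms(1,3) unfolding codes_def by blast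
  ultimately show "a / 2^b < M k s" by linarith
next
  assume "a / 2^b < M k s"
  then obtain a' b' :: nat where ab: "a / 2^b < a' / 2^b'" "a' / 2^b' < M k s"
    using ex_dyadic_between[of "a / 2^b" "M k s"] by auto
  then have "w (cut_code k s a' b')" using assms(1,3) unfolding codes_def by (meson not_le)
  with ab(1) show "cut_below w k s a b" unfolding cut_below_def dyadic_less_iff by blast
qed

lemma cut_above_iff:
  assumes "codes w M" "dyadic_cdf M" "s \<le> 2^k"
  shows "cut_above w k s a b \<longleftrightarrow> M k s < a / 2^b"
proof
  assume "cut_above w k s a b"
  then obtain a' b' where "real a' / 2^b' < real a / 2^b" "\<not> w (cut_code k s a' b')"
    unfolding cut_above_def dyadic_less_iff by blast
  moreover from this(2) have "M k s \<le> a' / 2^b'" using assms(1,3) unfolding codes_def by blast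
  ultimately show "M k s < a / 2^b" by linarith
next
  assume "M k s < a / 2^b"
  then obtain a' b' :: nat where ab: "M k s < a' / 2^b'" "a' / 2^b' < a / 2^b"
    using ex_dyadic_between[of "M k s" "a / 2^b"] dyadic_cdf_bounds(1)[OF assms(2,3)] by blast
  then have "\<not> w (cut_code k s a' b')" using assms(1,3) unfolding codes_def by (meson not_le)
  with ab(2) show "cut_above w k s a b" unfolding cut_above_def dyadic_less_iff by blast
qed

lemma D11_cut:
  assumes "hyp_le w (\<lambda>_. False)" "Df x f" "Df x g" "Df x h" "Df x d"
  shows "D11 x (\<lambda>u e. cut_below w (f u e) (g u e) (h u e) (d u e))"
    and "D11 x (\<lambda>u e. cut_above w (f u e) (g u e) (h u e) (d u e))"
proof -
  have w: "Df x f \<Longrightarrow> D11 x (\<lambda>u e. w (f u e))" for f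
    by (rule D11_rel1[OF D11_mono]) (intro hyp_le_D11 assms Df_var)
  show "D11 x (\<lambda>u e. cut_below w (f u e) (g u e) (h u e) (d u e))"
    unfolding cut_below_def by (intro D11_intros Df_power w Df_rename[OF assms(2)] Df_rename[OF assms(3)]
        Df_rename[OF assms(4)] Df_rename[OF assms(5)])
  show "D11 x (\<lambda>u e. cut_above w (f u e) (g u e) (h u e) (d u e))"
    unfolding cut_above_def by (intro D11_intros Df_power w Df_rename[OF assms(2)] Df_rename[OF assms(3)]
        Df_rename[OF assms(4)] Df_rename[OF assms(5)])
qed

text \<open>The intervals from \<open>M k (str y k)\<close> to \<open>M k (Suc (str y k))\<close>
  are nested: a True bit moves the left end, a False bit the right end.\<close>

lemma dyadic_cdf_path_mono:
  assumes "dyadic_cdf M"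
  shows "M k (str y k) \<le> M (Suc k) (str y (Suc k))" "M (Suc k) (Suc (str y (Suc k))) \<le> M k (Suc (str y k))"
    and "y k \<Longrightarrow> M k (str y k) < M (Suc k) (str y (Suc k))"
    and "\<not> y k \<Longrightarrow> M (Suc k) (Suc (str y (Suc k))) < M k (Suc (str y k))"
proof -
  have lt: "str y k < 2^k" by (rule str_less)
  have L: "M k (str y k) = M (Suc k) (2 * str y k)" and R: "M k (Suc (str y k)) = M (Suc k) (2 * Suc (str y k))"
    using assms lt unfolding dyadic_cdf_def by (metis Suc_leI less_imp_le_nat)+
  show "M k (str y k) \<le> M (Suc k) (str y (Suc k))"
    unfolding L by (rule dyadic_cdf_mono[OF assms]) (use lt in auto)
  show "M (Suc k) (Suc (str y (Suc k))) \<le> M k (Suc (str y k))"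
    unfolding R by (rule dyadic_cdf_mono[OF assms]) (use lt in auto)
  show "M k (str y k) < M (Suc k) (str y (Suc k))" if "y k"
    unfolding L by (rule dyadic_cdf_strict[OF assms]) (use lt that in auto)
  show "M (Suc k) (Suc (str y (Suc k))) < M k (Suc (str y k))" if "\<not> y k"
    unfolding R by (rule dyadic_cdf_strict[OF assms]) (use lt that in auto)
qed

lemma dyadic_cdf_path_incseq:
  assumes "dyadic_cdf M"
  shows "incseq (\<lambda>k. M k (str y k))" "decseq (\<lambda>k. M k (Suc (str y k)))"
  using dyadic_cdf_path_mono[OF assms] by (auto intro!: incseq_SucI decseq_SucI simp del: str.simps)

text \<open>The cells of one level meet at most in endpoints, so only one has \<open>r\<close>
  strictly inside. Its number is \<open>str y (Suc k)\<close>, whose parity is the bit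
  \<open>y k\<close>; comparing \<open>r\<close> with the values of \<open>M\<close> thus determines
  \<open>y\<close>.\<close>

lemma hyp_le_squeezed:
  assumes M: "dyadic_cdf M" and r: "\<And>k. M k (str y k) < r" "\<And>k. r < M k (Suc (str y k))"
    and B: "D11 x (\<lambda>w e. B (e 0) (e 1))" "\<And>k s. s \<le> 2^k \<Longrightarrow> B k s \<longleftrightarrow> M k s < r"
    and C: "D11 x (\<lambda>w e. C (e 0) (e 1))" "\<And>k s. s \<le> 2^k \<Longrightarrow> C k s \<longleftrightarrow> r < M k s"
  shows "hyp_le y x"
proof -
  have y: "y k \<longleftrightarrow> (\<exists>q. Suc (q + q) < 2^Suc k \<and> B (Suc k) (Suc (q + q)) \<and> C (Suc k) (Suc (Suc (q + q))))" (is "_ \<longleftrightarrow> ?R") for k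
  proof
    assume "y k"
    then have s: "str y (Suc k) = Suc (str y k + str y k)" by simp
    show ?R
      using r[of "Suc k"] str_less[of y "Suc k"] unfolding s by (intro exI[of _ "str y k"]) (simp add: B(2) C(2) del: power_Suc)
  next
    assume ?R
    then obtain q where q: "Suc (q + q) < 2^Suc k" "M (Suc k) (Suc (q + q)) < r" "r < M (Suc k) (Suc (Suc (q + q)))"
      using B(2)[of _ "Suc k"] C(2)[of _ "Suc k"] by (metis Suc_leI less_imp_le_nat)
    let ?s = "Suc (q + q)" and ?t = "str y (Suc k)"
    have "\<not> ?s < ?t"
      using dyadic_cdf_mono[OF M, of "Suc ?s" ?t "Suc k"] q(3) r(1)[of "Suc k"] str_less[of y "Suc k"] by (auto simp del: str.simps)
    moreover have "\<not> ?t < ?s"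
      using dyadic_cdf_mono[OF M, of "Suc ?t" ?s "Suc k"] q(1,2) r(2)[of "Suc k"] by (auto simp del: str.simps)
    ultimately have "?s = ?t" by linarith
    then show "y k" by (cases "y k") (simp_all, presburger)
  qed
  have "D11 x (\<lambda>w e. \<exists>q. Suc (q + q) < 2^Suc (e 0) \<and> B (Suc (e 0)) (Suc (q + q)) \<and> C (Suc (e 0)) (Suc (Suc (q + q))))"
    by (intro D11_intros Df_power D11_rel2[OF B(1)] D11_rel2[OF C(1)])
  then show ?thesis by (intro D11_hyp_le) (simp only: y)
qed

lemma hyp_eventually_const:
  assumes "\<And>m. k \<le> m \<Longrightarrow> y m = b"
  shows "hyperarithmetic y"
proof -
  let ?S = "{i. i < k \<and> y i}"
  have y: "y n \<longleftrightarrow> (\<exists>s\<in>?S. n = s) \<or> (k \<le> n \<and> b)" for n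
    using assms[of n] by (cases "k \<le> n") auto
  have "D11 (\<lambda>_. False) (\<lambda>w e. (\<exists>s\<in>?S. e 0 = s) \<or> (k \<le> e 0 \<and> b))"
    by (intro D11_finite_ex D11_intros) simp
  then show ?thesis unfolding hyperarithmetic_def by (intro D11_hyp_le) (subst y)
qed

lemma str_binary_digits:
  fixes r :: real
  assumes "0 \<le> r" "r < 1"
  defines "z \<equiv> \<lambda>i. odd (nat \<lfloor>2^Suc i * r\<rfloor>)"
  shows "str z k / 2^k \<le> r" "r < Suc (str z k) / 2^k"
proof -
  have fl: "\<lfloor>2 * u\<rfloor> = 2 * \<lfloor>u\<rfloor> \<or> \<lfloor>2 * u\<rfloor> = 2 * \<lfloor>u\<rfloor> + 1" for u :: real by linarith
  have "int (str z k) = \<lfloor>2^k * r\<rfloor>"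
  proof (induction k)
    case 0
    have "\<lfloor>r\<rfloor> = 0" using assms(1,2) by linarith
    then show ?case by simp
  next
    case (Suc k)
    have nonneg: "0 \<le> \<lfloor>2^Suc k * r\<rfloor>" using assms(1) by simp
    have "z k \<longleftrightarrow> odd \<lfloor>2^Suc k * r\<rfloor>" unfolding z_def using nonneg by (simp add: even_nat_iff)
    moreover have "\<lfloor>2^Suc k * r\<rfloor> = 2 * \<lfloor>2^k * r\<rfloor> \<or> \<lfloor>2^Suc k * r\<rfloor> = 2 * \<lfloor>2^k * r\<rfloor> + 1"
      using fl[of "2^k * r"] by (simp add: mult.assoc)
    ultimately show ?case using Suc by auto
  qed
  then have "real (str z k) = \<lfloor>2^k * r\<rfloor>" by (metis of_int_of_nat_eq)
  then have "real (str z k) \<le> 2^k * r" "2^k * r < real (str z k) + 1" by linarith+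
  then show "str z k / 2^k \<le> r" "r < Suc (str z k) / 2^k" by (simp_all add: field_simps)
qed

text \<open>The assumption on \<open>y\<close> enters twice. Both bit values recur, so
  \<open>r\<close> is strictly inside every cell along \<open>y\<close>. And the cells shrink to
  \<open>r\<close>: otherwise some dyadic number would lie inside all of them, and
  \<open>hyp_le_squeezed\<close> would make \<open>y\<close> hyperarithmetic.\<close>

lemma quantile_degree:
  assumes w: "hyp_le w (\<lambda>_. False)" and codes: "codes w M" and M: "dyadic_cdf M" and y: "\<not> hyperarithmetic y"
  obtains z r where "hyp_equiv y z"
    "\<And>v. r < v \<Longrightarrow> \<exists>k. M k (Suc (str y k)) < v" "\<And>v. v < r \<Longrightarrow> \<exists>k. v < M k (str y k)"
    "\<And>k. str z k / 2^k \<le> r" "\<And>k. r < Suc (str z k) / 2^k"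
proof -
  let ?L = "\<lambda>k. M k (str y k)" and ?R = "\<lambda>k. M k (Suc (str y k))"
  have le: "str y k \<le> 2^k" "Suc (str y k) \<le> 2^k" for k
    using str_less[of y k] by auto
  have LR: "?L k < ?R l" for k l
  proof -
    have "?L k \<le> ?L (max k l)" using dyadic_cdf_path_incseq(1)[OF M, of y] unfolding incseq_def by simp
    also have "\<dots> < ?R (max k l)" by (rule dyadic_cdf_strict[OF M]) (use le in auto)
    also have "\<dots> \<le> ?R l" using dyadic_cdf_path_incseq(2)[OF M, of y] unfolding decseq_def by simp
    finally show ?thesis .
  qed
  have inf: "\<exists>m\<ge>k. y m = b" for k b
    using hyp_eventually_const[of k y "\<not> b"] y by blast
  define r where "r = (SUP k. ?L k)"
  have bdd: "bdd_above (range ?L)" using LR[of _ 0] by (intro bdd_aboveI[of _ "?R 0"]) (auto intro: less_imp_le)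
  have Lr': "?L k \<le> r" for k unfolding r_def by (rule cSUP_upper[OF _ bdd]) simp
  have rR': "r \<le> ?R k" for k unfolding r_def by (rule cSUP_least) (use LR[of _ k] in \<open>auto intro: less_imp_le\<close>)
  have Lr: "?L k < r" for k
  proof -
    obtain m where m: "m \<ge> k" "y m" using inf[of k True] by blast
    have "?L k \<le> ?L m" using dyadic_cdf_path_incseq(1)[OF M, of y] m(1) unfolding incseq_def by simp
    also have "\<dots> < ?L (Suc m)" using dyadic_cdf_path_mono(3)[where y = y and k = m, OF M m(2)] .
    also have "\<dots> \<le> r" by (rule Lr')
    finally show ?thesis .
  qed
  have rR: "r < ?R k" for k
  proof -
    obtain m where m: "m \<ge> k" "\<not> y m" using inf[of k False] by blast
    have "r \<le> ?R (Suc m)" by (rule rR')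
    also have "\<dots> < ?R m" using dyadic_cdf_path_mono(4)[where y = y and k = m, OF M m(2)] .
    also have "\<dots> \<le> ?R k" using dyadic_cdf_path_incseq(2)[OF M, of y] m(1) unfolding decseq_def by simp
    finally show ?thesis .
  qed
  have "?L 0 = 0" "?R 0 = 1" using M unfolding dyadic_cdf_def by (simp, metis One_nat_def power_0 str.simps(1))
  with Lr[of 0] rR[of 0] have r01: "0 < r" "r < 1" by simp_all
  have no_dyadic: False if q: "\<And>k. ?L k < real a / 2^b" "\<And>k. real a / 2^b < ?R k" for a b
  proof -
    have "hyp_le y (\<lambda>_. False)"
    proof (rule hyp_le_squeezed[OF M q])
      show "D11 (\<lambda>_. False) (\<lambda>u e. cut_above w (e 0) (e 1) a b)" "D11 (\<lambda>_. False) (\<lambda>u e. cut_below w (e 0) (e 1) a b)"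
        by (intro D11_cut w Df_var Df_const)+
    qed (simp_all add: cut_above_iff[OF codes M] cut_below_iff[OF codes M])
    with y show False unfolding hyperarithmetic_def by blast
  qed
  have Rlim: "\<exists>k. ?R k < v" if v: "r < v" for v
  proof (rule ccontr)
    assume *: "\<not> (\<exists>k. ?R k < v)"
    obtain a b :: nat where ab: "r < a / 2^b" "a / 2^b < v" using ex_dyadic_between[of r v] r01 v by auto
    show False
    proof (rule no_dyadic)
      show "?L k < real a / 2^b" for k using Lr'[of k] ab(1) by linarith
      show "real a / 2^b < ?R k" for k using * ab(2) by (meson less_le_trans not_less)
    qed
  qed
  have Llim: "\<exists>k. v < ?L k" if "v < r" for v
    using that unfolding r_def by (subst (asm) less_cSUP_iff[OF _ bdd]) auto
  define z where "z = (\<lambda>i. odd (nat \<lfloor>2^Suc i * r\<rfloor>))"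
  have z: "str z k / 2^k \<le> r" "r < Suc (str z k) / 2^k" for k
    unfolding z_def using str_binary_digits[of r k] r01 by simp_all
  have "hyp_le z y"
  proof (rule D11_hyp_le)
    \<comment> \<open>The right ends of the cells tend to \<open>r\<close> from above, so from
      \<open>y\<close> they decide \<open>r < a / 2 ^ b\<close>, and with it the digits of
      \<open>r\<close>.\<close>
    define B where "B a b \<longleftrightarrow> (\<exists>k. cut_above w k (Suc (str y k)) a b)" for a b
    have B: "B a b \<longleftrightarrow> r < a / 2^b" for a b
      unfolding B_def cut_above_iff[OF codes M le(2)] using Rlim[of "a / 2^b"] rR less_trans by blast
    have zi: "z i \<longleftrightarrow> (\<exists>q. \<not> B (Suc (q + q)) (Suc i) \<and> B (Suc (Suc (q + q))) (Suc i))" for i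
    proof
      assume "z i"
      then have "str z (Suc i) = Suc (str z i + str z i)" by simp
      with z[of "Suc i"] show "\<exists>q. \<not> B (Suc (q + q)) (Suc i) \<and> B (Suc (Suc (q + q))) (Suc i)"
        unfolding B by (metis not_less)
    next
      assume "\<exists>q. \<not> B (Suc (q + q)) (Suc i) \<and> B (Suc (Suc (q + q))) (Suc i)"
      then obtain q where q: "real (Suc (q + q)) / 2^Suc i \<le> r" "r < real (Suc (Suc (q + q))) / 2^Suc i"
        unfolding B not_less by blast
      then have "real (Suc (q + q)) \<le> 2^Suc i * r" "2^Suc i * r < real (Suc (q + q)) + 1"
        by (simp_all add: field_simps)
      then have "\<lfloor>2^Suc i * r\<rfloor> = int (Suc (q + q))" by linarith
      then have "nat \<lfloor>2^Suc i * r\<rfloor> = Suc (q + q)" by (simp only: nat_int)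
      then show "z i" unfolding z_def by simp
    qed
    have "D11 y (\<lambda>w e. y (e 0))" by (intro D11_param Df_var)
    then have DB: "D11 y (\<lambda>u e. B (e 0) (e 1))"
      unfolding B_def by (intro D11_intros D11_cut w Df_str)
    have "D11 y (\<lambda>u e. \<exists>q. \<not> B (Suc (q + q)) (Suc (e 0)) \<and> B (Suc (Suc (q + q))) (Suc (e 0)))"
      by (intro D11_intros D11_rel2[OF DB])
    then show "D11 y (\<lambda>w e. z (e 0))" by (simp only: zi)
  qed
  moreover have "hyp_le y z"
  proof (rule hyp_le_squeezed[OF M Lr rR])
    have Dz: "D11 z (\<lambda>w e. z (e 0))" by (intro D11_param Df_var)
    \<comment> \<open>The digits locate \<open>r\<close> up to \<open>1 / 2 ^ i\<close>, which
      settles strict comparisons with \<open>M k s\<close>.\<close>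
    show "D11 z (\<lambda>u e. \<exists>i. cut_above w (e 0) (e 1) (str z i) i)"
      "D11 z (\<lambda>u e. \<exists>i. cut_below w (e 0) (e 1) (Suc (str z i)) i)"
      by (intro D11_intros D11_cut w Df_str Dz)+
    fix k s :: nat assume s: "s \<le> 2^k"
    have small: "\<exists>i. (1/2)^i < \<delta>" if "\<delta> > 0" for \<delta> :: real
      using real_arch_pow_inv[OF that, of "1/2"] by auto
    show "(\<exists>i. cut_above w k s (str z i) i) \<longleftrightarrow> M k s < r"
    proof
      assume "M k s < r"
      then obtain i where "(1/2)^i < r - M k s" using small[of "r - M k s"] by auto
      then have "M k s < str z i / 2^i" using z(2)[of i] by (simp add: power_divide add_divide_distrib)
      then show "\<exists>i. cut_above w k s (str z i) i" unfolding cut_above_iff[OF codes M s] by blast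
    qed (unfold cut_above_iff[OF codes M s], use z(1) less_le_trans in blast)
    show "(\<exists>i. cut_below w k s (Suc (str z i)) i) \<longleftrightarrow> r < M k s"
    proof
      assume "r < M k s"
      then obtain i where "(1/2)^i < M k s - r" using small[of "M k s - r"] by auto
      then have "Suc (str z i) / 2^i < M k s" using z(1)[of i] by (simp add: power_divide add_divide_distrib)
      then show "\<exists>i. cut_below w k s (Suc (str z i)) i" unfolding cut_below_iff[OF codes M s] by blast
    qed (unfold cut_below_iff[OF codes M s], use z(2) less_trans in blast)
  qed
  ultimately show ?thesis using that[of z r] Rlim Llim z unfolding hyp_equiv_def by blast
qed

section \<open>The upward closure of a null set\<close>

lemma sum_increments_le:
  fixes M :: "nat \<Rightarrow> real"
  assumes mono: "\<And>s t. s \<le> t \<Longrightarrow> t \<le> n \<Longrightarrow> M s \<le> M t" and V: "V \<subseteq> {..<n}"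
    and ab: "\<And>s. s \<in> V \<Longrightarrow> a \<le> M s" "\<And>s. s \<in> V \<Longrightarrow> M (Suc s) \<le> b" "a \<le> b"
  shows "(\<Sum>s\<in>V. M (Suc s) - M s) \<le> b - a"
proof (cases "V = {}")
  case False
  have fin: "finite V" using V finite_subset by blast
  have mm: "Min V \<in> V" "Max V \<in> V" using fin False by auto
  have "(\<Sum>s\<in>V. M (Suc s) - M s) \<le> (\<Sum>s=Min V..Max V. M (Suc s) - M s)"
  proof (rule sum_mono2)
    show "V \<subseteq> {Min V..Max V}" using fin by auto
    fix s assume "s \<in> {Min V..Max V} - V"
    then have "s < n" using mm V by auto
    then show "0 \<le> M (Suc s) - M s" using mono[of s "Suc s"] by simp
  qed simp
  also have "\<dots> = M (Suc (Max V)) - M (Min V)"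
    using fin mm by (intro sum_Suc_diff) (simp add: le_SucI)
  also have "\<dots> \<le> b - a" using ab(1)[OF mm(1)] ab(2)[OF mm(2)] by linarith
  finally show ?thesis .
qed (use ab in simp)

lemma sum_UN_le:
  fixes g :: "'a \<Rightarrow> real"
  assumes "finite T" "\<And>t. t \<in> T \<Longrightarrow> finite (V t)" "\<And>t s. t \<in> T \<Longrightarrow> s \<in> V t \<Longrightarrow> 0 \<le> g s"
  shows "sum g (\<Union>t\<in>T. V t) \<le> (\<Sum>t\<in>T. sum g (V t))"
  using assms
proof (induction T rule: finite_induct)
  case (insert t T)
  have "sum g (V t \<union> (\<Union>t\<in>T. V t)) = sum g (V t) + sum g (\<Union>t\<in>T. V t) - sum g (V t \<inter> (\<Union>t\<in>T. V t))"
    using insert by (intro sum_Un) auto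
  moreover have "0 \<le> sum g (V t \<inter> (\<Union>t\<in>T. V t))" using insert.prems by (intro sum_nonneg) auto
  ultimately show ?case using insert by fastforce
qed simp

text \<open>This is the uniform distribution of \<open>z\<close>. Points with \<open>z x\<close> in
  a dyadic cell of \<open>U\<close> are caught by increments of \<open>M\<close> inside that cell
  widened to three times its length; \<open>dom\<close> doubles the bound, hence 6.\<close>

lemma covered_of_small_open:
  assumes M: "dyadic_cdf M" and U: "measure cantor_measure U \<le> \<delta>" "opn U" and "0 < \<delta>" "0 \<le> \<epsilon>"
    and dom: "\<And>k V. V \<subseteq> {..<2^k} \<Longrightarrow> covered {x \<in> X. str (\<Phi> x) k \<in> V} (2 * (\<Sum>s\<in>V. M k (Suc s) - M k s) + \<epsilon>)"
    and z: "\<And>x. x \<in> X \<Longrightarrow> z x \<in> U"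
    and r: "\<And>x v. x \<in> X \<Longrightarrow> r x < v \<Longrightarrow> \<exists>k. M k (Suc (str (\<Phi> x) k)) < v"
      "\<And>x v. x \<in> X \<Longrightarrow> v < r x \<Longrightarrow> \<exists>k. v < M k (str (\<Phi> x) k)"
      "\<And>x k. x \<in> X \<Longrightarrow> str (z x) k / 2^k \<le> r x" "\<And>x k. x \<in> X \<Longrightarrow> r x < Suc (str (z x) k) / 2^k"
  shows "covered X (6 * \<delta> + \<epsilon>)"
proof -
  define Y where "Y k = {x \<in> X. z x \<in> inner_cyl U k}" for k
  have "covered (Y k) (6 * \<delta> + \<epsilon>)" for k
  proof -
    \<comment> \<open>\<open>bit\<close> reads the least significant bit first; \<open>str\<close>
      turns the pattern into the number of its dyadic cell.\<close>
    define T where "T = (\<lambda>t::nat. str (bit t) k) ` {t. t < 2^k \<and> bit t \<in> inner_cyl U k}"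
    \<comment> \<open>\<open>r x\<close> may be the left end of its cell \<open>t\<close>. It is
      interior to the widened interval, so the cells of \<open>M\<close> that shrink to it
      eventually lie inside.\<close>
    define lo where "lo t = (real t - 1) / 2^k" for t
    define hi where "hi t = (real t + 2) / 2^k" for t
    define V where "V l t = {s. s < 2^l \<and> lo t < M l s \<and> M l (Suc s) < hi t}" for l t
    have finT: "finite T" unfolding T_def by simp
    have "card T / 2^k \<le> card {t. t < 2^k \<and> bit (t::nat) \<in> inner_cyl U k} / 2^k"
      unfolding T_def by (intro divide_right_mono) (simp_all add: card_image_le)
    also have "\<dots> = measure cantor_measure (inner_cyl U k)"
      by (rule dets_measure(2)[OF dets_inner_cyl, symmetric])
    also have "\<dots> \<le> measure cantor_measure U"
      by (rule cantor.finite_measure_mono[OF inner_cyl_subset opn_measurable[OF U(2)]])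
    finally have card: "card T / 2^k \<le> \<delta>" using U(1) by linarith
    have S: "(\<Sum>s\<in>(\<Union>t\<in>T. V l t). M l (Suc s) - M l s) \<le> 3 * \<delta>" for l
    proof -
      have "(\<Sum>s\<in>(\<Union>t\<in>T. V l t). M l (Suc s) - M l s) \<le> (\<Sum>t\<in>T. \<Sum>s\<in>V l t. M l (Suc s) - M l s)"
        by (rule sum_UN_le[OF finT]) (auto simp: V_def intro!: dyadic_cdf_mono[OF M])
      also have "\<dots> \<le> (\<Sum>t\<in>T. hi t - lo t)"
      proof (rule sum_mono)
        fix t
        have "lo t \<le> hi t" unfolding lo_def hi_def by (intro divide_right_mono) auto
        then show "(\<Sum>s\<in>V l t. M l (Suc s) - M l s) \<le> hi t - lo t"
          by (intro sum_increments_le[where n = "2^l"] dyadic_cdf_mono[OF M]) (auto simp: V_def)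
      qed
      also have "\<dots> = 3 * (card T / 2^k)"
        unfolding lo_def hi_def diff_divide_distrib[symmetric] by simp
      finally show ?thesis using card by linarith
    qed
    have C: "covered {x \<in> X. str (\<Phi> x) l \<in> (\<Union>t\<in>T. V l t)} (2 * (\<Sum>s\<in>(\<Union>t\<in>T. V l t). M l (Suc s) - M l s) + \<epsilon>)" for l
      by (rule dom) (auto simp: V_def)
    have "covered {x \<in> X. str (\<Phi> x) l \<in> (\<Union>t\<in>T. V l t)} (6 * \<delta> + \<epsilon>)" for l
      by (rule covered_mono[OF C order_refl]) (use S[of l] in linarith)
    moreover have "incseq (\<lambda>l. {x \<in> X. str (\<Phi> x) l \<in> (\<Union>t\<in>T. V l t)})"
    proof (rule incseq_SucI, rule subsetI)
      fix l x assume "x \<in> {x \<in> X. str (\<Phi> x) l \<in> (\<Union>t\<in>T. V l t)}"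
      then obtain t where "x \<in> X" "t \<in> T" "str (\<Phi> x) l \<in> V l t" by blast
      moreover from this(3) have "str (\<Phi> x) (Suc l) \<in> V (Suc l) t"
        unfolding V_def using dyadic_cdf_path_mono(1,2)[OF M, of l "\<Phi> x"] str_less[of "\<Phi> x" "Suc l"] 
        by (auto simp del: str.simps)
      ultimately show "x \<in> {x \<in> X. str (\<Phi> x) (Suc l) \<in> (\<Union>t\<in>T. V (Suc l) t)}" by blast
    qed
    ultimately have cov: "covered (\<Union>l. {x \<in> X. str (\<Phi> x) l \<in> (\<Union>t\<in>T. V l t)}) (6 * \<delta> + \<epsilon>)"
      by (intro covered_incseq)
    show ?thesis
    proof (rule covered_mono[OF cov _ order_refl], rule subsetI)
      fix x assume "x \<in> Y k"
      then have x: "x \<in> X" "z x \<in> inner_cyl U k" unfolding Y_def by auto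
      define t where "t = str (z x) k"
      obtain b where b: "b < 2^k" "\<forall>i<k. bit (b::nat) i = z x i" using ex_bits by blast
      then have "bit b \<in> inner_cyl U k" using x(2) dets_inner_cyl[of k U] unfolding dets_def by metis
      moreover have "str (bit b) k = t" unfolding t_def using b(2) by (intro str_cong) auto
      ultimately have "t \<in> T" unfolding T_def using b(1) by blast
      have "t / 2^k \<le> r x" "r x < Suc t / 2^k" unfolding t_def using r(3,4)[OF x(1)] by blast+
      moreover have "lo t < t / 2^k" "Suc t / 2^k < hi t" unfolding lo_def hi_def by (simp_all add: divide_strict_right_mono)
      ultimately have "lo t < r x" "r x < hi t" by linarith+
      then obtain l1 l2 where l: "lo t < M l1 (str (\<Phi> x) l1)" "M l2 (Suc (str (\<Phi> x) l2)) < hi t"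
        using r(1,2)[OF x(1)] by metis
      let ?l = "max l1 l2"
      have "M l1 (str (\<Phi> x) l1) \<le> M ?l (str (\<Phi> x) ?l)" "M ?l (Suc (str (\<Phi> x) ?l)) \<le> M l2 (Suc (str (\<Phi> x) l2))"
        using dyadic_cdf_path_incseq[OF M, of "\<Phi> x"] unfolding incseq_def decseq_def by simp_all
      then have "str (\<Phi> x) ?l \<in> V ?l t" unfolding V_def using l str_less[of "\<Phi> x" ?l] by auto
      with x(1) \<open>t \<in> T\<close> show "x \<in> (\<Union>l. {x \<in> X. str (\<Phi> x) l \<in> (\<Union>t\<in>T. V l t)})" by blast
    qed
  qed
  moreover have "incseq Y" unfolding Y_def incseq_def using incseq_inner_cyl[of U] unfolding incseq_def by blast
  ultimately have "covered (\<Union>k. Y k) (6 * \<delta> + \<epsilon>)" by (intro covered_incseq)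
  then show ?thesis
    by (rule covered_mono[OF _ _ order_refl]) (use z UN_inner_cyl[OF U(2)] in \<open>auto simp: Y_def\<close>)
qed

lemma null_if_covered:
  assumes "\<And>\<delta>. \<delta> > 0 \<Longrightarrow> covered X \<delta>"
  shows "null X"
proof -
  have "covered X (1 / Suc n)" for n by (rule assms) simp
  then obtain W where W: "\<And>n. W n \<in> sets cantor_measure" "\<And>n. X \<subseteq> W n" "\<And>n. measure cantor_measure (W n) \<le> 1 / Suc n"
    unfolding covered_def by metis
  have mW: "(\<Inter>n. W n) \<in> sets cantor_measure" using W(1) by blast
  have "measure cantor_measure (\<Inter>n. W n) \<le> 1 / Suc n" for n
    by (rule order_trans[OF cantor.finite_measure_mono W(3)[of n]]) (use W(1) in auto)
  then have "measure cantor_measure (\<Inter>n. W n) \<le> 0"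
    using LIMSEQ_le_const[OF LIMSEQ_inverse_real_of_nat] by (simp add: inverse_eq_divide)
  then have "measure cantor_measure (\<Inter>n. W n) = 0" by (intro antisym measure_nonneg)
  then have "emeasure cantor_measure (\<Inter>n. W n) = 0"
    by (simp add: cantor.emeasure_eq_measure)
  then show ?thesis unfolding null_def using mW W(2) by blast
qed

lemma null_UN:
  fixes X :: "'a::countable \<Rightarrow> cantor set"
  assumes "\<And>i. null (X i)"
  shows "null (\<Union>i. X i)"
proof -
  obtain B where B: "\<And>i. B i \<in> null_sets cantor_measure" "\<And>i. X i \<subseteq> B i"
    using assms unfolding null_def null_sets_def by (metis (mono_tags, lifting) mem_Collect_eq)
  have "(\<Union>i. B i) \<in> null_sets cantor_measure"
    using B(1) by (intro null_sets_UN') auto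
  then show ?thesis unfolding null_def null_sets_def using B(2) by blast
qed

text \<open>The quantified real and the Skolem function merge into one \<open>f\<close>: column 0
  codes \<open>Z\<close>, column 1 the Skolem function. Delaying stage \<open>j\<close> to
  \<open>prod_encode (1, j)\<close> ensures that stage \<open>k\<close> reads only the first
  \<open>k\<close> values of \<open>f\<close>.\<close>

definition closed_matrix :: "fm \<Rightarrow> bool \<Rightarrow> nat \<Rightarrow> nat \<Rightarrow> cantor \<Rightarrow> (nat \<Rightarrow> nat) \<Rightarrow> bool" where
  "closed_matrix \<phi> b n k x f \<longleftrightarrow> (\<forall>j. k = prod_encode (1, j) \<longrightarrow>
     clo \<phi> b j x (\<lambda>i. f (prod_encode (0, i)) \<noteq> 0) (\<lambda>i. f (prod_encode (1, i))) (push n (\<lambda>_. 0)))"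

lemma closed_matrix: "(\<exists>f. \<forall>k. closed_matrix \<phi> b n k x f) \<longleftrightarrow> (\<exists>Z. sat x Z (push n (\<lambda>_. 0)) \<phi> = b)"
proof
  assume "\<exists>f. \<forall>k. closed_matrix \<phi> b n k x f"
  then obtain f where "\<And>j. clo \<phi> b j x (\<lambda>i. f (prod_encode (0, i)) \<noteq> 0) (\<lambda>i. f (prod_encode (1, i))) (push n (\<lambda>_. 0))"
    unfolding closed_matrix_def by blast
  then show "\<exists>Z. sat x Z (push n (\<lambda>_. 0)) \<phi> = b" unfolding sat_clo by blast
next
  assume "\<exists>Z. sat x Z (push n (\<lambda>_. 0)) \<phi> = b"
  then obtain Z f where "\<And>k. clo \<phi> b k x Z f (push n (\<lambda>_. 0))" unfolding sat_clo by blast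
  then show "\<exists>f. \<forall>k. closed_matrix \<phi> b n k x f"
    unfolding closed_matrix_def
    by (intro exI[of _ "\<lambda>m. case prod_decode m of (a, i) \<Rightarrow> if a = 0 then (if Z i then 1 else 0) else f i"]) simp
qed

lemma closed_matrix_local:
  assumes "\<And>i. i < k \<Longrightarrow> x i = x' i" "\<And>i. i < k \<Longrightarrow> f i = f' i"
  shows "closed_matrix \<phi> b n k x f = closed_matrix \<phi> b n k x' f'"
proof -
  have "clo \<phi> b j x (\<lambda>i. f (prod_encode (0, i)) \<noteq> 0) (\<lambda>i. f (prod_encode (1, i))) e =
    clo \<phi> b j x' (\<lambda>i. f' (prod_encode (0, i)) \<noteq> 0) (\<lambda>i. f' (prod_encode (1, i))) e"
    if k: "k = prod_encode (1, j)" for j e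
  proof (rule clo_local)
    fix i assume "i < j"
    have "triangle j \<le> triangle (Suc j)" by simp
    then have "prod_encode (0, j) < k" unfolding k by (simp add: prod_encode_def)
    then have "prod_encode (0, i) < k" "prod_encode (1, i) < k" "i < k"
      using prod_encode_less[OF \<open>i < j\<close>, of 0] prod_encode_less[OF \<open>i < j\<close>, of 1] le_prod_encode_2[of j 1] \<open>i < j\<close> k by auto
    then show "x i = x' i" "(f (prod_encode (0, i)) \<noteq> 0) = (f' (prod_encode (0, i)) \<noteq> 0)"
      "f (prod_encode (1, i)) = f' (prod_encode (1, i))"
      using assms by auto
  qed
  then show ?thesis unfolding closed_matrix_def by blast
qed

lemma D11_closed_matrix:
  assumes "Df x f" "Df x g" "Df x h" "Df x d"
  shows "D11 x (\<lambda>w e. closed_matrix \<phi> b (f w e) (g w e) (bit (h w e)) (lookup (d w e)))"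
proof -
  have p: "Df x (\<lambda>w e. push (f w e) (\<lambda>_. 0) i)" if "Df x f" for f i
    by (cases i) (simp_all add: that Df_const)
  show ?thesis unfolding closed_matrix_def
    by (intro D11_intros D11_clo p D11_bit Df_lookup Df_rename[OF assms(1)] Df_rename[OF assms(2)]
        Df_rename[OF assms(3)] Df_rename[OF assms(4)])
qed

lemma null_reduction:
  fixes A :: "cantor set"
  assumes "null A" and closed: "\<And>x y. x \<in> A \<Longrightarrow> hyp_equiv x y \<Longrightarrow> y \<in> A"
    and nonhyp: "\<And>x. x \<in> A \<Longrightarrow> \<not> hyperarithmetic x"
  shows "null {x. \<exists>y\<in>A. \<forall>n. (y n \<longleftrightarrow> (\<exists>Z. sat x Z (push n (\<lambda>_. 0)) \<phi>)) \<and> (y n \<longleftrightarrow> (\<forall>Z. sat x Z (push n (\<lambda>_. 0)) \<psi>))}"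
    (is "null ?X")
proof (rule ccontr)
  assume not_null: "\<not> null ?X"
  define \<Phi> where "\<Phi> x = (\<lambda>n. \<exists>Z. sat x Z (push n (\<lambda>_. 0)) \<phi>)" for x
  have \<Phi>A: "\<Phi> x \<in> A" "\<And>n. \<Phi> x n \<longleftrightarrow> (\<forall>Z. sat x Z (push n (\<lambda>_. 0)) \<psi>)" if x: "x \<in> ?X" for x
  proof -
    obtain y where "y \<in> A" and y: "\<And>n. y n \<longleftrightarrow> (\<exists>Z. sat x Z (push n (\<lambda>_. 0)) \<phi>)"
      "\<And>n. y n \<longleftrightarrow> (\<forall>Z. sat x Z (push n (\<lambda>_. 0)) \<psi>)" using x by blast
    moreover from y(1) have "\<Phi> x = y" unfolding \<Phi>_def by (intro ext) simp
    ultimately show "\<Phi> x \<in> A" "\<And>n. \<Phi> x n \<longleftrightarrow> (\<forall>Z. sat x Z (push n (\<lambda>_. 0)) \<psi>)" by blast+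
  qed
  \<comment> \<open>The outer measure, since \<open>?X\<close> need not be measurable.\<close>
  define m where "m = Inf {b. covered ?X b}"
  have ne: "covered ?X 1" unfolding covered_def using sets.top[of cantor_measure] cantor.prob_le_1 by auto
  have nonneg: "0 \<le> b" if "covered ?X b" for b
    using that unfolding covered_def by (meson measure_nonneg order_trans)
  have m_le: "m \<le> b" if "covered ?X b" for b
    unfolding m_def by (rule cInf_lower) (use that nonneg in \<open>auto intro!: bdd_belowI[of _ 0]\<close>)
  have m_app: "\<exists>b. covered ?X b \<and> b < v" if "m < v" for v
    using cInf_lessD[of "{b. covered ?X b}" v] ne that unfolding m_def by blast
  have "m > 0"
  proof (rule ccontr)
    assume "\<not> m > 0"
    then have "covered ?X \<delta>" if "\<delta> > 0" for \<delta>
      using m_app[of \<delta>] that covered_mono[of ?X _ ?X \<delta>] by force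
    then show False using not_null null_if_covered by blast
  qed
  \<comment> \<open>The losses will be \<open>6 * \<epsilon> + 2 * \<epsilon>\<close> inside
    \<open>N\<close> and \<open>\<epsilon>\<close> on \<open>E - N\<close>, so
    \<open>\<epsilon>\<close> has to stay below \<open>m / 9\<close>; 16 leaves room.\<close>
  then obtain p where "(1/2)^p < m / 16" using real_arch_pow_inv[of "m / 16" "1/2"] by auto
  then have p: "1 / 2^p < m / 16" by (simp add: power_divide)
  define \<epsilon> :: real where "\<epsilon> = 1 / 2^p"
  have \<epsilon>: "\<epsilon> > 0" unfolding \<epsilon>_def by simp
  obtain b where b: "covered ?X b" "b < m + \<epsilon>/2" using m_app[of "m + \<epsilon>/2"] \<epsilon> by auto
  then obtain W where W: "W \<in> sets cantor_measure" "?X \<subseteq> W" "measure cantor_measure W < m + \<epsilon>/2"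
    unfolding covered_def by (meson le_less_trans)
  obtain E where E: "opn E" "W \<subseteq> E" "measure cantor_measure E < measure cantor_measure W + \<epsilon>/2"
    using ex_open_cover[OF W(1), of "\<epsilon>/2"] \<epsilon> by auto
  have E_lt: "measure cantor_measure E < m + \<epsilon>" using E(3) W(3) by linarith
  have mE: "E \<in> sets cantor_measure" by (rule opn_measurable[OF E(1)])
  have mN: "inner_cyl E k \<in> sets cantor_measure" for k by (rule dets_measure(1)[OF dets_inner_cyl])
  have "(\<lambda>k. measure cantor_measure (inner_cyl E k)) \<longlonglongrightarrow> measure cantor_measure (\<Union>k. inner_cyl E k)"
    by (rule cantor.finite_Lim_measure_incseq) (use mN incseq_inner_cyl in blast)+
  from LIMSEQ_D[OF this[unfolded UN_inner_cyl[OF E(1)]] \<epsilon>]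
  obtain K where "norm (measure cantor_measure (inner_cyl E K) - measure cantor_measure E) < \<epsilon>" by blast
  then have K: "measure cantor_measure E - measure cantor_measure (inner_cyl E K) < \<epsilon>"
    unfolding real_norm_def by linarith
  define N where "N = inner_cyl E K"
  have EN: "measure cantor_measure (E - N) < \<epsilon>"
    using K mN mE inner_cyl_subset unfolding N_def by (subst cantor.finite_measure_Diff) auto
  \<comment> \<open>The value True is witnessed by a real satisfying \<open>\<phi>\<close>, the
    value False by a real refuting \<open>\<psi>\<close>; on \<open>?X\<close> exactly one of them
    exists.\<close>
  interpret pushforward "\<lambda>b. closed_matrix (if b then \<phi> else \<psi>) b" ?X N \<Phi> K p
  proof
    show "dets K N" unfolding N_def by (rule dets_inner_cyl)
    show "(\<exists>f. \<forall>k. closed_matrix (if b then \<phi> else \<psi>) b n k x f) \<longleftrightarrow> \<Phi> x n = b" if "x \<in> ?X" for x b n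
      unfolding closed_matrix using \<Phi>A(2)[OF that, of n] by (cases b) (auto simp: \<Phi>_def)
    show "measure cantor_measure (N \<inter> Q) < 1 / 2^p" if Q: "Q \<in> sets cantor_measure" "Q \<inter> ?X = {}" for Q
    proof -
      \<comment> \<open>\<open>E - Q\<close> still covers \<open>?X\<close>, so its measure is at
        least \<open>m\<close>, while that of \<open>E\<close> is below
        \<open>m + \<epsilon>\<close>.\<close>
      have "covered ?X (measure cantor_measure (E - Q))"
        unfolding covered_def using W(2) E(2) Q mE by (intro bexI[of _ "E - Q"]) auto
      then have "m \<le> measure cantor_measure (E - Q)" by (rule m_le)
      also have "\<dots> \<le> measure cantor_measure (E - N \<inter> Q)"
        by (rule cantor.finite_measure_mono) (use Q mE mN in \<open>auto simp: N_def\<close>)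
      also have "\<dots> = measure cantor_measure E - measure cantor_measure (N \<inter> Q)"
        using Q mE mN inner_cyl_subset[of E K] unfolding N_def by (subst cantor.finite_measure_Diff) auto
      finally show ?thesis using E_lt unfolding \<epsilon>_def by linarith
    qed
    show "closed_matrix (if b then \<phi> else \<psi>) b n k x f = closed_matrix (if b then \<phi> else \<psi>) b n k x' f'"
      if "\<And>i. i < k \<Longrightarrow> x i = x' i" "\<And>i. i < k \<Longrightarrow> f i = f' i" for b n k x x' f f'
      by (rule closed_matrix_local[OF that])
    show "D11 (\<lambda>_. False) (\<lambda>w e. closed_matrix (if b then \<phi> else \<psi>) b (f w e) (g w e) (bit (h w e)) (lookup (d w e)))"
      if "Df (\<lambda>_. False) f" "Df (\<lambda>_. False) g" "Df (\<lambda>_. False) h" "Df (\<lambda>_. False) d" for b f g h d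
      by (rule D11_closed_matrix[OF that])
  qed
  obtain w M where w: "hyp_le w (\<lambda>_. False)" "codes w M" "dyadic_cdf M"
    and dom: "\<And>k V \<delta>. V \<subseteq> {..<2^k} \<Longrightarrow> \<delta> > 0 \<Longrightarrow>
       covered {x. x \<in> ?X \<and> x \<in> N \<and> str (\<Phi> x) k \<in> V} (2 * (\<Sum>s\<in>V. M k (Suc s) - M k s) + 1 / 2^p + \<delta>)"
    by (rule hyp_measure) (rule that)
  define G where "G x z r \<longleftrightarrow> hyp_equiv (\<Phi> x) z \<and> (\<forall>v. r < v \<longrightarrow> (\<exists>k. M k (Suc (str (\<Phi> x) k)) < v)) \<and>
    (\<forall>v. v < r \<longrightarrow> (\<exists>k. v < M k (str (\<Phi> x) k))) \<and> (\<forall>k. str z k / 2^k \<le> r) \<and> (\<forall>k. r < Suc (str z k) / 2^k)" for x z r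
  have "\<forall>x\<in>?X. \<exists>q. G x (fst q) (snd q)"
  proof
    fix x assume x: "x \<in> ?X"
    obtain z r where "G x z r"
      unfolding G_def by (rule quantile_degree[OF w nonhyp[OF \<Phi>A(1)[OF x]]]) blast
    then show "\<exists>q. G x (fst q) (snd q)" by (intro exI[of _ "(z, r)"]) simp
  qed
  then obtain q where q: "\<forall>x\<in>?X. G x (fst (q x)) (snd (q x))" by (rule bchoice[THEN exE])
  define z r where "z x = fst (q x)" and "r x = snd (q x)" for x
  have G: "G x (z x) (r x)" if "x \<in> ?X" for x using q that unfolding z_def r_def by blast
  have zr: "\<And>x. x \<in> ?X \<Longrightarrow> hyp_equiv (\<Phi> x) (z x)"
    "\<And>x v. x \<in> ?X \<Longrightarrow> r x < v \<Longrightarrow> \<exists>k. M k (Suc (str (\<Phi> x) k)) < v"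
    "\<And>x v. x \<in> ?X \<Longrightarrow> v < r x \<Longrightarrow> \<exists>k. v < M k (str (\<Phi> x) k)"
    "\<And>x k. x \<in> ?X \<Longrightarrow> str (z x) k / 2^k \<le> r x"
    "\<And>x k. x \<in> ?X \<Longrightarrow> r x < Suc (str (z x) k) / 2^k"
    using G unfolding G_def by blast+
  obtain A' where A': "A' \<in> sets cantor_measure" "A \<subseteq> A'" "emeasure cantor_measure A' = 0"
    using \<open>null A\<close> unfolding null_def by blast
  then have "measure cantor_measure A' = 0" by (simp add: measure_def)
  then obtain U where U: "opn U" "A' \<subseteq> U" "measure cantor_measure U < \<epsilon>"
    using ex_open_cover[OF A'(1) \<epsilon>] by auto
  have "covered (?X \<inter> N) (6 * \<epsilon> + 2 * \<epsilon>)"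
  proof (rule covered_of_small_open[OF w(3) less_imp_le[OF U(3)] U(1) \<epsilon>, where \<Phi> = \<Phi> and z = z and r = r])
    fix k and V :: "nat set" assume "V \<subseteq> {..<2^k}"
    \<comment> \<open>One \<open>\<epsilon>\<close> is the error \<open>1 / 2 ^ p\<close>, the other
      is the \<open>\<delta>\<close> of \<open>dom\<close>.\<close>
    from dom[OF this \<epsilon>] show "covered {x \<in> ?X \<inter> N. str (\<Phi> x) k \<in> V} (2 * (\<Sum>s\<in>V. M k (Suc s) - M k s) + 2 * \<epsilon>)"
      by (rule covered_mono) (blast, simp add: \<epsilon>_def)
  next
    fix x assume "x \<in> ?X \<inter> N"
    then have x: "x \<in> ?X" by (rule IntD1)
    have "z x \<in> A" by (rule closed[OF \<Phi>A(1)[OF x] zr(1)[OF x]])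
    then show "z x \<in> U" using A'(2) U(2) by blast
  qed (use \<epsilon> in simp, (rule zr(2-5)[OF IntD1]; assumption)+)
  then obtain W' where W': "W' \<in> sets cantor_measure" "?X \<inter> N \<subseteq> W'" "measure cantor_measure W' \<le> 8 * \<epsilon>"
    unfolding covered_def by auto
  have mEN: "E - N \<in> sets cantor_measure" using mE mN unfolding N_def by blast
  have "measure cantor_measure (W' \<union> (E - N)) \<le> 9 * \<epsilon>"
    using measure_Un_le[OF W'(1) mEN] W'(3) EN by linarith
  moreover have "?X \<subseteq> W' \<union> (E - N)" using W'(2) W(2) E(2) by blast
  ultimately have "covered ?X (9 * \<epsilon>)" unfolding covered_def using W'(1) mEN by blast
  then have "m \<le> 9 * \<epsilon>" by (rule m_le)
  then show False using p \<open>m > 0\<close> unfolding \<epsilon>_def by linarith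
qed

instance trm :: countable by countable_datatype
instance fm :: countable by countable_datatype

theorem mainTheorem12:
  fixes A :: "cantor set"
  assumes "null A"
    and "\<And>x y. x \<in> A \<Longrightarrow> hyp_equiv x y \<Longrightarrow> y \<in> A"
    and "\<And>x. x \<in> A \<Longrightarrow> \<not> hyperarithmetic x"
  shows "null (upper_cone_h A)"
proof -
  let ?X = "\<lambda>\<phi> \<psi>. {x. \<exists>y\<in>A. \<forall>n. (y n \<longleftrightarrow> (\<exists>Z. sat x Z (push n (\<lambda>_. 0)) \<phi>)) \<and> (y n \<longleftrightarrow> (\<forall>Z. sat x Z (push n (\<lambda>_. 0)) \<psi>))}"
  have "null (\<Union>p. ?X (fst p) (snd p))"
    by (rule null_UN) (rule null_reduction[OF assms])
  moreover have "upper_cone_h A \<subseteq> (\<Union>p. ?X (fst p) (snd p))"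
  proof
    fix x assume "x \<in> upper_cone_h A"
    then obtain y \<phi> \<psi> where "y \<in> A" "\<forall>n. y n \<longleftrightarrow> (\<exists>Z. sat x Z (push n (\<lambda>_. 0)) \<phi>)" "\<forall>n. y n \<longleftrightarrow> (\<forall>Z. sat x Z (push n (\<lambda>_. 0)) \<psi>)"
      unfolding upper_cone_h_def hyp_le_def Sigma11_def Pi11_def by blast
    then have "x \<in> ?X (fst (\<phi>, \<psi>)) (snd (\<phi>, \<psi>))" by auto
    then show "x \<in> (\<Union>p. ?X (fst p) (snd p))" by blast
  qed
  ultimately show ?thesis unfolding null_def by (meson order_trans)
qed

end
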